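(* For every integer $k\ge 2$, it is NP-hard to decide whether a digraph $D=(V,E)$ is $k$-colorable, even when $D$ has a (directed) feedback vertex set of size $k$. Furthermore, this problem cannot be solved in time $2^{o(n)}$, where $n=|V|$, unless the Exponential Time Hypothesis is false.
   Context: Digraphs are loopless and have no parallel arcs, but two oppositely oriented arcs between the same pair of vertices (a digon) are allowed. A digraph $D$ is $k$-colorable if its vertices can be colored with $k$ colors so that each color class induces an acyclic subdigraph (no monochromatic directed cycle). A feedback vertex set of $D$ is a set $S\subseteq V$ such that $D-S$ is acyclic. The Exponential Time Hypothesis is used in the form: \textsc{3-SAT} with $n$ variables and $m$ clauses cannot be solved in time $2^{o(n+m)}$. *)

theory Defs
  imports
    "Graph_Theory.Graph_Theory"
    "HOL-Computational_Algebra.Polynomial"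
    "HOL-Library.Landau_Symbols"
begin

section \<open>Digraph colouring\<close>

definition acyclic_digraph :: "('a, 'b) pre_digraph \<Rightarrow> bool" where
  "acyclic_digraph D \<longleftrightarrow> \<not> (\<exists>p. pre_digraph.cycle D p)"

definition k_colorable :: "nat \<Rightarrow> ('a, 'b) pre_digraph \<Rightarrow> bool" where
  "k_colorable k D \<longleftrightarrow>
     (\<exists>c :: 'a \<Rightarrow> nat. c ` verts D \<subseteq> {..<k} \<and>
        (\<forall>i<k. acyclic_digraph (D \<restriction> {v \<in> verts D. c v = i})))"

definition feedback_vertex_set :: "('a, 'b) pre_digraph \<Rightarrow> 'a set \<Rightarrow> bool" where
  "feedback_vertex_set D S \<longleftrightarrow> S \<subseteq> verts D \<and> acyclic_digraph (D \<restriction> (verts D - S))"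


section \<open>Deterministic multi-tape Turing machines\<close>

text \<open>
  States and tape symbols are natural numbers below the bounds stored in the machine. Symbol 0 is
  the blank, 1 and 2 are the input bits and 3 separates the two parts of a verifier's input.
  Tapes are infinite in both directions. Tape 0 (the head of the tape list) holds the
  input and, for machines computing a function, the output.
\<close>

datatype move = Left | Stay | Right

record tm =
  tm_tapes :: nat
  tm_states :: nat
  tm_symbols :: nat
  tm_start :: nat
  tm_accept :: nat
  tm_reject :: nat
  tm_delta :: "nat \<Rightarrow> nat list \<Rightarrow> nat \<times> (nat \<times> move) list"

definition wf_tm :: "tm \<Rightarrow> bool" where
  "wf_tm M \<longleftrightarrow>
     1 \<le> tm_tapes M \<and> 4 \<le> tm_symbols M \<and>
     tm_start M < tm_states M \<and> tm_accept M < tm_states M \<and> tm_reject M < tm_states M \<and>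
     tm_accept M \<noteq> tm_reject M \<and>
     (\<forall>q rs. q < tm_states M \<and> length rs = tm_tapes M \<and> set rs \<subseteq> {..<tm_symbols M} \<longrightarrow>
        (case tm_delta M q rs of (q', as) \<Rightarrow>
           q' < tm_states M \<and> length as = tm_tapes M \<and> fst ` set as \<subseteq> {..<tm_symbols M}))"

text \<open>Tape contents together with the head position.\<close>
type_synonym tape = "(int \<Rightarrow> nat) \<times> int"

type_synonym config = "nat \<times> tape list"

fun move_offset :: "move \<Rightarrow> int" where
  "move_offset Left = -1"
| "move_offset Stay = 0"
| "move_offset Right = 1"

fun read_tape :: "tape \<Rightarrow> nat" where
  "read_tape (c, h) = c h"

fun act_tape :: "nat \<times> move \<Rightarrow> tape \<Rightarrow> tape" where
  "act_tape (s, d) (c, h) = (c(h := s), h + move_offset d)"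

definition halted :: "tm \<Rightarrow> config \<Rightarrow> bool" where
  "halted M c \<longleftrightarrow> fst c \<in> {tm_accept M, tm_reject M}"

definition tm_step :: "tm \<Rightarrow> config \<Rightarrow> config" where
  "tm_step M c =
     (if halted M c then c
      else case tm_delta M (fst c) (map read_tape (snd c)) of
        (q', as) \<Rightarrow> (q', map2 act_tape as (snd c)))"

definition word_tape :: "nat list \<Rightarrow> tape" where
  "word_tape w = (\<lambda>i. if 0 \<le> i \<and> i < int (length w) then w ! nat i else 0, 0)"

definition tm_init :: "tm \<Rightarrow> nat list \<Rightarrow> config" where
  "tm_init M w = (tm_start M, word_tape w # replicate (tm_tapes M - 1) (word_tape []))"

text \<open>The configuration after \<open>t\<close> steps; halted configurations are fixed points of \<open>tm_step\<close>.\<close>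
definition tm_run :: "tm \<Rightarrow> nat list \<Rightarrow> nat \<Rightarrow> config" where
  "tm_run M w t = (tm_step M ^^ t) (tm_init M w)"

definition bits :: "bool list \<Rightarrow> nat list" where
  "bits x = map (\<lambda>b. if b then 2 else 1) x"

definition pair_word :: "bool list \<Rightarrow> bool list \<Rightarrow> nat list" where
  "pair_word x y = bits x @ [3] @ bits y"


section \<open>Complexity\<close>

definition poly_time_computable :: "(bool list \<Rightarrow> bool list) \<Rightarrow> bool" where
  "poly_time_computable f \<longleftrightarrow>
     (\<exists>M (p :: nat poly). wf_tm M \<and>
        (\<forall>x. let c = tm_run M (bits x) (poly p (length x)) in
           halted M c \<and> hd (snd c) = word_tape (bits (f x))))"

definition NP :: "bool list set set" where
  "NP = {L. \<exists>M (p :: nat poly) (q :: nat poly). wf_tm M \<and>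
     (\<forall>x y. halted M (tm_run M (pair_word x y) (poly p (length x + length y)))) \<and>
     (\<forall>x. x \<in> L \<longleftrightarrow>
        (\<exists>y. length y \<le> poly q (length x) \<and>
           fst (tm_run M (pair_word x y) (poly p (length x + length y))) = tm_accept M))}"

text \<open>
  A decision problem consists of an encoding \<open>enc\<close>, a set \<open>I\<close> of admissible instances and a
  property \<open>P\<close> to be decided. Restricting \<open>I\<close> expresses hardness \<open>even when\<close> the
  instances satisfy the restriction: a reduction must produce instances from \<open>I\<close>, and an
  algorithm need only be correct and fast on \<open>I\<close>.
\<close>

definition NP_hard :: "('i \<Rightarrow> bool list) \<Rightarrow> 'i set \<Rightarrow> ('i \<Rightarrow> bool) \<Rightarrow> bool" where
  "NP_hard enc I P \<longleftrightarrow>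
     (\<forall>L\<in>NP. \<exists>f. poly_time_computable f \<and>
        (\<forall>x. \<exists>d\<in>I. f x = enc d \<and> (x \<in> L \<longleftrightarrow> P d)))"

definition solvable_in_time ::
  "('i \<Rightarrow> bool list) \<Rightarrow> 'i set \<Rightarrow> ('i \<Rightarrow> bool) \<Rightarrow> ('i \<Rightarrow> real) \<Rightarrow> bool" where
  "solvable_in_time enc I P T \<longleftrightarrow>
     (\<exists>M. wf_tm M \<and>
        (\<forall>d\<in>I. \<exists>t. real t \<le> T d \<and> halted M (tm_run M (bits (enc d)) t) \<and>
           (fst (tm_run M (bits (enc d)) t) = tm_accept M \<longleftrightarrow> P d)))"

text \<open>Solvable in time \<open>2\<^bsup>o(s)\<^esup>\<close>, where \<open>s\<close> is the size parameter of the instance.\<close>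
definition solvable_subexp ::
  "('i \<Rightarrow> bool list) \<Rightarrow> 'i set \<Rightarrow> ('i \<Rightarrow> bool) \<Rightarrow> ('i \<Rightarrow> nat) \<Rightarrow> bool" where
  "solvable_subexp enc I P s \<longleftrightarrow>
     (\<exists>f :: nat \<Rightarrow> real. f \<in> o(\<lambda>n. real n) \<and>
        solvable_in_time enc I P (\<lambda>d. 2 powr f (s d)))"


section \<open>3-SAT and the Exponential Time Hypothesis\<close>

text \<open>
  A literal is a variable with the truth value that satisfies it. A formula is the number \<open>n\<close>
  of its variables, which are \<open>0, \<dots>, n - 1\<close>, together with its list of clauses.
\<close>

type_synonym literal = "nat \<times> bool"
type_synonym cnf = "nat \<times> literal list list"

definition three_cnf :: "cnf set" where
  "three_cnf = {(n, cs). \<forall>C\<in>set cs. length C \<le> 3 \<and> fst ` set C \<subseteq> {..<n}}"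

definition satisfiable :: "cnf \<Rightarrow> bool" where
  "satisfiable \<phi> \<longleftrightarrow> (\<exists>\<sigma> :: nat \<Rightarrow> bool. \<forall>C\<in>set (snd \<phi>). \<exists>(v, b)\<in>set C. \<sigma> v = b)"

definition cnf_size :: "cnf \<Rightarrow> nat" where
  "cnf_size \<phi> = fst \<phi> + length (snd \<phi>)"

text \<open>
  Variables are written in unary. On \<open>three_cnf\<close> the length of the encoding is still
  polynomial in \<open>n + m\<close>, so this affects neither polynomial time nor time \<open>2\<^bsup>o(n+m)\<^esup>\<close>.
\<close>

fun encode_literal :: "literal \<Rightarrow> bool list" where
  "encode_literal (v, b) = [True, b] @ replicate v True @ [False]"

definition encode_clause :: "literal list \<Rightarrow> bool list" where
  "encode_clause C = concat (map encode_literal C) @ [False]"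

fun encode_cnf :: "cnf \<Rightarrow> bool list" where
  "encode_cnf (n, cs) = replicate n True @ [False] @ concat (map encode_clause cs)"

lemma replicate_True_False_eq:
  "replicate m True @ False # xs = replicate n True @ False # ys \<longleftrightarrow> m = n \<and> xs = ys"
proof (induction m arbitrary: n)
  case 0 then show ?case by (cases n) auto
next
  case (Suc m) then show ?case by (cases n) auto
qed

lemma encode_clause_append_eq:
  "encode_clause C @ xs = encode_clause C' @ ys \<longleftrightarrow> C = C' \<and> xs = ys"
proof (induction C arbitrary: C')
  case Nil then show ?case by (cases C') (auto simp: encode_clause_def)
next
  case (Cons l C)
  show ?case
  proof (cases C')
    case Nil then show ?thesis by (cases l) (auto simp: encode_clause_def)
  next
    case (Cons l' D)
    with Cons.IH[of D] show ?thesis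
      by (cases l; cases l') (auto simp: encode_clause_def replicate_True_False_eq)
  qed
qed

lemma inj_encode_cnf: "inj encode_cnf"
proof -
  have ne: "encode_clause C \<noteq> []" for C by (simp add: encode_clause_def)
  have "concat (map encode_clause cs) = concat (map encode_clause ds) \<Longrightarrow> cs = ds" for cs ds
  proof (induction cs arbitrary: ds)
    case Nil then show ?case by (cases ds) (auto simp: ne)
  next
    case (Cons C cs) then show ?case by (cases ds) (auto simp: ne encode_clause_append_eq)
  qed
  then show ?thesis by (auto intro!: injI simp: replicate_True_False_eq)
qed

definition ETH :: bool where
  "ETH \<longleftrightarrow> \<not> solvable_subexp encode_cnf three_cnf satisfiable cnf_size"


section \<open>Digraphs as problem instances\<close>

text \<open>Finite loopless digraphs without parallel arcs on the vertices \<open>0, \<dots>, n - 1\<close>.\<close>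
definition digraph_instances :: "nat pair_pre_digraph set" where
  "digraph_instances = {D. pair_digraph D \<and> pverts D = {..<card (pverts D)}}"

text \<open>The number of vertices in unary, followed by the rows of the adjacency matrix.\<close>
definition encode_digraph :: "nat pair_pre_digraph \<Rightarrow> bool list" where
  "encode_digraph D =
     (let n = card (pverts D)
      in replicate n True @ [False] @
         concat (map (\<lambda>u. map (\<lambda>v. (u, v) \<in> parcs D) [0..<n]) [0..<n]))"

lemma concat_map_upt_eq:
  fixes a b :: "nat \<Rightarrow> 'a list"
  assumes "concat (map a [0..<m]) = concat (map b [0..<m])"
    and "\<And>u. length (a u) = length (b u)" and "u < m"
  shows "a u = b u"
  using assms(1,3)
proof (induction m)
  case (Suc m)
  have "length (concat (map a [0..<m])) = length (concat (map b [0..<m]))"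
    by (simp add: length_concat o_def assms(2))
  with Suc show ?case by (auto simp: less_Suc_eq)
qed simp

lemma inj_on_encode_digraph: "inj_on encode_digraph digraph_instances"
proof (rule inj_onI)
  fix D E assume D: "D \<in> digraph_instances" and E: "E \<in> digraph_instances"
    and eq: "encode_digraph D = encode_digraph E"
  define n where "n = card (pverts D)"
  from eq have n: "card (pverts E) = n"
    and m: "concat (map (\<lambda>u. map (\<lambda>v. (u, v) \<in> parcs D) [0..<n]) [0..<n]) =
            concat (map (\<lambda>u. map (\<lambda>v. (u, v) \<in> parcs E) [0..<n]) [0..<n])"
    by (auto simp: encode_digraph_def Let_def n_def replicate_True_False_eq)
  have V: "pverts D = {..<n}" "pverts E = {..<n}"
    using D E n by (auto simp: digraph_instances_def n_def)
  have sub: "parcs D \<subseteq> {..<n} \<times> {..<n}" "parcs E \<subseteq> {..<n} \<times> {..<n}"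
    using D E V unfolding digraph_instances_def pair_digraph_def pair_fin_digraph_def
      pair_wf_digraph_def by fastforce+
  have iff: "(u, v) \<in> parcs D \<longleftrightarrow> (u, v) \<in> parcs E" if "u < n" "v < n" for u v
    using concat_map_upt_eq[OF m _ \<open>u < n\<close>] \<open>v < n\<close> by (simp add: map_eq_conv)
  have "parcs D = parcs E"
    using sub iff by blast
  with V show "D = E" by simp
qed

definition digraphs_with_fvs :: "nat \<Rightarrow> nat pair_pre_digraph set" where
  "digraphs_with_fvs k =
     {D \<in> digraph_instances. \<exists>S. feedback_vertex_set (with_proj D) S \<and> card S = k}"

end

theory Submission
  imports Defs "HOL-Real_Asymp.Real_Asymp"
begin

text \<open>
  A CNF formula becomes a digraph as follows. Special vertices \<open>0, \<dots>, k - 1\<close> are pairwise joined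
  by digons, so they carry all \<open>k\<close> colours; those numbered 2 and higher are joined by digons to all
  vertices, so every other vertex has the colour of vertex 0 (false) or vertex 1 (true). A
  clause is a directed cycle through vertex 0, its literal occurrences and an end vertex that is
  forced to be false; it is not monochromatic iff some occurrence is true. Triangles through the
  vertices 0 and 1 make an occurrence that is coloured true agree with the vertices of its variable.
  Removing the special vertices leaves only arcs that respect a linear order, and there are
  \<open>O(n + m)\<close> vertices.

  Hardness for NP follows by the Cook-Levin theorem. Its formula is Horn apart from
  the clauses that guess the certificate: it only propagates true facts about the computation
  forwards, so that no uniqueness conditions on the tableau are needed.

  To see that both reductions run in polynomial time on Turing machines, their output is described
  by expressions made of bounded loops, arithmetic and runs of finite automata over the input. Every
  such expression is compiled to a multi-tape machine that represents counters by head positions.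
\<close>

text \<open>A feedback vertex set of only \<open>k\<close> vertices dictates the shape of the
  gadget: every directed cycle has to pass through one of \<open>k\<close> vertices that all
  variables and clauses share, so a variable or a clause cannot have a cycle of its own. Each
  constraint is instead a path closed up by a shared vertex, and the known colour of that vertex
  determines the colour in which the constraint bites. Implications are enforced in one direction
  only, from a true occurrence to a true literal. A false occurrence says nothing, which is enough
  because a clause only asks for one true literal.

  The bound under ETH requires more than a polynomial reduction. The time of the reduction has to be
  absorbed into \<open>2 powr h s\<close> with \<open>h\<close> sublinear, and the given exponent
  \<open>f\<close>, which need not be monotone, is evaluated at a vertex count that is only known up
  to an upper bound. The construction of the digraph works for clauses of any length, so one gadget
  serves both for 3-CNF formulas and for the tableau formulas.\<close>

definition stay :: "nat \<Rightarrow> nat \<times> move" where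
  "stay s = (s, Stay)"

lemma fst_stay [simp]: "fst (stay s) = s"
  by (simp add: stay_def)

lemma act_stay [simp]: "act_tape (stay (read_tape T)) T = T"
  by (cases T) (simp add: stay_def)

lemma map2_act_stay [simp]: "map2 act_tape (map stay (map read_tape ts)) ts = ts"
  by (induction ts) auto

lemma map2_append: "length xs = length ys \<Longrightarrow>
    map2 f (xs @ xs') (ys @ ys') = map2 f xs ys @ map2 f xs' ys'"
  by simp

section \<open>Invariants of configurations and runs\<close>

definition wf_config :: "tm \<Rightarrow> config \<Rightarrow> bool" where
  "wf_config M c \<longleftrightarrow> fst c < tm_states M \<and> length (snd c) = tm_tapes M \<and>
     (\<forall>T\<in>set (snd c). \<forall>i. fst T i < tm_symbols M)"

lemma read_tape_eq: "read_tape T = fst T (snd T)"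
  by (cases T) simp

lemma wf_config_read: "wf_config M c \<Longrightarrow> set (map read_tape (snd c)) \<subseteq> {..<tm_symbols M}"
  by (auto simp: wf_config_def read_tape_eq)

lemma wf_delta:
  assumes "wf_tm M" "q < tm_states M" "length rs = tm_tapes M" "set rs \<subseteq> {..<tm_symbols M}"
    and "tm_delta M q rs = (q', as)"
  shows "q' < tm_states M" "length as = tm_tapes M" "fst ` set as \<subseteq> {..<tm_symbols M}"
proof -
  have "q < tm_states M \<and> length rs = tm_tapes M \<and> set rs \<subseteq> {..<tm_symbols M} \<longrightarrow>
      (case tm_delta M q rs of (q', as) \<Rightarrow>
      q' < tm_states M \<and> length as = tm_tapes M \<and> fst ` set as \<subseteq> {..<tm_symbols M})"
    using assms(1) unfolding wf_tm_def by (elim conjE) (erule allE, erule allE)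
  then show "q' < tm_states M" "length as = tm_tapes M" "fst ` set as \<subseteq> {..<tm_symbols M}"
    using assms(2-5) by simp_all
qed

lemma wf_config_step:
  assumes M: "wf_tm M" and c: "wf_config M c"
  shows "wf_config M (tm_step M c)"
proof (cases "halted M c")
  case True then show ?thesis using c by (simp add: tm_step_def)
next
  case False
  obtain q' as where d: "tm_delta M (fst c) (map read_tape (snd c)) = (q', as)"
    by fastforce
  have len: "length (snd c) = tm_tapes M" and q: "fst c < tm_states M"
    using c by (auto simp: wf_config_def)
  have wd: "q' < tm_states M" "length as = tm_tapes M" "fst ` set as \<subseteq> {..<tm_symbols M}"
    using wf_delta[OF M q _ wf_config_read[OF c] d] len by auto
  have "fst T i < tm_symbols M" if T: "T \<in> set (map2 act_tape as (snd c))" for T i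
  proof -
    obtain a U where aU: "(a, U) \<in> set (zip as (snd c))" "T = act_tape a U"
      using T by auto
    then have "fst a < tm_symbols M" "\<forall>i. fst U i < tm_symbols M"
      using wd(3) c set_zip_leftD[OF aU(1)] set_zip_rightD[OF aU(1)] by (auto simp: wf_config_def)
    then show ?thesis using aU(2) by (cases a; cases U) auto
  qed
  then show ?thesis
    using False d wd len by (auto simp: tm_step_def wf_config_def)
qed

lemma wf_config_init:
  assumes "wf_tm M" "set w \<subseteq> {..<tm_symbols M}"
  shows "wf_config M (tm_init M w)"
proof -
  have "fst T i < tm_symbols M" if "T \<in> set (snd (tm_init M w))" for T i
    using that assms by (auto simp: tm_init_def word_tape_def wf_tm_def nth_mem subset_iff)
  then show ?thesis using assms by (auto simp: wf_config_def tm_init_def wf_tm_def)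
qed

lemma tm_run_0 [simp]: "tm_run M w 0 = tm_init M w"
  by (simp add: tm_run_def)

lemma tm_run_Suc: "tm_run M w (Suc t) = tm_step M (tm_run M w t)"
  by (simp add: tm_run_def)

lemma wf_config_run:
  "wf_tm M \<Longrightarrow> set w \<subseteq> {..<tm_symbols M} \<Longrightarrow> wf_config M (tm_run M w t)"
  by (induction t) (auto simp: tm_run_Suc wf_config_init wf_config_step)

lemma tm_step_halted: "halted M c \<Longrightarrow> tm_step M c = c"
  by (simp add: tm_step_def)

lemma tm_run_halted_add: "halted M (tm_run M w t) \<Longrightarrow> tm_run M w (t + s) = tm_run M w t"
  by (induction s) (auto simp: tm_run_Suc tm_step_halted)

lemma tm_run_halted_le:
  "halted M (tm_run M w t) \<Longrightarrow> t \<le> u \<Longrightarrow> tm_run M w u = tm_run M w t"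
  using tm_run_halted_add[of M w t "u - t"] by simp

lemma set_bits: "set (bits x) \<subseteq> {1, 2}"
  by (auto simp: bits_def)

lemma set_bits_symbols: "wf_tm M \<Longrightarrow> set (bits x) \<subseteq> {..<tm_symbols M}"
  using set_bits[of x] by (auto simp: wf_tm_def)

lemma length_bits [simp]: "length (bits x) = length x"
  by (simp add: bits_def)

subsection \<open>Sequential composition of machines\<close>

text \<open>
  Tape 0 is shared; it is followed by the remaining tapes of the first and then those of the
  second machine, which stay blank during the first phase.
\<close>
definition compose_tm :: "tm \<Rightarrow> tm \<Rightarrow> tm" where
  "compose_tm M1 M2 = \<lparr>
     tm_tapes = tm_tapes M1 + (tm_tapes M2 - 1),
     tm_states = tm_states M1 + tm_states M2,
     tm_symbols = max (tm_symbols M1) (tm_symbols M2),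
     tm_start = tm_start M1,
     tm_accept = tm_states M1 + tm_accept M2,
     tm_reject = tm_states M1 + tm_reject M2,
     tm_delta = (\<lambda>q rs.
       if q < tm_states M1 then
         if q \<in> {tm_accept M1, tm_reject M1} \<or> \<not> set (take (tm_tapes M1) rs) \<subseteq> {..<tm_symbols M1}
         then (tm_states M1 + tm_start M2, map stay rs)
         else case tm_delta M1 q (take (tm_tapes M1) rs) of (q', as) \<Rightarrow>
           (q', as @ map stay (drop (tm_tapes M1) rs))
       else
         if \<not> set (hd rs # drop (tm_tapes M1) rs) \<subseteq> {..<tm_symbols M2}
         then (q, map stay rs)
         else case tm_delta M2 (q - tm_states M1) (hd rs # drop (tm_tapes M1) rs) of (q', as) \<Rightarrow>
           (tm_states M1 + q', hd as # map stay (take (tm_tapes M1 - 1) (tl rs)) @ tl as)) \<rparr>"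

lemma compose_tm_simps [simp]:
  "tm_tapes (compose_tm M1 M2) = tm_tapes M1 + (tm_tapes M2 - 1)"
  "tm_states (compose_tm M1 M2) = tm_states M1 + tm_states M2"
  "tm_symbols (compose_tm M1 M2) = max (tm_symbols M1) (tm_symbols M2)"
  "tm_start (compose_tm M1 M2) = tm_start M1"
  "tm_accept (compose_tm M1 M2) = tm_states M1 + tm_accept M2"
  "tm_reject (compose_tm M1 M2) = tm_states M1 + tm_reject M2"
  by (simp_all add: compose_tm_def)

text \<open>The two alphabets may differ, and \<open>wf_tm\<close> constrains a transition function
  only on the symbols of its own machine. The alphabet tests in \<open>compose_tm\<close> keep
  foreign symbols away from \<open>tm_delta\<close>, which makes the composite total over the larger
  alphabet; in the runs considered below these tests do not fire.\<close>

lemma wf_compose_tm: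
  assumes M1: "wf_tm M1" and M2: "wf_tm M2"
  shows "wf_tm (compose_tm M1 M2)"
proof -
  have sizes: "1 \<le> tm_tapes M1" "1 \<le> tm_tapes M2" "4 \<le> tm_symbols M1"
    "tm_start M1 < tm_states M1" "tm_start M2 < tm_states M2"
    "tm_accept M2 < tm_states M2" "tm_reject M2 < tm_states M2" "tm_accept M2 \<noteq> tm_reject M2"
    using M1 M2 by (auto simp: wf_tm_def)
  have delta: "case tm_delta (compose_tm M1 M2) q rs of (q', as) \<Rightarrow>
      q' < tm_states M1 + tm_states M2 \<and> length as = tm_tapes M1 + (tm_tapes M2 - 1) \<and>
      fst ` set as \<subseteq> {..<max (tm_symbols M1) (tm_symbols M2)}"
    if q: "q < tm_states M1 + tm_states M2"
      and len: "length rs = tm_tapes M1 + (tm_tapes M2 - 1)"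
      and rs: "set rs \<subseteq> {..<max (tm_symbols M1) (tm_symbols M2)}" for q rs
  proof (cases "q < tm_states M1")
    case True
    show ?thesis
    proof (cases "q \<in> {tm_accept M1, tm_reject M1} \<or> \<not> set (take (tm_tapes M1) rs) \<subseteq> {..<tm_symbols M1}")
      case True
      with \<open>q < tm_states M1\<close> show ?thesis
        using sizes len rs by (auto simp: compose_tm_def)
    next
      case False
      obtain q' as where d: "tm_delta M1 q (take (tm_tapes M1) rs) = (q', as)" by fastforce
      have "q' < tm_states M1" "length as = tm_tapes M1" "fst ` set as \<subseteq> {..<tm_symbols M1}"
        using wf_delta[OF M1 \<open>q < tm_states M1\<close> _ _ d] False len by auto
      then show ?thesis
        using False \<open>q < tm_states M1\<close> d len rs
        by (auto simp: compose_tm_def image_Un dest: in_set_dropD)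
    qed
  next
    case q1: False
    show ?thesis
    proof (cases "set (hd rs # drop (tm_tapes M1) rs) \<subseteq> {..<tm_symbols M2}")
      case False
      with q1 show ?thesis
        using q len rs by (auto simp: compose_tm_def)
    next
      case True
      obtain q' as where d: "tm_delta M2 (q - tm_states M1) (hd rs # drop (tm_tapes M1) rs) = (q', as)"
        by fastforce
      have w: "q' < tm_states M2" "length as = tm_tapes M2" "fst ` set as \<subseteq> {..<tm_symbols M2}"
        using wf_delta[OF M2 _ _ _ d] True q q1 len sizes by auto
      have "as \<noteq> []" using w sizes by auto
      then have mem: "hd as \<in> set as" "set (tl as) \<subseteq> set as"
        by (auto dest: list.set_sel(2))
      have sub: "fst ` insert (hd as) (set (tl as)) \<subseteq> {..<tm_symbols M2}"
        using w(3) mem by blast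
      have "set (take (tm_tapes M1 - 1) (tl rs)) \<subseteq> set rs"
        by (metis set_take_subset list.set_sel(2) subset_iff tl_Nil)
      then have sub2: "set (take (tm_tapes M1 - 1) (tl rs)) \<subseteq> {..<max (tm_symbols M1) (tm_symbols M2)}"
        using rs by blast
      have "fst ` set (hd as # map stay (take (tm_tapes M1 - 1) (tl rs)) @ tl as)
          \<subseteq> {..<max (tm_symbols M1) (tm_symbols M2)}"
        using sub sub2 by (auto simp: image_Un image_image)
      moreover have "length (hd as # map stay (take (tm_tapes M1 - 1) (tl rs)) @ tl as) =
          tm_tapes M1 + (tm_tapes M2 - 1)"
        using len w sizes by auto
      moreover have "tm_delta (compose_tm M1 M2) q rs =
          (tm_states M1 + q', hd as # map stay (take (tm_tapes M1 - 1) (tl rs)) @ tl as)"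
        using True q1 d by (simp add: compose_tm_def)
      ultimately show ?thesis using w by simp
    qed
  qed
  show ?thesis
    unfolding wf_tm_def compose_tm_simps
  proof (intro conjI allI impI)
    fix q rs
    assume a: "q < tm_states M1 + tm_states M2 \<and> length rs = tm_tapes M1 + (tm_tapes M2 - 1) \<and>
      set rs \<subseteq> {..<max (tm_symbols M1) (tm_symbols M2)}"
    show "case tm_delta (compose_tm M1 M2) q rs of (q', as) \<Rightarrow>
      q' < tm_states M1 + tm_states M2 \<and> length as = tm_tapes M1 + (tm_tapes M2 - 1) \<and>
      fst ` set as \<subseteq> {..<max (tm_symbols M1) (tm_symbols M2)}"
      by (rule delta) (use a in simp_all)
  qed (use sizes in auto)
qed

lemma compose_step1:
  assumes M1: "wf_tm M1" and c: "wf_config M1 (q, ts)" and nh: "\<not> halted M1 (q, ts)"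
  shows "tm_step (compose_tm M1 M2) (q, ts @ bs) =
    (fst (tm_step M1 (q, ts)), snd (tm_step M1 (q, ts)) @ bs)"
proof -
  have len: "length ts = tm_tapes M1" and q: "q < tm_states M1"
    using c by (auto simp: wf_config_def)
  have rd: "set (map read_tape ts) \<subseteq> {..<tm_symbols M1}" using wf_config_read[OF c] by simp
  obtain q' as where d: "tm_delta M1 q (map read_tape ts) = (q', as)" by fastforce
  have las: "length as = length ts" using wf_delta[OF M1 q _ rd d] len by simp
  have nh': "\<not> halted (compose_tm M1 M2) (q, ts @ bs)"
    using q by (auto simp: halted_def)
  have "tm_delta (compose_tm M1 M2) q (map read_tape (ts @ bs)) = (q', as @ map stay (map read_tape bs))"
    using nh q rd d len by (auto simp: compose_tm_def halted_def)
  then show ?thesis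
    using nh nh' d las by (simp add: tm_step_def map2_append del: map_map)
qed

lemma compose_switch:
  assumes c: "wf_config M1 (q, ts)" and h: "halted M1 (q, ts)"
  shows "tm_step (compose_tm M1 M2) (q, ts @ bs) = (tm_states M1 + tm_start M2, ts @ bs)"
proof -
  have q: "q < tm_states M1" using c by (auto simp: wf_config_def)
  have nh': "\<not> halted (compose_tm M1 M2) (q, ts @ bs)"
    using q by (auto simp: halted_def)
  have "tm_delta (compose_tm M1 M2) q (map read_tape (ts @ bs)) =
      (tm_states M1 + tm_start M2, map stay (map read_tape (ts @ bs)))"
    using h q by (auto simp: compose_tm_def halted_def)
  then show ?thesis
    using nh' by (simp add: tm_step_def del: map_map map_append)
qed

lemma compose_step2:
  assumes M2: "wf_tm M2" and c: "wf_config M2 (q, T # ts)" and nh: "\<not> halted M2 (q, T # ts)"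
    and ms: "length ms = tm_tapes M1 - 1" "1 \<le> tm_tapes M1"
    and st: "tm_step M2 (q, T # ts) = (q', T' # ts')"
  shows "tm_step (compose_tm M1 M2) (tm_states M1 + q, T # ms @ ts) =
    (tm_states M1 + q', T' # ms @ ts')"
proof -
  have len: "Suc (length ts) = tm_tapes M2" and q: "q < tm_states M2"
    using c by (auto simp: wf_config_def)
  have rd: "set (map read_tape (T # ts)) \<subseteq> {..<tm_symbols M2}" using wf_config_read[OF c] by simp
  obtain q'' as where d: "tm_delta M2 q (map read_tape (T # ts)) = (q'', as)" by fastforce
  have las: "length as = Suc (length ts)" using wf_delta[OF M2 q _ rd d] len by simp
  then obtain a as' where as: "as = a # as'" "length as' = length ts" by (cases as) auto
  have eq: "q'' = q'" "T' = act_tape a T" "ts' = map2 act_tape as' ts"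
    using st nh d as by (auto simp: tm_step_def)
  have nh': "\<not> halted (compose_tm M1 M2) (tm_states M1 + q, T # ms @ ts)"
    using nh by (auto simp: halted_def)
  have drop: "drop (tm_tapes M1) (map read_tape (T # ms @ ts)) = map read_tape ts"
    using ms by (cases "tm_tapes M1") auto
  have "tm_delta (compose_tm M1 M2) (tm_states M1 + q) (map read_tape (T # ms @ ts)) =
      (tm_states M1 + q', a # map stay (map read_tape ms) @ as')"
    using rd d as ms eq drop by (simp add: compose_tm_def)
  then show ?thesis
    using nh' eq as by (simp add: tm_step_def map2_append del: map_map)
qed

text \<open>Once the first machine has halted its configuration is frozen, whereas the composite
  would move on to the second machine. Hence only some time \<open>t'\<close> up to \<open>t\<close>
  is claimed, at which the composite has not yet jumped.\<close>

lemma compose_phase1: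
  assumes M1: "wf_tm M1" and M2: "wf_tm M2" and w: "set w \<subseteq> {..<tm_symbols M1}"
  shows "\<exists>t'\<le>t. tm_run (compose_tm M1 M2) w t' =
    (fst (tm_run M1 w t), snd (tm_run M1 w t) @ replicate (tm_tapes M2 - 1) (word_tape []))"
proof (induction t)
  case 0
  have "1 \<le> tm_tapes M1" using M1 by (simp add: wf_tm_def)
  then have "tm_tapes M1 + (tm_tapes M2 - 1) - 1 = (tm_tapes M1 - 1) + (tm_tapes M2 - 1)" by simp
  then have "tm_init (compose_tm M1 M2) w =
    (fst (tm_init M1 w), snd (tm_init M1 w) @ replicate (tm_tapes M2 - 1) (word_tape []))"
    by (simp add: tm_init_def replicate_add)
  then show ?case by auto
next
  case (Suc t)
  then obtain t' where t': "t' \<le> t" "tm_run (compose_tm M1 M2) w t' =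
    (fst (tm_run M1 w t), snd (tm_run M1 w t) @ replicate (tm_tapes M2 - 1) (word_tape []))"
    by blast
  show ?case
  proof (cases "halted M1 (tm_run M1 w t)")
    case True
    then show ?thesis using t' unfolding tm_run_Suc tm_step_halted[OF True] by (intro exI[of _ t'] conjI) simp_all
  next
    case False
    have "wf_config M1 (fst (tm_run M1 w t), snd (tm_run M1 w t))"
      "\<not> halted M1 (fst (tm_run M1 w t), snd (tm_run M1 w t))"
      using wf_config_run[OF M1 w, of t] False by simp_all
    from compose_step1[OF M1 this] have "tm_run (compose_tm M1 M2) w (Suc t') =
      (fst (tm_run M1 w (Suc t)), snd (tm_run M1 w (Suc t)) @ replicate (tm_tapes M2 - 1) (word_tape []))"
      unfolding tm_run_Suc t'(2) by simp
    then show ?thesis using t'(1) by (intro exI[of _ "Suc t'"] conjI) simp_all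
  qed
qed

text \<open>The work tapes \<open>ms\<close> left over by the first machine are carried along with
  arbitrary contents. The second machine nevertheless starts from a genuine initial configuration,
  because its own work tapes are still blank.\<close>

lemma compose_phase2:
  assumes M1: "wf_tm M1" and M2: "wf_tm M2" and v: "set v \<subseteq> {..<tm_symbols M2}"
    and ms: "length ms = tm_tapes M1 - 1"
    and start: "tm_run (compose_tm M1 M2) w t0 =
      (tm_states M1 + tm_start M2, word_tape v # ms @ replicate (tm_tapes M2 - 1) (word_tape []))"
  shows "\<exists>t'\<le>t0 + t. tm_run (compose_tm M1 M2) w t' =
    (tm_states M1 + fst (tm_run M2 v t), hd (snd (tm_run M2 v t)) # ms @ tl (snd (tm_run M2 v t)))"
proof (induction t)
  case 0
  then show ?case using start by (intro exI[of _ t0]) (simp add: tm_init_def)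
next
  case (Suc t)
  have one: "1 \<le> tm_tapes M1" "1 \<le> tm_tapes M2" using M1 M2 by (auto simp: wf_tm_def)
  from Suc obtain t' where t': "t' \<le> t0 + t" "tm_run (compose_tm M1 M2) w t' =
    (tm_states M1 + fst (tm_run M2 v t), hd (snd (tm_run M2 v t)) # ms @ tl (snd (tm_run M2 v t)))"
    by blast
  show ?case
  proof (cases "halted M2 (tm_run M2 v t)")
    case True
    then show ?thesis using t' unfolding tm_run_Suc tm_step_halted[OF True] by (intro exI[of _ t'] conjI) simp_all
  next
    case False
    have run: "\<exists>q T ts. tm_run M2 v u = (q, T # ts)" for u
    proof -
      have "snd (tm_run M2 v u) \<noteq> []"
        using wf_config_run[OF M2 v, of u] one by (auto simp: wf_config_def)
      then show ?thesis by (metis list.exhaust prod.collapse)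
    qed
    obtain q T ts where c: "tm_run M2 v t = (q, T # ts)" using run by blast
    obtain q' T' ts' where c': "tm_step M2 (q, T # ts) = (q', T' # ts')"
      using run[of "Suc t"] c unfolding tm_run_Suc by metis
    have "tm_run (compose_tm M1 M2) w (Suc t') = (tm_states M1 + q', T' # ms @ ts')"
      using compose_step2[OF M2 _ _ ms one(1) c'] wf_config_run[OF M2 v, of t] False t' c
      unfolding tm_run_Suc by simp
    moreover have "tm_run M2 v (Suc t) = (q', T' # ts')" using c c' by (simp add: tm_run_Suc)
    ultimately show ?thesis using t'(1) by (intro exI[of _ "Suc t'"]) simp
  qed
qed

text \<open>The additional step is the jump between the machines. It can take place at once, since
  equality with \<open>word_tape v\<close> also puts the head of tape 0 on cell 0.\<close>

lemma compose_tm_run: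
  assumes M1: "wf_tm M1" and M2: "wf_tm M2" and w: "set w \<subseteq> {..<tm_symbols M1}"
    and v: "set v \<subseteq> {..<tm_symbols M2}"
    and h1: "halted M1 (tm_run M1 w t1)" "hd (snd (tm_run M1 w t1)) = word_tape v"
    and h2: "halted M2 (tm_run M2 v t2)"
  shows "\<exists>t\<le>t1 + t2 + 1. halted (compose_tm M1 M2) (tm_run (compose_tm M1 M2) w t) \<and>
    (fst (tm_run (compose_tm M1 M2) w t) = tm_accept (compose_tm M1 M2) \<longleftrightarrow>
       fst (tm_run M2 v t2) = tm_accept M2) \<and>
    hd (snd (tm_run (compose_tm M1 M2) w t)) = hd (snd (tm_run M2 v t2))"
proof -
  let ?M = "compose_tm M1 M2"
  obtain t' where t': "t' \<le> t1" "tm_run ?M w t' =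
    (fst (tm_run M1 w t1), snd (tm_run M1 w t1) @ replicate (tm_tapes M2 - 1) (word_tape []))"
    using compose_phase1[OF M1 M2 w] by blast
  obtain ms where ms: "snd (tm_run M1 w t1) = word_tape v # ms" "length ms = tm_tapes M1 - 1"
    using wf_config_run[OF M1 w, of t1] M1 h1
    by (cases "snd (tm_run M1 w t1)") (auto simp: wf_config_def wf_tm_def)
  have "tm_run ?M w (Suc t') =
      (tm_states M1 + tm_start M2, word_tape v # ms @ replicate (tm_tapes M2 - 1) (word_tape []))"
    using compose_switch[of M1 "fst (tm_run M1 w t1)" "snd (tm_run M1 w t1)"]
      wf_config_run[OF M1 w, of t1] h1 t' ms by (metis append_Cons prod.collapse tm_run_Suc)
  from compose_phase2[OF M1 M2 v ms(2) this, of t2] obtain t where t: "t \<le> Suc t' + t2"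
    "tm_run ?M w t =
      (tm_states M1 + fst (tm_run M2 v t2), hd (snd (tm_run M2 v t2)) # ms @ tl (snd (tm_run M2 v t2)))"
    by blast
  then show ?thesis
    using h2 t'(1) by (intro exI[of _ t]) (auto simp: halted_def)
qed

subsection \<open>Structured programs\<close>

datatype prog =
    Act "nat list \<Rightarrow> (nat \<times> move) list"
  | Seq prog prog
  | IfP "nat list \<Rightarrow> bool" prog prog
  | While "nat list \<Rightarrow> bool" prog

text \<open>The step counts anticipate the compiled code: a test costs one step, and so does the
  jump that ends a first branch or returns to a loop test, while the second branch falls through to
  what follows.\<close>

inductive exec :: "prog \<Rightarrow> tape list \<Rightarrow> nat \<Rightarrow> tape list \<Rightarrow> bool" where
  exec_Act: "exec (Act f) ts 1 (map2 act_tape (f (map read_tape ts)) ts)"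
| exec_Seq: "exec c ts t ts' \<Longrightarrow> exec d ts' u ts'' \<Longrightarrow> exec (Seq c d) ts (t + u) ts''"
| exec_IfT: "P (map read_tape ts) \<Longrightarrow> exec c ts t ts' \<Longrightarrow> exec (IfP P c d) ts (1 + t + 1) ts'"
| exec_IfF: "\<not> P (map read_tape ts) \<Longrightarrow> exec d ts t ts' \<Longrightarrow> exec (IfP P c d) ts (1 + t) ts'"
| exec_WhileF: "\<not> P (map read_tape ts) \<Longrightarrow> exec (While P c) ts 1 ts"
| exec_WhileT: "P (map read_tape ts) \<Longrightarrow> exec c ts t ts' \<Longrightarrow> exec (While P c) ts' u ts'' \<Longrightarrow>
    exec (While P c) ts (1 + t + 1 + u) ts''"

type_synonym instr = "nat list \<Rightarrow> nat \<times> (nat \<times> move) list"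

fun psize :: "prog \<Rightarrow> nat" where
  "psize (Act f) = 1"
| "psize (Seq c d) = psize c + psize d"
| "psize (IfP P c d) = psize c + psize d + 2"
| "psize (While P c) = psize c + 2"

text \<open>Jump targets are absolute; \<open>a\<close> is the address at which the code is placed.\<close>
fun code :: "nat \<Rightarrow> prog \<Rightarrow> instr list" where
  "code a (Act f) = [\<lambda>rs. (a + 1, f rs)]"
| "code a (Seq c d) = code a c @ code (a + psize c) d"
| "code a (IfP P c d) =
     [\<lambda>rs. (if P rs then a + 1 else a + 2 + psize c, map stay rs)] @ code (a + 1) c @
     [\<lambda>rs. (a + 2 + psize c + psize d, map stay rs)] @ code (a + 2 + psize c) d"
| "code a (While P c) =
     [\<lambda>rs. (if P rs then a + 1 else a + 2 + psize c, map stay rs)] @ code (a + 1) c @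
     [\<lambda>rs. (a, map stay rs)]"

lemma length_code [simp]: "length (code a c) = psize c"
  by (induction c arbitrary: a) auto

text \<open>Control that runs past the last instruction arrives at address \<open>length is\<close>,
  which is the accepting state; so a terminating program halts by accepting.\<close>

definition code_tm :: "nat \<Rightarrow> instr list \<Rightarrow> tm" where
  "code_tm K is = \<lparr> tm_tapes = K, tm_states = length is + 2, tm_symbols = 4, tm_start = 0,
     tm_accept = length is, tm_reject = length is + 1,
     tm_delta = (\<lambda>q rs. if q < length is then (is ! q) rs else (q, map stay rs)) \<rparr>"

fun wf_prog :: "nat \<Rightarrow> prog \<Rightarrow> bool" where
  "wf_prog K (Act f) \<longleftrightarrow> (\<forall>rs. length rs = K \<and> set rs \<subseteq> {..<4} \<longrightarrow>
      length (f rs) = K \<and> fst ` set (f rs) \<subseteq> {..<4})"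
| "wf_prog K (Seq c d) \<longleftrightarrow> wf_prog K c \<and> wf_prog K d"
| "wf_prog K (IfP P c d) \<longleftrightarrow> wf_prog K c \<and> wf_prog K d"
| "wf_prog K (While P c) \<longleftrightarrow> wf_prog K c"

lemma wf_code:
  assumes "wf_prog K c" "i \<in> set (code a c)" "length rs = K" "set rs \<subseteq> {..<4}"
  shows "fst (i rs) \<le> a + psize c \<and> length (snd (i rs)) = K \<and> fst ` set (snd (i rs)) \<subseteq> {..<4}"
  using assms(1,2)
proof (induction c arbitrary: a)
  case (Act f)
  then show ?case using assms(3,4) by auto
next
  case (Seq c d)
  then show ?case by fastforce
next
  case (IfP P c d)
  have st: "length (map stay rs) = K \<and> fst ` set (map stay rs) \<subseteq> {..<4}"
    using assms(3,4) by auto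
  from IfP(4) consider "i = (\<lambda>rs. (if P rs then a + 1 else a + 2 + psize c, map stay rs))"
    | "i \<in> set (code (a + 1) c)" | "i = (\<lambda>rs. (a + 2 + psize c + psize d, map stay rs))"
    | "i \<in> set (code (a + 2 + psize c) d)" by auto
  then show ?case
  proof cases
    case 1 then show ?thesis using st by auto
  next
    case 2 then show ?thesis using IfP(1)[of "a + 1"] IfP(3) by auto
  next
    case 3 then show ?thesis using st by auto
  next
    case 4 then show ?thesis using IfP(2)[of "a + 2 + psize c"] IfP(3) by auto
  qed
next
  case (While P c)
  have st: "length (map stay rs) = K \<and> fst ` set (map stay rs) \<subseteq> {..<4}"
    using assms(3,4) by auto
  from While(3) consider "i = (\<lambda>rs. (if P rs then a + 1 else a + 2 + psize c, map stay rs))"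
    | "i \<in> set (code (a + 1) c)" | "i = (\<lambda>rs. (a, map stay rs))" by auto
  then show ?case
  proof cases
    case 1 then show ?thesis using st by auto
  next
    case 2 then show ?thesis using While(1)[of "a + 1"] While(2) by auto
  next
    case 3 then show ?thesis using st by auto
  qed
qed

lemma wf_code_tm:
  assumes "1 \<le> K" "wf_prog K c"
  shows "wf_tm (code_tm K (code 0 c))"
proof -
  have "case tm_delta (code_tm K (code 0 c)) q rs of (q', as) \<Rightarrow>
      q' < psize c + 2 \<and> length as = K \<and> fst ` set as \<subseteq> {..<4}"
    if "q < psize c + 2" "length rs = K" "set rs \<subseteq> {..<4}" for q rs
  proof (cases "q < psize c")
    case True
    then show ?thesis
      using wf_code[OF assms(2), of "code 0 c ! q" 0 rs] that
      by (simp add: code_tm_def case_prod_beta)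
  next
    case False
    then show ?thesis using that by (auto simp: code_tm_def)
  qed
  then show ?thesis
    using assms(1) unfolding wf_tm_def by (simp add: code_tm_def)
qed

lemma code_tm_step:
  assumes "is = pre @ [i] @ post" "length pre = a" "i (map read_tape ts) = (b, as)"
  shows "tm_step (code_tm K is) (a, ts) = (b, map2 act_tape as ts)"
  using assms by (simp add: tm_step_def halted_def code_tm_def nth_append)

lemma code_tm_jump:
  assumes "is = pre @ [i] @ post" "length pre = a"
    "i (map read_tape ts) = (b, map stay (map read_tape ts))"
  shows "tm_step (code_tm K is) (a, ts) = (b, ts)"
  using code_tm_step[OF assms] map2_act_stay by simp

text \<open>The prefix \<open>pre\<close> and the suffix \<open>post\<close> are arbitrary, so that
  the induction can place a subprogram in the middle of a larger one whose jump targets are already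
  absolute.\<close>

lemma exec_code:
  assumes "exec c ts t ts'" "is = pre @ code a c @ post" "length pre = a"
  shows "(tm_step (code_tm K is) ^^ t) (a, ts) = (a + psize c, ts')"
  using assms
proof (induction arbitrary: a pre post rule: exec.induct)
  case (exec_Act f ts)
  then show ?case using code_tm_step[of "is" pre "\<lambda>rs. (a + 1, f rs)" post a ts] by simp
next
  case (exec_Seq c ts t ts' d u ts'')
  have 1: "(tm_step (code_tm K is) ^^ t) (a, ts) = (a + psize c, ts')"
    using exec_Seq.prems by (intro exec_Seq.IH(1)[of pre _ "code (a + psize c) d @ post"]) auto
  have 2: "(tm_step (code_tm K is) ^^ u) (a + psize c, ts') = (a + psize c + psize d, ts'')"
    using exec_Seq.prems by (intro exec_Seq.IH(2)[of "pre @ code a c" _ post]) auto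
  show ?case using 1 2 by (simp add: add.commute[of t u] funpow_add add.assoc)
next
  case (exec_IfT P ts c t ts' d)
  let ?j = "\<lambda>rs. (a + 2 + psize c + psize d, map stay rs)"
  let ?i = "\<lambda>rs. (if P rs then a + 1 else a + 2 + psize c, map stay rs)"
  have 1: "tm_step (code_tm K is) (a, ts) = (a + 1, ts)"
    using exec_IfT by (intro code_tm_jump[of _ pre ?i]) auto
  have 2: "(tm_step (code_tm K is) ^^ t) (a + 1, ts) = (a + 1 + psize c, ts')"
    using exec_IfT.prems by (intro exec_IfT.IH[of "pre @ [?i]" _ "[?j] @ code (a + 2 + psize c) d @ post"]) auto
  have 3: "tm_step (code_tm K is) (a + 1 + psize c, ts') = (a + 2 + psize c + psize d, ts')"
    using exec_IfT.prems by (intro code_tm_jump[of _ "pre @ [?i] @ code (a + 1) c" ?j]) auto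
  have "(tm_step (code_tm K is) ^^ (1 + t + 1)) (a, ts) =
    tm_step (code_tm K is) ((tm_step (code_tm K is) ^^ t) (tm_step (code_tm K is) (a, ts)))"
    by (simp add: funpow_swap1)
  then show ?case using 1 2 3 by (simp add: add.assoc)
next
  case (exec_IfF P ts d t ts' c)
  let ?j = "\<lambda>rs. (a + 2 + psize c + psize d, map stay rs)"
  let ?i = "\<lambda>rs. (if P rs then a + 1 else a + 2 + psize c, map stay rs)"
  have 1: "tm_step (code_tm K is) (a, ts) = (a + 2 + psize c, ts)"
    using exec_IfF by (intro code_tm_jump[of _ pre ?i]) auto
  have 2: "(tm_step (code_tm K is) ^^ t) (a + 2 + psize c, ts) = (a + 2 + psize c + psize d, ts')"
    using exec_IfF.prems by (intro exec_IfF.IH[of "pre @ [?i] @ code (a + 1) c @ [?j]" _ post]) auto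
  have "(tm_step (code_tm K is) ^^ (1 + t)) (a, ts) =
    (tm_step (code_tm K is) ^^ t) (tm_step (code_tm K is) (a, ts))"
    by (simp add: funpow_swap1)
  then show ?case using 1 2 by (simp add: add.assoc)
next
  case (exec_WhileF P ts c)
  let ?i = "\<lambda>rs. (if P rs then a + 1 else a + 2 + psize c, map stay rs)"
  have "tm_step (code_tm K is) (a, ts) = (a + 2 + psize c, ts)"
    using exec_WhileF by (intro code_tm_jump[of _ pre ?i]) auto
  then show ?case by simp
next
  case (exec_WhileT P ts c t ts' u ts'')
  let ?j = "\<lambda>rs. (a, map stay rs)"
  let ?i = "\<lambda>rs. (if P rs then a + 1 else a + 2 + psize c, map stay rs)"
  have 1: "tm_step (code_tm K is) (a, ts) = (a + 1, ts)"
    using exec_WhileT by (intro code_tm_jump[of _ pre ?i]) auto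
  have 2: "(tm_step (code_tm K is) ^^ t) (a + 1, ts) = (a + 1 + psize c, ts')"
    using exec_WhileT.prems by (intro exec_WhileT.IH(1)[of "pre @ [?i]" _ "[?j] @ post"]) auto
  have 3: "tm_step (code_tm K is) (a + 1 + psize c, ts') = (a, ts')"
    using exec_WhileT.prems by (intro code_tm_jump[of _ "pre @ [?i] @ code (a + 1) c" ?j]) auto
  have 4: "(tm_step (code_tm K is) ^^ u) (a, ts') = (a + psize (While P c), ts'')"
    using exec_WhileT.prems by (intro exec_WhileT.IH(2)[of pre _ post]) auto
  have eq: "1 + t + 1 + u = u + (1 + (t + 1))" by simp
  have "(tm_step (code_tm K is) ^^ (1 + t + 1 + u)) (a, ts) =
    (tm_step (code_tm K is) ^^ u) (tm_step (code_tm K is)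
      ((tm_step (code_tm K is) ^^ t) (tm_step (code_tm K is) (a, ts))))"
    unfolding eq by (simp add: funpow_add funpow_swap1)
  then show ?case using 1 2 3 4 by simp
qed

lemma exec_tm_run:
  assumes "exec c (word_tape w # replicate (K - 1) (word_tape [])) t ts"
  shows "halted (code_tm K (code 0 c)) (tm_run (code_tm K (code 0 c)) w t)"
    "snd (tm_run (code_tm K (code 0 c)) w t) = ts"
  using exec_code[OF assms, of "code 0 c" "[]" 0 "[]" K]
  by (auto simp: tm_run_def tm_init_def code_tm_def halted_def)

subsection \<open>Execution within a time bound\<close>

text \<open>Only an upper bound on the time is kept: exact times depend on the data and would differ
  between the iterations of a loop.\<close>

definition runs :: "prog \<Rightarrow> tape list \<Rightarrow> nat \<Rightarrow> tape list \<Rightarrow> bool" where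
  "runs c ts b ts' \<longleftrightarrow> (\<exists>t\<le>b. exec c ts t ts')"

lemma runs_mono: "runs c ts b ts' \<Longrightarrow> b \<le> b' \<Longrightarrow> runs c ts b' ts'"
  unfolding runs_def by (meson order_trans)

lemma runs_Seq: "runs c ts b ts' \<Longrightarrow> runs d ts' b' ts'' \<Longrightarrow> runs (Seq c d) ts (b + b') ts''"
  unfolding runs_def by (meson add_mono exec_Seq)

lemma runs_IfT: "P (map read_tape ts) \<Longrightarrow> runs c ts b ts' \<Longrightarrow> runs (IfP P c d) ts (b + 2) ts'"
  unfolding runs_def using exec_IfT[of P ts c _ ts' d] by fastforce

lemma runs_IfF: "\<not> P (map read_tape ts) \<Longrightarrow> runs d ts b ts' \<Longrightarrow> runs (IfP P c d) ts (b + 2) ts'"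
  unfolding runs_def by (metis exec_IfF add.commute add_le_mono one_le_numeral)

text \<open>\<open>S\<close> lists the tapes before the successive tests; each iteration costs its
  body, the test and the jump back.\<close>

lemma runs_While:
  assumes "\<And>j. j < n \<Longrightarrow> P (map read_tape (S j))"
    and "\<And>j. j < n \<Longrightarrow> runs c (S j) b (S (Suc j))"
    and "\<not> P (map read_tape (S n))"
  shows "runs (While P c) (S 0) (n * (b + 2) + 1) (S n)"
proof -
  \<comment> \<open>Induction on the number \<open>k\<close> of iterations that are still to come,
    because \<open>exec\<close> unfolds a loop at its front.\<close>
  have "runs (While P c) (S (n - k)) (k * (b + 2) + 1) (S n)" if "k \<le> n" for k
    using that
  proof (induction k)
    case 0
    then show ?case using exec_WhileF[of P "S n" c] assms(3) by (auto simp: runs_def)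
  next
    case (Suc k)
    then have lt: "n - Suc k < n" and eq: "Suc (n - Suc k) = n - k" by auto
    obtain t u where t: "t \<le> b" "exec c (S (n - Suc k)) t (S (n - k))"
      and u: "u \<le> k * (b + 2) + 1" "exec (While P c) (S (n - k)) u (S n)"
      using assms(2)[OF lt] Suc eq by (auto simp: runs_def)
    have "exec (While P c) (S (n - Suc k)) (1 + t + 1 + u) (S n)"
      using exec_WhileT[OF assms(1)[OF lt] t(2) u(2)] .
    moreover have "1 + t + 1 + u \<le> Suc k * (b + 2) + 1" using t(1) u(1) by simp
    ultimately show ?case unfolding runs_def by blast
  qed
  from this[of n] show ?thesis by simp
qed

subsection \<open>Counters\<close>

text \<open>
  A counter is a tape whose cell 0 carries the mark 3; its value is the position of its head, so
  that increment, decrement and zero test take one step each. Tape 0 is the output, tape 1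
  holds the input, tape 2 stores a single symbol in cell 0, and tape \<open>r + 3\<close> is counter \<open>r\<close>.
\<close>
definition word_cells :: "bool list \<Rightarrow> int \<Rightarrow> nat" where
  "word_cells x = fst (word_tape (bits x))"

definition mem_tape :: "bool list \<Rightarrow> nat \<Rightarrow> nat \<Rightarrow> (nat \<Rightarrow> nat) \<Rightarrow> bool list \<Rightarrow> nat \<Rightarrow> tape" where
  "mem_tape x h s \<rho> out i =
     (if i = 0 then (word_cells out, int (length out))
      else if i = 1 then (word_cells x, int h)
      else if i = 2 then (\<lambda>p. if p = 0 then s else 0, 0)
      else (\<lambda>p. if p = 0 then 3 else 0, int (\<rho> (i - 3))))"

definition mem :: "nat \<Rightarrow> bool list \<Rightarrow> nat \<Rightarrow> nat \<Rightarrow> (nat \<Rightarrow> nat) \<Rightarrow> bool list \<Rightarrow> tape list" where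
  "mem R x h s \<rho> out = map (mem_tape x h s \<rho> out) [0..<R + 3]"

lemma length_mem [simp]: "length (mem R x h s \<rho> out) = R + 3"
  by (simp add: mem_def)

lemma mem_nth [simp]: "i < R + 3 \<Longrightarrow> mem R x h s \<rho> out ! i = mem_tape x h s \<rho> out i"
  by (simp add: mem_def del: upt_Suc)

lemma mem_cong: "(\<And>r. r < R \<Longrightarrow> \<rho> r = \<rho>' r) \<Longrightarrow> mem R x h s \<rho> out = mem R x h s \<rho>' out"
  by (auto simp: mem_def mem_tape_def simp del: upt_Suc)

definition nonzero :: "nat set \<Rightarrow> nat list \<Rightarrow> bool" where
  "nonzero D rs \<longleftrightarrow> (\<forall>d\<in>D. rs ! (d + 3) \<noteq> 3)"

lemma nonzero_mem: "D \<subseteq> {..<R} \<Longrightarrow>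
    nonzero D (map read_tape (mem R x h s \<rho> out)) \<longleftrightarrow> (\<forall>d\<in>D. \<rho> d \<noteq> 0)"
  by (auto simp: nonzero_def mem_tape_def subset_iff)

definition act :: "(nat list \<Rightarrow> nat \<Rightarrow> nat \<times> move) \<Rightarrow> prog" where
  "act f = Act (\<lambda>rs. map (f rs) [0..<length rs])"

lemma runs_act:
  assumes "\<And>i. i < length ts \<Longrightarrow> act_tape (f (map read_tape ts) i) (ts ! i) = ts' ! i"
    and "length ts' = length ts"
  shows "runs (act f) ts 1 ts'"
proof -
  have "map2 act_tape (map (f (map read_tape ts)) [0..<length (map read_tape ts)]) ts = ts'"
    using assms by (intro nth_equalityI) auto
  then show ?thesis
    using exec_Act[of "\<lambda>rs. map (f rs) [0..<length rs]" ts] by (auto simp: runs_def act_def)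
qed

lemma wf_act: "(\<And>rs i. set rs \<subseteq> {..<4} \<Longrightarrow> length rs = K \<Longrightarrow> i < K \<Longrightarrow> fst (f rs i) < 4) \<Longrightarrow> wf_prog K (act f)"
  by (auto simp: act_def)

definition mv :: "(nat \<Rightarrow> move) \<Rightarrow> prog" where
  "mv F = act (\<lambda>rs i. (rs ! i, F i))"

lemma wf_mv [simp]: "wf_prog K (mv F)"
  unfolding mv_def by (rule wf_act) (auto simp: subset_iff)

lemma act_tape_move: "act_tape (read_tape T, d) T = (fst T, snd T + move_offset d)"
  by (cases T) auto

text \<open>The equations over the integers demand that each new head position is again a natural
  number; in particular a counter at zero cannot be moved left.\<close>

lemma runs_mv:
  assumes "F 0 = Stay" "F 2 = Stay" "int h' = int h + move_offset (F 1)"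
    and "\<And>r. r < R \<Longrightarrow> int (\<rho>' r) = int (\<rho> r) + move_offset (F (r + 3))"
  shows "runs (mv F) (mem R x h s \<rho> out) 1 (mem R x h' s \<rho>' out)"
  unfolding mv_def
proof (rule runs_act)
  fix i assume i: "i < length (mem R x h s \<rho> out)"
  have r: "int (\<rho>' (i - 3)) = int (\<rho> (i - 3)) + move_offset (F i)" if "\<not> i < 3"
    using assms(4)[of "i - 3"] i that by simp
  have "mem_tape x h' s \<rho>' out i =
      (fst (mem_tape x h s \<rho> out i), snd (mem_tape x h s \<rho> out i) + move_offset (F i))"
    using assms(1-3) r by (auto simp: mem_tape_def numeral_2_eq_2 numeral_3_eq_3)
  then show "act_tape (map read_tape (mem R x h s \<rho> out) ! i, F i) (mem R x h s \<rho> out ! i) =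
      mem R x h' s \<rho>' out ! i"
    using i by (simp add: act_tape_move)
qed simp

text \<open>Heads move in lockstep until one of the guarding counters is zero. Copying, transferring
  and clearing of counters, truncated subtraction and the rewinding of the input are all
  instances.\<close>

definition move_loop :: "nat set \<Rightarrow> (nat \<Rightarrow> move) \<Rightarrow> prog" where
  "move_loop D F = While (nonzero D) (mv F)"

lemma wf_move_loop [simp]: "wf_prog K (move_loop D F)"
  by (simp add: move_loop_def)

text \<open>\<open>n\<close> is the minimum of the guarding counters, attained at \<open>d\<close>,
  and therefore the number of iterations.\<close>

lemma runs_move_loop:
  assumes D: "D \<subseteq> {..<R}" "\<And>d. d \<in> D \<Longrightarrow> F (d + 3) = Left \<and> n \<le> \<rho> d" "d \<in> D" "\<rho> d = n"
    and F: "F 0 = Stay" "F 2 = Stay" "int h' = int h + int n * move_offset (F 1)"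
    and \<rho>': "\<And>r. r < R \<Longrightarrow> int (\<rho>' r) = int (\<rho> r) + int n * move_offset (F (r + 3))"
  shows "runs (move_loop D F) (mem R x h s \<rho> out) (3 * n + 1) (mem R x h' s \<rho>' out)"
proof -
  define H where "H j = nat (int h + int j * move_offset (F 1))" for j
  define P where "P j r = nat (int (\<rho> r) + int j * move_offset (F (r + 3)))" for j r
  \<comment> \<open>A position that is natural at the start and after \<open>n\<close> equal moves
    is natural in between, so the conversions by \<open>nat\<close> lose nothing.\<close>
  have nn: "0 \<le> int a + int j * move_offset m" if "int a' = int a + int n * move_offset m" "j \<le> n"
    for a a' j :: nat and m
    using that by (cases m) auto
  have H: "int (H j) = int h + int j * move_offset (F 1)" if "j \<le> n" for j
    unfolding H_def using nn[OF F(3) that] by simp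
  have P: "int (P j r) = int (\<rho> r) + int j * move_offset (F (r + 3))" if "j \<le> n" "r < R" for j r
    unfolding P_def using nn[OF \<rho>'[OF that(2)] that(1)] by simp
  have dec: "P j d = \<rho> d - j" if "d \<in> D" "j \<le> n" for j d
    using P[of j d] D(2)[OF that(1)] D(1) that by (auto simp: subset_iff)
  have "runs (move_loop D F) (mem R x (H 0) s (P 0) out) (n * (1 + 2) + 1)
      (mem R x (H n) s (P n) out)"
    unfolding move_loop_def
  proof (rule runs_While[where S = "\<lambda>j. mem R x (H j) s (P j) out"])
    fix j assume j: "j < n"
    show "nonzero D (map read_tape (mem R x (H j) s (P j) out))"
      using j D(2) dec[of _ j] by (fastforce simp: nonzero_mem[OF D(1)])
    show "runs (mv F) (mem R x (H j) s (P j) out) 1 (mem R x (H (Suc j)) s (P (Suc j)) out)"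
      using F j by (intro runs_mv) (auto simp: H P algebra_simps)
  next
    show "\<not> nonzero D (map read_tape (mem R x (H n) s (P n) out))"
      using D(3,4) dec[OF D(3), of n] by (auto simp: nonzero_mem[OF D(1)])
  qed
  from runs_mono[OF this, of "3 * n + 1"]
  have "runs (move_loop D F) (mem R x (H 0) s (P 0) out) (3 * n + 1) (mem R x (H n) s (P n) out)"
    by simp
  moreover have "H 0 = h" "P 0 = \<rho>" by (auto simp: H_def P_def)
  moreover have "H n = h'" using H[of n] F(3) by simp
  moreover have "mem R x h' s (P n) out = mem R x h' s \<rho>' out"
    using P[of n] \<rho>' by (intro mem_cong) force
  ultimately show ?thesis by simp
qed

definition moves :: "(nat \<times> move) list \<Rightarrow> nat \<Rightarrow> move" where
  "moves ms i = (case map_of ms i of None \<Rightarrow> Stay | Some m \<Rightarrow> m)"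

definition inc :: "nat \<Rightarrow> prog" where
  "inc r = mv (moves [(r + 3, Right)])"

definition dec :: "nat \<Rightarrow> prog" where
  "dec r = mv (moves [(r + 3, Left)])"

definition transfer :: "nat \<Rightarrow> nat \<Rightarrow> prog" where
  "transfer d e = move_loop {d} (moves [(d + 3, Left), (e + 3, Right)])"

definition clear :: "nat \<Rightarrow> prog" where
  "clear d = move_loop {d} (moves [(d + 3, Left)])"

lemma wf_counter_ops [simp]: "wf_prog K (inc r)" "wf_prog K (dec r)"
  "wf_prog K (transfer d e)" "wf_prog K (clear d)"
  by (simp_all add: inc_def dec_def transfer_def clear_def)

lemma runs_inc: "runs (inc r) (mem R x h s \<rho> out) 1 (mem R x h s (\<rho>(r := \<rho> r + 1)) out)"
  unfolding inc_def by (intro runs_mv) (auto simp: moves_def)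

lemma runs_dec: "\<rho> r \<noteq> 0 \<Longrightarrow> runs (dec r) (mem R x h s \<rho> out) 1 (mem R x h s (\<rho>(r := \<rho> r - 1)) out)"
  unfolding dec_def by (intro runs_mv) (auto simp: moves_def)

lemma runs_transfer:
  assumes "d < R" "e < R" "d \<noteq> e" "\<rho>' = \<rho>(d := 0, e := \<rho> e + \<rho> d)"
  shows "runs (transfer d e) (mem R x h s \<rho> out) (3 * \<rho> d + 1) (mem R x h s \<rho>' out)"
  unfolding transfer_def using assms
  by (intro runs_move_loop[where d = d]) (auto simp: moves_def)

lemma runs_clear:
  assumes "d < R"
  shows "runs (clear d) (mem R x h s \<rho> out) (3 * \<rho> d + 1) (mem R x h s (\<rho>(d := 0)) out)"
  unfolding clear_def using assms
  by (intro runs_move_loop[where d = d]) (auto simp: moves_def)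

definition emit_bit :: "bool \<Rightarrow> prog" where
  "emit_bit b = act (\<lambda>rs i. if i = 0 then (if b then 2 else 1, Right) else stay (rs ! i))"

lemma wf_emit_bit [simp]: "wf_prog K (emit_bit b)"
  unfolding emit_bit_def by (rule wf_act) (auto simp: subset_iff)

lemma word_cells_snoc:
  "word_cells (x @ [b]) = (word_cells x)(int (length x) := if b then 2 else 1)"
  by (auto simp: word_cells_def word_tape_def bits_def nth_append fun_eq_iff nat_less_iff)

lemma runs_emit_bit: "runs (emit_bit b) (mem R x h s \<rho> out) 1 (mem R x h s \<rho> (out @ [b]))"
  unfolding emit_bit_def
  by (rule runs_act) (auto simp: mem_tape_def word_cells_snoc stay_def)

definition set_state :: "nat \<Rightarrow> prog" where
  "set_state q = act (\<lambda>rs i. if i = 2 then (min 3 q, Stay) else stay (rs ! i))"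

definition automaton_step :: "(nat \<Rightarrow> nat \<Rightarrow> nat) \<Rightarrow> nat \<Rightarrow> prog" where
  "automaton_step \<delta> d = act (\<lambda>rs i.
     if i = 2 then (min 3 (\<delta> (rs ! 2) (rs ! 1)), Stay)
     else (rs ! i, moves [(1, Right), (d + 3, Left), (d + 4, Right)] i))"

definition unload_state :: "nat \<Rightarrow> prog" where
  "unload_state d = While (\<lambda>rs. rs ! 2 \<noteq> 0)
     (act (\<lambda>rs i. if i = 2 then (rs ! 2 - 1, Stay) else (rs ! i, moves [(d + 3, Right)] i)))"

text \<open>Counter \<open>d\<close> is used up as the number of symbols to read, and counter
  \<open>d + 1\<close> remembers that number so that the input head can be brought back. The final
  state, a symbol on tape 2, is then unloaded in unary into counter \<open>d\<close>.\<close>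

definition automaton_prog :: "(nat \<Rightarrow> nat \<Rightarrow> nat) \<Rightarrow> nat \<Rightarrow> nat \<Rightarrow> prog" where
  "automaton_prog \<delta> q d = Seq (set_state q) (Seq (While (nonzero {d}) (automaton_step \<delta> d))
     (Seq (move_loop {d + 1} (moves [(1, Left), (d + 4, Left)])) (unload_state d)))"

lemma wf_automaton_prog [simp]: "3 \<le> K \<Longrightarrow> wf_prog K (automaton_prog \<delta> q d)"
proof -
  assume K: "3 \<le> K"
  have lt: "rs ! 2 - 1 < 4" if "set rs \<subseteq> {..<4::nat}" "length rs = K" for rs
  proof -
    have "rs ! 2 \<in> set rs" using K that(2) by (intro nth_mem) simp
    then show ?thesis using that(1) by auto
  qed
  show ?thesis
    unfolding automaton_prog_def set_state_def automaton_step_def unload_state_def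
    by (simp, intro conjI) (rule wf_act; use lt in \<open>auto simp: subset_iff\<close>)+
qed

text \<open>
  States are capped at 3 since the current one is stored as a tape symbol. Beyond the end of the
  input the automaton reads blanks.
\<close>
fun automaton :: "(nat \<Rightarrow> nat \<Rightarrow> nat) \<Rightarrow> nat \<Rightarrow> bool list \<Rightarrow> nat \<Rightarrow> nat" where
  "automaton \<delta> q x 0 = min 3 q"
| "automaton \<delta> q x (Suc n) = min 3 (\<delta> (automaton \<delta> q x n) (word_cells x (int n)))"

lemma automaton_le: "automaton \<delta> q x n \<le> 3"
  by (cases n) auto

text \<open>Reading and rewinding take \<open>3 * n + 1\<close> steps each, setting the initial
  state takes one step, and unloading takes at most ten because a state is at most 3.\<close>

lemma runs_automaton_prog:
  assumes R: "d + 1 < R" and z: "\<rho> (d + 1) = 0"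
  shows "runs (automaton_prog \<delta> q d) (mem R x 0 0 \<rho> out) (6 * \<rho> d + 13)
    (mem R x 0 0 (\<rho>(d := automaton \<delta> q x (\<rho> d))) out)"
proof -
  define n where "n = \<rho> d"
  define S where "S j = mem R x j (automaton \<delta> q x j) (\<rho>(d := n - j, d + 1 := j)) out" for j
  let ?a = "automaton \<delta> q x n"
  have "\<rho>(d := n, d + 1 := 0) = \<rho>" using z by (auto simp: n_def)
  then have 1: "runs (set_state q) (mem R x 0 0 \<rho> out) 1 (S 0)"
    unfolding set_state_def S_def by (intro runs_act) (auto simp: mem_tape_def stay_def)
  have 2: "runs (While (nonzero {d}) (automaton_step \<delta> d)) (S 0) (n * (1 + 2) + 1) (S n)"
  proof (rule runs_While)
    fix j assume j: "j < n"
    show "nonzero {d} (map read_tape (S j))"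
      using j R by (simp add: S_def nonzero_mem)
    show "runs (automaton_step \<delta> d) (S j) 1 (S (Suc j))"
      unfolding automaton_step_def
    proof (rule runs_act)
      fix i assume i: "i < length (S j)"
      then have i: "i < R + 3" by (simp add: S_def)
      consider "i = 0" | "i = 1" | "i = 2" | "i = d + 3" | "i = d + 4"
        | "i \<ge> 3" "i \<noteq> d + 3" "i \<noteq> d + 4" by linarith
      then show "act_tape
           (if i = 2 then (min 3 (\<delta> (map read_tape (S j) ! 2) (map read_tape (S j) ! 1)), Stay)
            else (map read_tape (S j) ! i, moves [(1, Right), (d + 3, Left), (d + 4, Right)] i))
           (S j ! i) = S (Suc j) ! i"
      proof cases
        case 4
        then show ?thesis using i j by (auto simp: S_def mem_tape_def moves_def)
      next
        case 6
        then have "i - 3 \<noteq> d" "i - 3 \<noteq> Suc d" by auto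
        then show ?thesis using i 6 by (auto simp: S_def mem_tape_def moves_def)
      qed (use i in \<open>auto simp: S_def mem_tape_def moves_def\<close>)
    qed (simp add: S_def)
  next
    show "\<not> nonzero {d} (map read_tape (S n))"
      using R by (simp add: S_def nonzero_mem)
  qed
  have 3: "runs (move_loop {d + 1} (moves [(1, Left), (d + 4, Left)])) (S n) (3 * n + 1)
      (mem R x 0 ?a (\<rho>(d := 0)) out)"
    unfolding S_def using R z by (intro runs_move_loop[where d = "d + 1"]) (auto simp: moves_def)
  define T where "T j = mem R x 0 (?a - j) (\<rho>(d := j)) out" for j
  have 4: "runs (unload_state d) (T 0) (?a * (1 + 2) + 1) (T ?a)"
    unfolding unload_state_def
  proof (rule runs_While)
    fix j assume j: "j < ?a"
    show "map read_tape (T j) ! 2 \<noteq> 0"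
      using j by (simp add: T_def mem_tape_def)
    show "runs (act (\<lambda>rs i. if i = 2 then (rs ! 2 - 1, Stay) else (rs ! i, moves [(d + 3, Right)] i)))
        (T j) 1 (T (Suc j))"
    proof (rule runs_act)
      fix i assume i: "i < length (T j)"
      then have i: "i < R + 3" by (simp add: T_def)
      consider "i = 0" | "i = 1" | "i = 2" | "i = d + 3" | "i \<ge> 3" "i \<noteq> d + 3" by linarith
      then show "act_tape (if i = 2 then (map read_tape (T j) ! 2 - 1, Stay)
          else (map read_tape (T j) ! i, moves [(d + 3, Right)] i)) (T j ! i) = T (Suc j) ! i"
      proof cases
        case 5
        then have "i - 3 \<noteq> d" by auto
        then show ?thesis using i 5 by (auto simp: T_def mem_tape_def moves_def)
      qed (use i in \<open>auto simp: T_def mem_tape_def moves_def\<close>)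
    qed (simp add: T_def)
  next
    show "\<not> map read_tape (T ?a) ! 2 \<noteq> 0" by (simp add: T_def mem_tape_def)
  qed
  have T: "T 0 = mem R x 0 ?a (\<rho>(d := 0)) out" "T ?a = mem R x 0 0 (\<rho>(d := ?a)) out"
    by (simp_all add: T_def)
  have "runs (automaton_prog \<delta> q d) (mem R x 0 0 \<rho> out)
      (1 + (n * (1 + 2) + 1 + (3 * n + 1 + (?a * (1 + 2) + 1)))) (mem R x 0 0 (\<rho>(d := ?a)) out)"
    unfolding automaton_prog_def by (intro runs_Seq[OF 1] runs_Seq[OF 2] runs_Seq[OF 3]) (use 4 T in simp)
  then show ?thesis
    unfolding n_def by (rule runs_mono) (use automaton_le[of \<delta> q x "\<rho> d"] in simp)
qed

subsection \<open>Polynomially bounded functions\<close>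

text \<open>Monotonicity is included because bounds are evaluated at other bounds in place of exact
  sizes. The base \<open>n + 2\<close> is at least 2, so constants and constant factors are absorbed
  by a larger exponent.\<close>

definition poly_bounded :: "(nat \<Rightarrow> nat) \<Rightarrow> bool" where
  "poly_bounded f \<longleftrightarrow> mono f \<and> (\<exists>k. \<forall>n. f n \<le> (n + 2) ^ k)"

lemma poly_boundedI: "mono f \<Longrightarrow> (\<And>n. f n \<le> (n + 2) ^ k) \<Longrightarrow> poly_bounded f"
  by (auto simp: poly_bounded_def)

lemma poly_bounded_mono: "poly_bounded f \<Longrightarrow> m \<le> n \<Longrightarrow> f m \<le> f n"
  by (auto simp: poly_bounded_def mono_def)

lemma poly_bounded_const: "poly_bounded (\<lambda>_. c)"
proof (rule poly_boundedI)
  fix n :: nat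
  have "c \<le> 2 ^ c" by (simp add: less_imp_le)
  also have "\<dots> \<le> (n + 2) ^ c" by (rule power_mono) auto
  finally show "c \<le> (n + 2) ^ c" .
qed (simp add: mono_def)

lemma poly_bounded_id: "poly_bounded (\<lambda>n. n)"
  by (rule poly_boundedI[of _ 1]) (auto simp: mono_def)

lemma poly_bounded_add:
  assumes "poly_bounded f" "poly_bounded g" shows "poly_bounded (\<lambda>n. f n + g n)"
proof -
  obtain k l where k: "\<And>n. f n \<le> (n + 2) ^ k" and l: "\<And>n. g n \<le> (n + 2) ^ l"
    using assms by (auto simp: poly_bounded_def)
  show ?thesis
  proof (rule poly_boundedI)
    fix n :: nat
    have "(n + 2) ^ k \<le> (n + 2) ^ (k + l)" "(n + 2) ^ l \<le> (n + 2) ^ (k + l)"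
      by (auto intro: power_increasing)
    then have "f n + g n \<le> 2 * (n + 2) ^ (k + l)" using k[of n] l[of n] by linarith
    also have "\<dots> \<le> (n + 2) ^ Suc (k + l)" by simp
    finally show "f n + g n \<le> (n + 2) ^ Suc (k + l)" .
  qed (use assms in \<open>auto simp: poly_bounded_def mono_def intro: add_mono\<close>)
qed

lemma poly_bounded_mult:
  assumes "poly_bounded f" "poly_bounded g" shows "poly_bounded (\<lambda>n. f n * g n)"
proof -
  obtain k l where "\<And>n. f n \<le> (n + 2) ^ k" "\<And>n. g n \<le> (n + 2) ^ l"
    using assms by (auto simp: poly_bounded_def)
  then show ?thesis
    by (intro poly_boundedI[of _ "k + l"])
      (use assms in \<open>auto simp: poly_bounded_def mono_def power_add intro!: mult_le_mono\<close>)
qed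

lemma poly_bounded_compose:
  assumes "poly_bounded f" "poly_bounded g" shows "poly_bounded (\<lambda>n. f (g n))"
proof -
  obtain k l where k: "\<And>n. f n \<le> (n + 2) ^ k" and l: "\<And>n. g n \<le> (n + 2) ^ l"
    using assms by (auto simp: poly_bounded_def)
  show ?thesis
  proof (rule poly_boundedI)
    fix n :: nat
    have "g n + 2 \<le> (n + 2) ^ l + 2" using l by simp
    \<comment> \<open>Adding 2 at most triples a power that is at least 1, and two further factors
      \<open>n + 2\<close> contribute at least 4.\<close>
    also have "\<dots> \<le> (n + 2) ^ Suc (Suc l)"
    proof -
      have "1 \<le> (n + 2) ^ l" by simp
      moreover have "4 * (n + 2) ^ l \<le> (n + 2) * (n + 2) * (n + 2) ^ l"
        by (intro mult_le_mono) auto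
      ultimately show ?thesis by (simp only: power_Suc mult.assoc)
    qed
    finally have "(g n + 2) ^ k \<le> ((n + 2) ^ Suc (Suc l)) ^ k" by (rule power_mono) simp
    then show "f (g n) \<le> (n + 2) ^ (Suc (Suc l) * k)"
      using k[of "g n"] by (simp only: power_mult)
  qed (use assms in \<open>auto simp: poly_bounded_def mono_def\<close>)
qed

lemmas poly_bounded_intros =
  poly_bounded_const poly_bounded_id poly_bounded_add poly_bounded_mult

lemma poly_bounded_poly: "poly_bounded f \<Longrightarrow> \<exists>p :: nat poly. \<forall>n. f n \<le> poly p n"
proof -
  assume "poly_bounded f"
  then obtain k where k: "\<And>n. f n \<le> (n + 2) ^ k" by (auto simp: poly_bounded_def)
  then show ?thesis by (intro exI[of _ "[:2, 1:] ^ k"]) (simp add: add.commute)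
qed

lemma poly_bounded_of_poly: "poly_bounded (poly (p :: nat poly))"
proof (induction p)
  case 0
  then show ?case using poly_bounded_const[of 0] by (simp add: fun_eq_iff[symmetric])
next
  case (pCons a p)
  have "poly_bounded (\<lambda>x. a + x * poly p x)"
    using pCons by (intro poly_bounded_intros)
  moreover have "poly (pCons a p) = (\<lambda>x. a + x * poly p x)" by auto
  ultimately show ?case by simp
qed

subsection \<open>Expressions\<close>

text \<open>There is no product and no unbounded search: products come from \<open>Sum\<close>,
  comparisons from truncated \<open>Sub\<close>. A loop bound is evaluated before its loop starts,
  which keeps values and times polynomial for each fixed expression. The input word is accessible
  through \<open>Aut\<close> alone.\<close>

datatype nexp =
    Var nat
  | Num nat
  | Add nexp nexp
  | Sub nexp nexp
  | Cond nexp nexp nexp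
  | Sum nat nexp nexp
  | Aut "nat \<Rightarrow> nat \<Rightarrow> nat" nat nexp

fun nval :: "bool list \<Rightarrow> (nat \<Rightarrow> nat) \<Rightarrow> nexp \<Rightarrow> nat" where
  "nval x \<rho> (Var i) = \<rho> i"
| "nval x \<rho> (Num n) = n"
| "nval x \<rho> (Add a b) = nval x \<rho> a + nval x \<rho> b"
| "nval x \<rho> (Sub a b) = nval x \<rho> a - nval x \<rho> b"
| "nval x \<rho> (Cond c a b) = (if nval x \<rho> c \<noteq> 0 then nval x \<rho> a else nval x \<rho> b)"
| "nval x \<rho> (Sum i e b) = (\<Sum>k<nval x \<rho> e. nval x (\<rho>(i := k)) b)"
| "nval x \<rho> (Aut \<delta> q e) = automaton \<delta> q x (nval x \<rho> e)"

fun nvars :: "nexp \<Rightarrow> nat set" where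
  "nvars (Var i) = {i}"
| "nvars (Num n) = {}"
| "nvars (Add a b) = nvars a \<union> nvars b"
| "nvars (Sub a b) = nvars a \<union> nvars b"
| "nvars (Cond c a b) = nvars c \<union> nvars a \<union> nvars b"
| "nvars (Sum i e b) = insert i (nvars e \<union> nvars b)"
| "nvars (Aut \<delta> q e) = nvars e"

lemma finite_nvars [simp]: "finite (nvars e)"
  by (induction e) auto

fun nregs :: "nexp \<Rightarrow> nat" where
  "nregs (Var i) = 2"
| "nregs (Num n) = 1"
| "nregs (Add a b) = nregs a + nregs b + 2"
| "nregs (Sub a b) = nregs a + nregs b + 2"
| "nregs (Cond c a b) = nregs c + nregs a + nregs b + 1"
| "nregs (Sum i e b) = nregs e + nregs b + 4"
| "nregs (Aut \<delta> q e) = nregs e + 2"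

lemma nval_cong: "(\<And>i. i \<in> nvars e \<Longrightarrow> \<rho> i = \<rho>' i) \<Longrightarrow> nval x \<rho> e = nval x \<rho>' e"
proof (induction e arbitrary: \<rho> \<rho>')
  case (Sum i e b)
  have "nval x \<rho> e = nval x \<rho>' e" by (rule Sum.IH(1)) (simp add: Sum.prems)
  moreover have "nval x (\<rho>(i := k)) b = nval x (\<rho>'(i := k)) b" for k
    using Sum.prems by (intro Sum.IH(2)) auto
  ultimately show ?case by simp
next
  case (Add a b)
  have "nval x \<rho> a = nval x \<rho>' a" "nval x \<rho> b = nval x \<rho>' b"
    by (rule Add.IH; simp add: Add.prems)+
  then show ?case by simp
next
  case (Sub a b)
  have "nval x \<rho> a = nval x \<rho>' a" "nval x \<rho> b = nval x \<rho>' b"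
    by (rule Sub.IH; simp add: Sub.prems)+
  then show ?case by simp
next
  case (Cond c a b)
  have "nval x \<rho> c = nval x \<rho>' c" "nval x \<rho> a = nval x \<rho>' a" "nval x \<rho> b = nval x \<rho>' b"
    by (rule Cond.IH; simp add: Cond.prems)+
  then show ?case by simp
next
  case (Aut \<delta> q e)
  have "nval x \<rho> e = nval x \<rho>' e" by (rule Aut.IH) (simp add: Aut.prems)
  then show ?case by simp
qed auto

fun incs :: "nat \<Rightarrow> nat \<Rightarrow> prog" where
  "incs d 0 = mv (\<lambda>_. Stay)"
| "incs d (Suc n) = Seq (incs d n) (inc d)"

text \<open>
  The program stores the value in counter \<open>d\<close> and leaves all other counters unchanged; it
  needs the counters from \<open>d\<close> on to be zero and uses them as a stack.
\<close>
fun nprog :: "nat \<Rightarrow> nexp \<Rightarrow> prog" where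
  "nprog d (Var i) = Seq (move_loop {i} (moves [(i + 3, Left), (d + 3, Right), (d + 4, Right)]))
     (transfer (d + 1) i)"
| "nprog d (Num n) = incs d n"
| "nprog d (Add a b) = Seq (nprog d a) (Seq (nprog (d + 1) b) (transfer (d + 1) d))"
| "nprog d (Sub a b) = Seq (nprog d a) (Seq (nprog (d + 1) b)
     (Seq (move_loop {d, d + 1} (moves [(d + 3, Left), (d + 4, Left)])) (clear (d + 1))))"
| "nprog d (Cond c a b) = Seq (nprog d c)
     (IfP (nonzero {d}) (Seq (clear d) (nprog d a)) (nprog d b))"
| "nprog d (Sum i e b) = Seq (nprog d e) (Seq (transfer i (d + 1))
     (Seq (While (nonzero {d})
        (Seq (dec d) (Seq (nprog (d + 3) b) (Seq (transfer (d + 3) (d + 2)) (inc i)))))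
     (Seq (clear i) (Seq (transfer (d + 1) i) (transfer (d + 2) d)))))"
| "nprog d (Aut \<delta> q e) = Seq (nprog d e) (automaton_prog \<delta> q d)"

lemma wf_incs [simp]: "wf_prog K (incs d n)"
  by (induction n) auto

lemma wf_nprog [simp]: "3 \<le> K \<Longrightarrow> wf_prog K (nprog d e)"
  by (induction e arbitrary: d) auto

lemma runs_incs:
  "runs (incs d n) (mem R x h s \<rho> out) (n + 1) (mem R x h s (\<rho>(d := \<rho> d + n)) out)"
proof (induction n)
  case 0
  have "runs (mv (\<lambda>_. Stay)) (mem R x h s \<rho> out) 1 (mem R x h s \<rho> out)"
    by (rule runs_mv) auto
  then show ?case by simp
next
  case (Suc n)
  have eq: "(\<rho>(d := \<rho> d + n))(d := (\<rho>(d := \<rho> d + n)) d + 1) = \<rho>(d := \<rho> d + Suc n)"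
    by (simp add: fun_eq_iff)
  show ?case
    unfolding incs.simps
    by (rule runs_mono[OF runs_Seq[OF Suc runs_inc[of d R x h s "\<rho>(d := \<rho> d + n)", unfolded eq]]]) simp
qed

text \<open>One function bounds both value and time, since the value of a subexpression may govern
  the number of iterations of a loop. It depends on the input only through the bound
  \<open>m\<close> on the variables.\<close>

definition nprog_ok :: "nat \<Rightarrow> nat \<Rightarrow> nexp \<Rightarrow> (nat \<Rightarrow> nat) \<Rightarrow> bool" where
  "nprog_ok R d e f \<longleftrightarrow> poly_bounded f \<and> (\<forall>x \<rho> out m.
     (\<forall>r\<in>nvars e. \<rho> r \<le> m) \<longrightarrow> (\<forall>r\<ge>d. \<rho> r = 0) \<longrightarrow>
     nval x \<rho> e \<le> f m \<and>
     runs (nprog d e) (mem R x 0 0 \<rho> out) (f m) (mem R x 0 0 (\<rho>(d := nval x \<rho> e)) out))"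

lemma nprog_okD:
  assumes "nprog_ok R d e f" "\<And>r. r \<in> nvars e \<Longrightarrow> \<rho> r \<le> m" "\<And>r. r \<ge> d \<Longrightarrow> \<rho> r = 0"
  shows "nval x \<rho> e \<le> f m"
    "runs (nprog d e) (mem R x 0 0 \<rho> out) (f m) (mem R x 0 0 (\<rho>(d := nval x \<rho> e)) out)"
proof -
  have "\<forall>r\<in>nvars e. \<rho> r \<le> m" "\<forall>r\<ge>d. \<rho> r = 0" using assms(2,3) by simp_all
  with assms(1) show "nval x \<rho> e \<le> f m"
    "runs (nprog d e) (mem R x 0 0 \<rho> out) (f m) (mem R x 0 0 (\<rho>(d := nval x \<rho> e)) out)"
    by (simp_all add: nprog_ok_def)
qed

text \<open>Reading a counter means running its head down to the mark, which destroys the value. It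
  is therefore moved to two counters at once, and one of the copies is moved back.\<close>

lemma nprog_ok_Var:
  assumes i: "i < d" "d + 2 \<le> R"
  shows "\<exists>f. nprog_ok R d (Var i) f"
proof -
  have "runs (nprog d (Var i)) (mem R x 0 0 \<rho> out) (6 * m + 2) (mem R x 0 0 (\<rho>(d := \<rho> i)) out)"
    if "\<rho> i \<le> m" and z: "\<forall>r\<ge>d. \<rho> r = 0" for x \<rho> out m
  proof -
    have 1: "runs (move_loop {i} (moves [(i + 3, Left), (d + 3, Right), (d + 4, Right)]))
        (mem R x 0 0 \<rho> out) (3 * \<rho> i + 1) (mem R x 0 0 (\<rho>(i := 0, d := \<rho> i, d + 1 := \<rho> i)) out)"
      using i z by (intro runs_move_loop[where d = i]) (auto simp: moves_def)
    have 2: "runs (transfer (d + 1) i) (mem R x 0 0 (\<rho>(i := 0, d := \<rho> i, d + 1 := \<rho> i)) out)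
        (3 * (\<rho>(i := 0, d := \<rho> i, d + 1 := \<rho> i)) (d + 1) + 1) (mem R x 0 0 (\<rho>(d := \<rho> i)) out)"
      using i z by (intro runs_transfer) (auto simp: fun_eq_iff)
    show ?thesis using runs_mono[OF runs_Seq[OF 1 2]] that by simp
  qed
  then show ?thesis
    unfolding nprog_ok_def
    by (intro exI[of _ "\<lambda>m. 6 * m + 2"] conjI poly_bounded_intros) auto
qed

lemma nprog_ok_Num:
  shows "\<exists>f. nprog_ok R d (Num n) f"
proof -
  have "runs (nprog d (Num n)) (mem R x 0 0 \<rho> out) (n + 1) (mem R x 0 0 (\<rho>(d := n)) out)"
    if z: "\<forall>r\<ge>d. \<rho> r = 0" for x \<rho> out
    using runs_incs[of d n R x 0 0 \<rho> out] z by simp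
  then show ?thesis
    unfolding nprog_ok_def
    by (intro exI[of _ "\<lambda>m. n + 1"] conjI poly_bounded_intros) auto
qed

lemma nprog_ok_Add:
  assumes f: "nprog_ok R d a f" and g: "nprog_ok R (d + 1) b g" and R: "d + 2 \<le> R" and vars: "nvars a \<union> nvars b \<subseteq> {..<d}"
  shows "\<exists>f. nprog_ok R d (Add a b) f"
proof -
  have pb: "poly_bounded f" "poly_bounded g" using f g by (auto simp: nprog_ok_def)
  have "nval x \<rho> (Add a b) \<le> f m + g m + (g m + 3 * g m + 1) \<and>
      runs (nprog d (Add a b)) (mem R x 0 0 \<rho> out) (f m + g m + (g m + 3 * g m + 1))
        (mem R x 0 0 (\<rho>(d := nval x \<rho> (Add a b))) out)"
    if b: "\<forall>r\<in>nvars (Add a b). \<rho> r \<le> m" and z: "\<forall>r\<ge>d. \<rho> r = 0" for x \<rho> out m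
  proof -
    let ?\<rho> = "\<rho>(d := nval x \<rho> a)"
    have v: "nval x ?\<rho> b = nval x \<rho> b" using vars by (intro nval_cong) auto
    have 1: "nval x \<rho> a \<le> f m" "runs (nprog d a) (mem R x 0 0 \<rho> out) (f m) (mem R x 0 0 ?\<rho> out)"
      using nprog_okD[OF f, of \<rho> m x] b z by auto
    have bd: "?\<rho> r \<le> m" if "r \<in> nvars b" for r
      using b that vars by auto
    have 2: "nval x \<rho> b \<le> g m"
      "runs (nprog (d + 1) b) (mem R x 0 0 ?\<rho> out) (g m) (mem R x 0 0 (?\<rho>(d + 1 := nval x \<rho> b)) out)"
      using nprog_okD[OF g, of ?\<rho> m x] z bd unfolding v by auto
    have 3: "runs (transfer (d + 1) d) (mem R x 0 0 (?\<rho>(d + 1 := nval x \<rho> b)) out)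
       (3 * (?\<rho>(d + 1 := nval x \<rho> b)) (d + 1) + 1) (mem R x 0 0 (\<rho>(d := nval x \<rho> a + nval x \<rho> b)) out)"
      using R z by (intro runs_transfer) (auto simp: fun_eq_iff)
    show ?thesis using runs_mono[OF runs_Seq[OF 1(2) runs_Seq[OF 2(2) 3]]] 1(1) 2(1) by simp
  qed
  then show ?thesis
    unfolding nprog_ok_def using pb
    by (intro exI[of _ "\<lambda>m. f m + g m + (g m + 3 * g m + 1)"] conjI poly_bounded_intros) auto
qed

lemma nprog_ok_Sub:
  assumes f: "nprog_ok R d a f" and g: "nprog_ok R (d + 1) b g" and R: "d + 2 \<le> R" and vars: "nvars a \<union> nvars b \<subseteq> {..<d}"
  shows "\<exists>f. nprog_ok R d (Sub a b) f"
proof -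
  have pb: "poly_bounded f" "poly_bounded g" using f g by (auto simp: nprog_ok_def)
  have "nval x \<rho> (Sub a b) \<le> f m + g m + (3 * f m + 3 * g m + 2) \<and>
      runs (nprog d (Sub a b)) (mem R x 0 0 \<rho> out) (f m + g m + (3 * f m + 3 * g m + 2))
        (mem R x 0 0 (\<rho>(d := nval x \<rho> (Sub a b))) out)"
    if b: "\<forall>r\<in>nvars (Sub a b). \<rho> r \<le> m" and z: "\<forall>r\<ge>d. \<rho> r = 0" for x \<rho> out m
  proof -
    let ?a = "nval x \<rho> a" and ?b = "nval x \<rho> b"
    let ?\<rho> = "\<rho>(d := ?a)"
    have v: "nval x ?\<rho> b = ?b" using vars by (intro nval_cong) auto
    have 1: "?a \<le> f m" "runs (nprog d a) (mem R x 0 0 \<rho> out) (f m) (mem R x 0 0 ?\<rho> out)"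
      using nprog_okD[OF f, of \<rho> m x] b z by auto
    have bd: "?\<rho> r \<le> m" if "r \<in> nvars b" for r
      using b that vars by auto
    have 2: "?b \<le> g m"
      "runs (nprog (d + 1) b) (mem R x 0 0 ?\<rho> out) (g m) (mem R x 0 0 (?\<rho>(d + 1 := ?b)) out)"
      using nprog_okD[OF g, of ?\<rho> m x] z bd unfolding v by auto
    \<comment> \<open>Both counters fall together for \<open>min ?a ?b\<close> iterations; this
      leaves the truncated difference in counter \<open>d\<close>, and what remains in
      \<open>d + 1\<close> is discarded next.\<close>
    have 3: "runs (move_loop {d, d + 1} (moves [(d + 3, Left), (d + 4, Left)]))
       (mem R x 0 0 (?\<rho>(d + 1 := ?b)) out) (3 * min ?a ?b + 1)
       (mem R x 0 0 (?\<rho>(d := ?a - ?b, d + 1 := ?b - min ?a ?b)) out)"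
      using R z
      by (intro runs_move_loop[where d = "if ?a \<le> ?b then d else d + 1"]) (auto simp: moves_def)
    have 4: "runs (clear (d + 1)) (mem R x 0 0 (?\<rho>(d := ?a - ?b, d + 1 := ?b - min ?a ?b)) out)
       (3 * (?\<rho>(d := ?a - ?b, d + 1 := ?b - min ?a ?b)) (d + 1) + 1)
       (mem R x 0 0 (?\<rho>(d := ?a - ?b, d + 1 := ?b - min ?a ?b, d + 1 := 0)) out)"
      using R by (intro runs_clear) auto
    have eq: "?\<rho>(d := ?a - ?b, d + 1 := ?b - min ?a ?b, d + 1 := 0) = \<rho>(d := ?a - ?b)"
      using z by (auto simp: fun_eq_iff)
    show ?thesis
      using runs_mono[OF runs_Seq[OF 1(2) runs_Seq[OF 2(2) runs_Seq[OF 3 4[unfolded eq]]]],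
          of "f m + g m + (3 * f m + 3 * g m + 2)"] 1(1) 2(1)
      by simp
  qed
  then show ?thesis
    unfolding nprog_ok_def using pb
    by (intro exI[of _ "\<lambda>m. f m + g m + (3 * f m + 3 * g m + 2)"] conjI poly_bounded_intros) auto
qed

text \<open>Counter \<open>d\<close> holds the value of the condition; it is cleared before the
  first branch and is already zero before the second. Both branches thus start from the memory
  \<open>\<rho>\<close> and may reuse all counters from \<open>d\<close> on.\<close>

lemma runs_test:
  assumes f: "nprog_ok R d c f" and R: "d < R"
    and le: "\<And>r. r \<in> nvars c \<Longrightarrow> \<rho> r \<le> m" and z: "\<And>r. r \<ge> d \<Longrightarrow> \<rho> r = 0"
    and a: "nval x \<rho> c \<noteq> 0 \<Longrightarrow> runs a (mem R x 0 0 \<rho> out) t ts"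
    and b: "nval x \<rho> c = 0 \<Longrightarrow> runs b (mem R x 0 0 \<rho> out) t ts"
  shows "runs (Seq (nprog d c) (IfP (nonzero {d}) (Seq (clear d) a) b)) (mem R x 0 0 \<rho> out)
    (4 * f m + t + 3) ts"
proof -
  let ?c = "nval x \<rho> c"
  have 1: "?c \<le> f m" "runs (nprog d c) (mem R x 0 0 \<rho> out) (f m) (mem R x 0 0 (\<rho>(d := ?c)) out)"
    using nprog_okD[OF f, of \<rho> m x, OF le z] by auto
  show ?thesis
  proof (cases "?c = 0")
    case True
    then have \<rho>: "\<rho>(d := ?c) = \<rho>" using z by (auto simp: fun_eq_iff)
    have "\<not> nonzero {d} (map read_tape (mem R x 0 0 \<rho> out))"
      using z R by (subst nonzero_mem) auto
    from runs_IfF[where P = "nonzero {d}", OF this b[OF True]]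
    show ?thesis by (intro runs_mono[OF runs_Seq[OF 1(2)[unfolded \<rho>]]]) auto
  next
    case False
    have nz: "nonzero {d} (map read_tape (mem R x 0 0 (\<rho>(d := ?c)) out))"
      using False R by (subst nonzero_mem) auto
    have "(\<rho>(d := ?c))(d := 0) = \<rho>" using z by (auto simp: fun_eq_iff)
    then have cl: "runs (clear d) (mem R x 0 0 (\<rho>(d := ?c)) out) (3 * f m + 1) (mem R x 0 0 \<rho> out)"
      using runs_mono[OF runs_clear[OF R, of x 0 0 "\<rho>(d := ?c)" out], of "3 * f m + 1"] 1(1) by simp
    from runs_IfT[where P = "nonzero {d}", OF nz runs_Seq[OF cl a[OF False]]]
    show ?thesis by (intro runs_mono[OF runs_Seq[OF 1(2)]]) auto
  qed
qed

lemma nprog_ok_Cond: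
  assumes f: "nprog_ok R d c f" and g: "nprog_ok R d a g" and h: "nprog_ok R d b h" and R: "d + 1 \<le> R"
  shows "\<exists>f. nprog_ok R d (Cond c a b) f"
proof -
  have pb: "poly_bounded f" "poly_bounded g" "poly_bounded h" using f g h by (auto simp: nprog_ok_def)
  have "nval x \<rho> (Cond c a b) \<le> 4 * f m + (g m + h m) + 3 \<and>
      runs (nprog d (Cond c a b)) (mem R x 0 0 \<rho> out) (4 * f m + (g m + h m) + 3)
        (mem R x 0 0 (\<rho>(d := nval x \<rho> (Cond c a b))) out)"
    if b: "\<forall>r\<in>nvars (Cond c a b). \<rho> r \<le> m" and z: "\<forall>r\<ge>d. \<rho> r = 0" for x \<rho> out m
  proof -
    have 2: "nval x \<rho> a \<le> g m"
      "runs (nprog d a) (mem R x 0 0 \<rho> out) (g m) (mem R x 0 0 (\<rho>(d := nval x \<rho> a)) out)"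
      using nprog_okD[OF g, of \<rho> m x] z b by auto
    have 3: "nval x \<rho> b \<le> h m"
      "runs (nprog d b) (mem R x 0 0 \<rho> out) (h m) (mem R x 0 0 (\<rho>(d := nval x \<rho> b)) out)"
      using nprog_okD[OF h, of \<rho> m x] z b by auto
    have "runs (nprog d (Cond c a b)) (mem R x 0 0 \<rho> out) (4 * f m + (g m + h m) + 3)
        (mem R x 0 0 (\<rho>(d := nval x \<rho> (Cond c a b))) out)"
      unfolding nprog.simps using b z R runs_mono[OF 2(2)] runs_mono[OF 3(2)]
      by (intro runs_test[OF f]) auto
    then show ?thesis using 2(1) 3(1) by simp
  qed
  then show ?thesis
    unfolding nprog_ok_def using pb
    by (intro exI[of _ "\<lambda>m. 4 * f m + (g m + h m) + 3"] conjI poly_bounded_intros) auto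
qed

lemma nprog_ok_Aut:
  assumes f: "nprog_ok R d e f" and R: "d + 1 < R"
  shows "\<exists>f. nprog_ok R d (Aut \<delta> q e) f"
proof -
  have pb: "poly_bounded f" using f by (auto simp: nprog_ok_def)
  have "nval x \<rho> (Aut \<delta> q e) \<le> 7 * f m + 13 \<and>
      runs (nprog d (Aut \<delta> q e)) (mem R x 0 0 \<rho> out) (7 * f m + 13)
        (mem R x 0 0 (\<rho>(d := nval x \<rho> (Aut \<delta> q e))) out)"
    if b: "\<forall>r\<in>nvars (Aut \<delta> q e). \<rho> r \<le> m" and z: "\<forall>r\<ge>d. \<rho> r = 0" for x \<rho> out m
  proof -
    let ?e = "nval x \<rho> e"
    have 1: "?e \<le> f m" "runs (nprog d e) (mem R x 0 0 \<rho> out) (f m) (mem R x 0 0 (\<rho>(d := ?e)) out)"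
      using nprog_okD[OF f, of \<rho> m x] b z by auto
    have 2: "runs (automaton_prog \<delta> q d) (mem R x 0 0 (\<rho>(d := ?e)) out) (6 * ?e + 13)
      (mem R x 0 0 (\<rho>(d := automaton \<delta> q x ?e)) out)"
      using runs_automaton_prog[OF R, of "\<rho>(d := ?e)"] z by simp
    show ?thesis
      using runs_mono[OF runs_Seq[OF 1(2) 2], of "7 * f m + 13"] 1(1) automaton_le[of \<delta> q x ?e] by simp
  qed
  then show ?thesis
    unfolding nprog_ok_def using pb
    by (intro exI[of _ "\<lambda>m. 7 * f m + 13"] conjI poly_bounded_intros) auto
qed

text \<open>Counter \<open>d\<close> holds the iterations left, \<open>d + 1\<close> the outer value
  of variable \<open>i\<close>, and \<open>d + 2\<close> the partial sum; the body works from
  \<open>d + 3\<close> on. The saved value is restored at the end, so a loop may rebind a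
  variable.\<close>

lemma nprog_ok_Sum:
  assumes f: "nprog_ok R d e f" and g: "nprog_ok R (d + 3) b g" and R: "d + 4 \<le> R"
    and i: "i < d" and bd: "nvars b \<subseteq> {..<d}"
  shows "\<exists>f. nprog_ok R d (Sum i e b) f"
proof -
  have pb: "poly_bounded f" "poly_bounded g" using f g by (auto simp: nprog_ok_def)
  \<comment> \<open>Loop indices stay below \<open>f m\<close>, so \<open>m + f m\<close> bounds
    every variable of the body; nesting of loops becomes composition of polynomial bounds.\<close>
  define F where "F m = f m + 6 * m + 3 * f m + 10 + f m * (4 * g (m + f m) + 5) + 4 * f m * g (m + f m)" for m
  have "nval x \<rho> (Sum i e b) \<le> F m \<and>
      runs (nprog d (Sum i e b)) (mem R x 0 0 \<rho> out) (F m)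
        (mem R x 0 0 (\<rho>(d := nval x \<rho> (Sum i e b))) out)"
    if b: "\<forall>r\<in>nvars (Sum i e b). \<rho> r \<le> m" and z: "\<forall>r\<ge>d. \<rho> r = 0" for x \<rho> out m
  proof -
    define n where "n = nval x \<rho> e"
    define v where "v k = nval x (\<rho>(i := k)) b" for k
    define acc where "acc j = (\<Sum>k<j. v k)" for j
    define \<sigma> where "\<sigma> j = \<rho>(d := n - j, i := j, d + 1 := \<rho> i, d + 2 := acc j)" for j
    have im: "\<rho> i \<le> m" using b by simp
    have 1: "n \<le> f m" "runs (nprog d e) (mem R x 0 0 \<rho> out) (f m) (mem R x 0 0 (\<rho>(d := n)) out)"
      using nprog_okD[OF f, of \<rho> m x] b z by (auto simp: n_def)
    have 2: "runs (transfer i (d + 1)) (mem R x 0 0 (\<rho>(d := n)) out) (3 * (\<rho>(d := n)) i + 1)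
        (mem R x 0 0 (\<sigma> 0) out)"
      using R i z by (intro runs_transfer) (auto simp: \<sigma>_def acc_def fun_eq_iff)
    have v_le: "v j \<le> g (m + f m)" and
      body: "runs (nprog (d + 3) b) (mem R x 0 0 ((\<sigma> j)(d := n - Suc j)) out) (g (m + f m))
        (mem R x 0 0 ((\<sigma> j)(d := n - Suc j, d + 3 := v j)) out)" if j: "j < n" for j
    proof -
      have veq: "nval x ((\<sigma> j)(d := n - Suc j)) b = v j"
        unfolding v_def using bd i by (intro nval_cong) (auto simp: \<sigma>_def)
      have le: "((\<sigma> j)(d := n - Suc j)) r \<le> m + f m" if "r \<in> nvars b" for r
        using that b bd i j 1(1) by (auto simp: \<sigma>_def intro: trans_le_add1)
      have ze: "((\<sigma> j)(d := n - Suc j)) r = 0" if "r \<ge> d + 3" for r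
        using that z i by (auto simp: \<sigma>_def)
      show "v j \<le> g (m + f m)"
        "runs (nprog (d + 3) b) (mem R x 0 0 ((\<sigma> j)(d := n - Suc j)) out) (g (m + f m))
        (mem R x 0 0 ((\<sigma> j)(d := n - Suc j, d + 3 := v j)) out)"
        using nprog_okD[OF g, of "(\<sigma> j)(d := n - Suc j)" "m + f m" x, OF le ze] unfolding veq by simp_all
    qed
    have 3: "runs (While (nonzero {d})
        (Seq (dec d) (Seq (nprog (d + 3) b) (Seq (transfer (d + 3) (d + 2)) (inc i)))))
        (mem R x 0 0 (\<sigma> 0) out) (n * (4 * g (m + f m) + 3 + 2) + 1) (mem R x 0 0 (\<sigma> n) out)"
    proof (rule runs_While[where S = "\<lambda>j. mem R x 0 0 (\<sigma> j) out"])
      fix j assume j: "j < n"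
      have dj: "\<sigma> j d = n - j" using i by (simp add: \<sigma>_def)
      show "nonzero {d} (map read_tape (mem R x 0 0 (\<sigma> j) out))"
        using j dj R by (subst nonzero_mem) auto
      have a: "runs (dec d) (mem R x 0 0 (\<sigma> j) out) 1 (mem R x 0 0 ((\<sigma> j)(d := n - Suc j)) out)"
        using runs_dec[of "\<sigma> j" d R x 0 0 out] dj j by simp
      let ?\<tau> = "(\<sigma> j)(d := n - Suc j, d + 3 := v j)"
      have c: "runs (transfer (d + 3) (d + 2)) (mem R x 0 0 ?\<tau> out) (3 * ?\<tau> (d + 3) + 1)
          (mem R x 0 0 ((\<sigma> j)(d := n - Suc j, d + 2 := acc (Suc j))) out)"
        using R i z by (intro runs_transfer) (auto simp: \<sigma>_def acc_def fun_eq_iff)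
      have "((\<sigma> j)(d := n - Suc j, d + 2 := acc (Suc j)))
          (i := ((\<sigma> j)(d := n - Suc j, d + 2 := acc (Suc j))) i + 1) = \<sigma> (Suc j)"
        using i by (auto simp: \<sigma>_def fun_eq_iff)
      then have e: "runs (inc i) (mem R x 0 0 ((\<sigma> j)(d := n - Suc j, d + 2 := acc (Suc j))) out) 1
          (mem R x 0 0 (\<sigma> (Suc j)) out)"
        using runs_inc[of i R x 0 0 "(\<sigma> j)(d := n - Suc j, d + 2 := acc (Suc j))" out] by simp
      show "runs (Seq (dec d) (Seq (nprog (d + 3) b) (Seq (transfer (d + 3) (d + 2)) (inc i))))
          (mem R x 0 0 (\<sigma> j) out) (4 * g (m + f m) + 3) (mem R x 0 0 (\<sigma> (Suc j)) out)"
        by (rule runs_mono[OF runs_Seq[OF a runs_Seq[OF body[OF j] runs_Seq[OF c e]]]])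
          (use v_le[OF j] in simp)
    next
      show "\<not> nonzero {d} (map read_tape (mem R x 0 0 (\<sigma> n) out))"
        using R i by (subst nonzero_mem) (auto simp: \<sigma>_def)
    qed
    have 4: "runs (clear i) (mem R x 0 0 (\<sigma> n) out) (3 * \<sigma> n i + 1)
        (mem R x 0 0 ((\<sigma> n)(i := 0)) out)"
      using R i by (intro runs_clear) auto
    have 5: "runs (transfer (d + 1) i) (mem R x 0 0 ((\<sigma> n)(i := 0)) out)
        (3 * ((\<sigma> n)(i := 0)) (d + 1) + 1) (mem R x 0 0 (\<rho>(d := 0, d + 2 := acc n)) out)"
      using R i z by (intro runs_transfer) (auto simp: \<sigma>_def fun_eq_iff)
    have 6: "runs (transfer (d + 2) d) (mem R x 0 0 (\<rho>(d := 0, d + 2 := acc n)) out)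
        (3 * (\<rho>(d := 0, d + 2 := acc n)) (d + 2) + 1) (mem R x 0 0 (\<rho>(d := acc n)) out)"
      using R i z by (intro runs_transfer) (auto simp: fun_eq_iff)
    have "acc n \<le> (\<Sum>k<n. g (m + f m))" unfolding acc_def using v_le by (intro sum_mono) auto
    also have "\<dots> \<le> f m * g (m + f m)" using 1(1) by simp
    finally have acc: "acc n \<le> f m * g (m + f m)" .
    have val: "nval x \<rho> (Sum i e b) = acc n" by (simp add: acc_def v_def n_def)
    have \<sigma>n: "\<sigma> n i = n" "((\<sigma> n)(i := 0)) (d + 1) = \<rho> i" using i by (auto simp: \<sigma>_def)
    have nle: "n * (4 * g (m + f m) + 3 + 2) \<le> f m * (4 * g (m + f m) + 5)"
      using 1(1) by (intro mult_le_mono) auto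
    have "runs (nprog d (Sum i e b)) (mem R x 0 0 \<rho> out) (F m) (mem R x 0 0 (\<rho>(d := acc n)) out)"
      unfolding nprog.simps
      by (rule runs_mono[OF runs_Seq[OF 1(2) runs_Seq[OF 2 runs_Seq[OF 3
            runs_Seq[OF 4 runs_Seq[OF 5 6]]]]]])
        (use acc nle im 1(1) i \<sigma>n in \<open>simp add: F_def\<close>)
    moreover have "acc n \<le> F m" using acc by (simp add: F_def)
    ultimately show ?thesis unfolding val by blast
  qed
  moreover have "poly_bounded F"
    unfolding F_def using pb
    by (intro poly_bounded_intros poly_bounded_compose[of g "\<lambda>m. m + f m"])
  ultimately show ?thesis
    unfolding nprog_ok_def by (intro exI[of _ F] conjI allI impI) simp_all
qed

lemma nprog_correct:
  assumes "nvars e \<subseteq> {..<d}" "d + nregs e \<le> R"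
  shows "\<exists>f. nprog_ok R d e f"
  using assms
proof (induction e arbitrary: d)
  case (Var i)
  then show ?case by (intro nprog_ok_Var) auto
next
  case (Num n)
  show ?case by (rule nprog_ok_Num)
next
  case (Add a b)
  obtain f where "nprog_ok R d a f" using Add.IH(1)[of d] Add.prems by auto
  moreover obtain g where "nprog_ok R (d + 1) b g" using Add.IH(2)[of "d + 1"] Add.prems by force
  ultimately show ?case using Add.prems by (intro nprog_ok_Add) auto
next
  case (Sub a b)
  obtain f where "nprog_ok R d a f" using Sub.IH(1)[of d] Sub.prems by auto
  moreover obtain g where "nprog_ok R (d + 1) b g" using Sub.IH(2)[of "d + 1"] Sub.prems by force
  ultimately show ?case using Sub.prems by (intro nprog_ok_Sub) auto
next
  case (Cond c a b)
  obtain f where "nprog_ok R d c f" using Cond.IH(1)[of d] Cond.prems by auto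
  moreover obtain g where "nprog_ok R d a g" using Cond.IH(2)[of d] Cond.prems by force
  moreover obtain h where "nprog_ok R d b h" using Cond.IH(3)[of d] Cond.prems by force
  ultimately show ?case using Cond.prems by (intro nprog_ok_Cond) auto
next
  case (Aut \<delta> q e)
  obtain f where "nprog_ok R d e f" using Aut.IH[of d] Aut.prems by auto
  then show ?case using Aut.prems by (intro nprog_ok_Aut) auto
next
  case (Sum i e b)
  obtain f where "nprog_ok R d e f" using Sum.IH(1)[of d] Sum.prems by auto
  moreover obtain g where "nprog_ok R (d + 3) b g" using Sum.IH(2)[of "d + 3"] Sum.prems by force
  ultimately show ?case using Sum.prems by (intro nprog_ok_Sum) auto
qed

subsection \<open>Programs writing words\<close>

text \<open>Output is only appended: the head of tape 0 always stands right behind the word written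
  so far, and no counter is spent on it.\<close>

datatype wexp =
    Bit nexp
  | Empty
  | Cat wexp wexp
  | If_w nexp wexp
  | For nat nexp wexp

fun wval :: "bool list \<Rightarrow> (nat \<Rightarrow> nat) \<Rightarrow> wexp \<Rightarrow> bool list" where
  "wval x \<rho> (Bit e) = [nval x \<rho> e \<noteq> 0]"
| "wval x \<rho> Empty = []"
| "wval x \<rho> (Cat a b) = wval x \<rho> a @ wval x \<rho> b"
| "wval x \<rho> (If_w c a) = (if nval x \<rho> c \<noteq> 0 then wval x \<rho> a else [])"
| "wval x \<rho> (For i e a) = concat (map (\<lambda>k. wval x (\<rho>(i := k)) a) [0..<nval x \<rho> e])"

fun wvars :: "wexp \<Rightarrow> nat set" where
  "wvars (Bit e) = nvars e"
| "wvars Empty = {}"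
| "wvars (Cat a b) = wvars a \<union> wvars b"
| "wvars (If_w c a) = nvars c \<union> wvars a"
| "wvars (For i e a) = insert i (nvars e \<union> wvars a)"

lemma finite_wvars [simp]: "finite (wvars e)"
  by (induction e) auto

fun wregs :: "wexp \<Rightarrow> nat" where
  "wregs (Bit e) = nregs e + 1"
| "wregs Empty = 0"
| "wregs (Cat a b) = wregs a + wregs b"
| "wregs (If_w c a) = nregs c + wregs a + 1"
| "wregs (For i e a) = nregs e + wregs a + 2"

lemma wval_cong: "(\<And>i. i \<in> wvars e \<Longrightarrow> \<rho> i = \<rho>' i) \<Longrightarrow> wval x \<rho> e = wval x \<rho>' e"
proof (induction e arbitrary: \<rho> \<rho>')
  case (Bit e)
  have "nval x \<rho> e = nval x \<rho>' e" by (rule nval_cong) (simp add: Bit)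
  then show ?case by simp
next
  case (Cat a b)
  have "wval x \<rho> a = wval x \<rho>' a" "wval x \<rho> b = wval x \<rho>' b"
    by (rule Cat.IH; simp add: Cat.prems)+
  then show ?case by simp
next
  case (If_w c a)
  have "nval x \<rho> c = nval x \<rho>' c" by (rule nval_cong) (simp add: If_w.prems)
  moreover have "wval x \<rho> a = wval x \<rho>' a" by (rule If_w.IH) (simp add: If_w.prems)
  ultimately show ?case by simp
next
  case (For i e a)
  have "nval x \<rho> e = nval x \<rho>' e" by (rule nval_cong) (simp add: For.prems)
  moreover have "wval x (\<rho>(i := k)) a = wval x (\<rho>'(i := k)) a" for k
    by (rule For.IH) (simp add: For.prems)
  ultimately show ?case by simp
qed auto

fun wprog :: "nat \<Rightarrow> wexp \<Rightarrow> prog" where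
  "wprog d (Bit e) = Seq (nprog d e) (IfP (nonzero {d}) (Seq (clear d) (emit_bit True)) (emit_bit False))"
| "wprog d Empty = mv (\<lambda>_. Stay)"
| "wprog d (Cat a b) = Seq (wprog d a) (wprog d b)"
| "wprog d (If_w c a) = Seq (nprog d c)
     (IfP (nonzero {d}) (Seq (clear d) (wprog d a)) (mv (\<lambda>_. Stay)))"
| "wprog d (For i e a) = Seq (nprog d e) (Seq (transfer i (d + 1))
     (Seq (While (nonzero {d}) (Seq (dec d) (Seq (wprog (d + 2) a) (inc i))))
     (Seq (clear i) (transfer (d + 1) i))))"

lemma wf_wprog [simp]: "3 \<le> K \<Longrightarrow> wf_prog K (wprog d e)"
  by (induction e arbitrary: d) auto

definition wprog_ok :: "nat \<Rightarrow> nat \<Rightarrow> wexp \<Rightarrow> (nat \<Rightarrow> nat) \<Rightarrow> bool" where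
  "wprog_ok R d e f \<longleftrightarrow> poly_bounded f \<and> (\<forall>x \<rho> out m.
     (\<forall>r\<in>wvars e. \<rho> r \<le> m) \<longrightarrow> (\<forall>r\<ge>d. \<rho> r = 0) \<longrightarrow>
     length (wval x \<rho> e) \<le> f m \<and>
     runs (wprog d e) (mem R x 0 0 \<rho> out) (f m) (mem R x 0 0 \<rho> (out @ wval x \<rho> e)))"

lemma wprog_okD:
  assumes "wprog_ok R d e f" "\<And>r. r \<in> wvars e \<Longrightarrow> \<rho> r \<le> m" "\<And>r. r \<ge> d \<Longrightarrow> \<rho> r = 0"
  shows "length (wval x \<rho> e) \<le> f m"
    "runs (wprog d e) (mem R x 0 0 \<rho> out) (f m) (mem R x 0 0 \<rho> (out @ wval x \<rho> e))"
proof -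
  have "\<forall>r\<in>wvars e. \<rho> r \<le> m" "\<forall>r\<ge>d. \<rho> r = 0" using assms(2,3) by simp_all
  with assms(1) show "length (wval x \<rho> e) \<le> f m"
    "runs (wprog d e) (mem R x 0 0 \<rho> out) (f m) (mem R x 0 0 \<rho> (out @ wval x \<rho> e))"
    by (simp_all add: wprog_ok_def)
qed

lemma wprog_okI:
  assumes "poly_bounded f"
    and "\<And>x \<rho> out m. (\<And>r. r \<in> wvars e \<Longrightarrow> \<rho> r \<le> m) \<Longrightarrow> (\<And>r. r \<ge> d \<Longrightarrow> \<rho> r = 0) \<Longrightarrow>
      length (wval x \<rho> e) \<le> f m"
    and "\<And>x \<rho> out m. (\<And>r. r \<in> wvars e \<Longrightarrow> \<rho> r \<le> m) \<Longrightarrow> (\<And>r. r \<ge> d \<Longrightarrow> \<rho> r = 0) \<Longrightarrow>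
      runs (wprog d e) (mem R x 0 0 \<rho> out) (f m) (mem R x 0 0 \<rho> (out @ wval x \<rho> e))"
  shows "wprog_ok R d e f"
  unfolding wprog_ok_def
proof (intro conjI allI impI)
  fix x out and \<rho> :: "nat \<Rightarrow> nat" and m :: nat
  assume "\<forall>r\<in>wvars e. \<rho> r \<le> m" "\<forall>r\<ge>d. \<rho> r = 0"
  then have *: "\<And>r. r \<in> wvars e \<Longrightarrow> \<rho> r \<le> m" "\<And>r. r \<ge> d \<Longrightarrow> \<rho> r = 0" by simp_all
  show "length (wval x \<rho> e) \<le> f m" by (rule assms(2)[OF *])
  show "runs (wprog d e) (mem R x 0 0 \<rho> out) (f m) (mem R x 0 0 \<rho> (out @ wval x \<rho> e))"
    by (rule assms(3)[OF *])
qed (rule assms(1))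

lemma runs_skip: "runs (mv (\<lambda>_. Stay)) (mem R x h s \<rho> out) 1 (mem R x h s \<rho> out)"
  by (rule runs_mv) auto

text \<open>The argument for \<open>Sum\<close> again, except that the partial result lies on the
  output tape; counters \<open>d\<close> and \<open>d + 1\<close> suffice for the loop
  itself.\<close>

lemma wprog_ok_For:
  assumes f: "nprog_ok R d e f" and g: "wprog_ok R (d + 2) a g" and R: "d + 2 \<le> R"
    and i: "i < d" and bd: "wvars a \<subseteq> {..<d}"
  shows "\<exists>f. wprog_ok R d (For i e a) f"
proof -
  define F where "F m = f m + 6 * m + 3 * f m + 10 + f m * (g (m + f m) + 4)" for m
  have pb: "poly_bounded f" "poly_bounded g" using f g by (auto simp: nprog_ok_def wprog_ok_def)
  have "wprog_ok R d (For i e a) F"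
  proof (rule wprog_okI)
    show "poly_bounded F"
      unfolding F_def using pb
      by (intro poly_bounded_intros poly_bounded_compose[of g "\<lambda>m. m + f m"])
  next
    fix x out and \<rho> :: "nat \<Rightarrow> nat" and m :: nat
    assume b: "\<And>r. r \<in> wvars (For i e a) \<Longrightarrow> \<rho> r \<le> m" and z: "\<And>r. r \<ge> d \<Longrightarrow> \<rho> r = 0"
    define n where "n = nval x \<rho> e"
    define v where "v = (\<lambda>k. wval x (\<rho>(i := k)) a)"
    define acc where "acc j = concat (map v [0..<j])" for j
    define \<sigma> where "\<sigma> j = \<rho>(d := n - j, i := j, d + 1 := \<rho> i)" for j
    have im: "\<rho> i \<le> m" using b by simp
    have 1: "n \<le> f m" "runs (nprog d e) (mem R x 0 0 \<rho> out) (f m) (mem R x 0 0 (\<rho>(d := n)) out)"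
      using nprog_okD[OF f, of \<rho> m x] b z by (auto simp: n_def)
    have 2: "runs (transfer i (d + 1)) (mem R x 0 0 (\<rho>(d := n)) out) (3 * (\<rho>(d := n)) i + 1)
        (mem R x 0 0 (\<sigma> 0) (out @ acc 0))"
    proof -
      have "out @ acc 0 = out" by (simp add: acc_def)
      then show ?thesis
        using R i z by (simp only:) (intro runs_transfer; auto simp: \<sigma>_def fun_eq_iff)
    qed
    have v_le: "length (v j) \<le> g (m + f m)" and
      body: "runs (wprog (d + 2) a) (mem R x 0 0 ((\<sigma> j)(d := n - Suc j)) (out @ acc j)) (g (m + f m))
        (mem R x 0 0 ((\<sigma> j)(d := n - Suc j)) (out @ acc (Suc j)))" if j: "j < n" for j
    proof -
      have veq: "wval x ((\<sigma> j)(d := n - Suc j)) a = v j"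
        unfolding v_def using bd i by (intro wval_cong) (auto simp: \<sigma>_def)
      have le: "((\<sigma> j)(d := n - Suc j)) r \<le> m + f m" if "r \<in> wvars a" for r
        using that b bd i j 1(1) by (auto simp: \<sigma>_def intro: trans_le_add1)
      have ze: "((\<sigma> j)(d := n - Suc j)) r = 0" if "r \<ge> d + 2" for r
        using that z i by (auto simp: \<sigma>_def)
      show "length (v j) \<le> g (m + f m)"
        "runs (wprog (d + 2) a) (mem R x 0 0 ((\<sigma> j)(d := n - Suc j)) (out @ acc j)) (g (m + f m))
        (mem R x 0 0 ((\<sigma> j)(d := n - Suc j)) (out @ acc (Suc j)))"
        using wprog_okD(1)[OF g, of "(\<sigma> j)(d := n - Suc j)" "m + f m" x, OF le ze]
          wprog_okD(2)[OF g, of "(\<sigma> j)(d := n - Suc j)" "m + f m" x "out @ acc j", OF le ze]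
        unfolding veq by (simp_all add: acc_def)
    qed
    have "length (acc n) = (\<Sum>k<n. length (v k))"
      unfolding acc_def length_concat map_map by (simp add: sum_list_sum_nth atLeast0LessThan)
    also have "\<dots> \<le> (\<Sum>k<n. g (m + f m))" using v_le by (intro sum_mono) auto
    also have "\<dots> \<le> f m * (g (m + f m) + 4)" using 1(1) by (simp add: mult_le_mono)
    finally have "length (acc n) \<le> F m" unfolding F_def by linarith
    moreover have val: "wval x \<rho> (For i e a) = acc n" by (simp add: acc_def v_def n_def)
    ultimately show "length (wval x \<rho> (For i e a)) \<le> F m" by simp
    have 3: "runs (While (nonzero {d}) (Seq (dec d) (Seq (wprog (d + 2) a) (inc i))))
        (mem R x 0 0 (\<sigma> 0) (out @ acc 0)) (n * (g (m + f m) + 2 + 2) + 1) (mem R x 0 0 (\<sigma> n) (out @ acc n))"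
    proof (rule runs_While[where S = "\<lambda>j. mem R x 0 0 (\<sigma> j) (out @ acc j)"])
      fix j assume j: "j < n"
      have dj: "\<sigma> j d = n - j" using i by (simp add: \<sigma>_def)
      show "nonzero {d} (map read_tape (mem R x 0 0 (\<sigma> j) (out @ acc j)))"
        using j dj R by (subst nonzero_mem) auto
      have a: "runs (dec d) (mem R x 0 0 (\<sigma> j) (out @ acc j)) 1
          (mem R x 0 0 ((\<sigma> j)(d := n - Suc j)) (out @ acc j))"
        using runs_dec[of "\<sigma> j" d R x 0 0 "out @ acc j"] dj j by simp
      have "((\<sigma> j)(d := n - Suc j)) (i := ((\<sigma> j)(d := n - Suc j)) i + 1) = \<sigma> (Suc j)"
        using i by (auto simp: \<sigma>_def fun_eq_iff)
      then have e: "runs (inc i) (mem R x 0 0 ((\<sigma> j)(d := n - Suc j)) (out @ acc (Suc j))) 1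
          (mem R x 0 0 (\<sigma> (Suc j)) (out @ acc (Suc j)))"
        using runs_inc[of i R x 0 0 "(\<sigma> j)(d := n - Suc j)" "out @ acc (Suc j)"] by simp
      show "runs (Seq (dec d) (Seq (wprog (d + 2) a) (inc i)))
          (mem R x 0 0 (\<sigma> j) (out @ acc j)) (g (m + f m) + 2) (mem R x 0 0 (\<sigma> (Suc j)) (out @ acc (Suc j)))"
        by (rule runs_mono[OF runs_Seq[OF a runs_Seq[OF body[OF j] e]]]) simp
    next
      show "\<not> nonzero {d} (map read_tape (mem R x 0 0 (\<sigma> n) (out @ acc n)))"
        using R i by (subst nonzero_mem) (auto simp: \<sigma>_def)
    qed
    have 4: "runs (clear i) (mem R x 0 0 (\<sigma> n) (out @ acc n)) (3 * \<sigma> n i + 1)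
        (mem R x 0 0 ((\<sigma> n)(i := 0)) (out @ acc n))"
      using R i by (intro runs_clear) auto
    have 5: "runs (transfer (d + 1) i) (mem R x 0 0 ((\<sigma> n)(i := 0)) (out @ acc n))
        (3 * ((\<sigma> n)(i := 0)) (d + 1) + 1) (mem R x 0 0 \<rho> (out @ acc n))"
      using R i z by (intro runs_transfer) (auto simp: \<sigma>_def fun_eq_iff)
    have \<sigma>n: "\<sigma> n i = n" "((\<sigma> n)(i := 0)) (d + 1) = \<rho> i" using i by (auto simp: \<sigma>_def)
    have nle: "n * (g (m + f m) + 2 + 2) \<le> f m * (g (m + f m) + 4)"
      using 1(1) by (intro mult_le_mono) auto
    show "runs (wprog d (For i e a)) (mem R x 0 0 \<rho> out) (F m) (mem R x 0 0 \<rho> (out @ wval x \<rho> (For i e a)))"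
      unfolding wprog.simps val
      by (rule runs_mono[OF runs_Seq[OF 1(2) runs_Seq[OF 2 runs_Seq[OF 3 runs_Seq[OF 4 5]]]]])
        (use nle im 1(1) i \<sigma>n in \<open>simp add: F_def\<close>)
  qed
  then show ?thesis by blast
qed

lemma wprog_correct:
  assumes "wvars e \<subseteq> {..<d}" "d + wregs e \<le> R"
  shows "\<exists>f. wprog_ok R d e f"
  using assms
proof (induction e arbitrary: d)
  case (Bit e)
  obtain f where f: "nprog_ok R d e f" using nprog_correct[of e d R] Bit by auto
  then have pb: "poly_bounded f" by (simp add: nprog_ok_def)
  have "wprog_ok R d (Bit e) (\<lambda>m. 4 * f m + 1 + 3)"
  proof (rule wprog_okI)
    fix x out and \<rho> :: "nat \<Rightarrow> nat" and m :: nat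
    assume b: "\<And>r. r \<in> wvars (Bit e) \<Longrightarrow> \<rho> r \<le> m" and z: "\<And>r. r \<ge> d \<Longrightarrow> \<rho> r = 0"
    show "runs (wprog d (Bit e)) (mem R x 0 0 \<rho> out) (4 * f m + 1 + 3)
        (mem R x 0 0 \<rho> (out @ wval x \<rho> (Bit e)))"
      unfolding wprog.simps using Bit b z
      by (intro runs_test[OF f]) (auto simp: runs_emit_bit[unfolded One_nat_def])
  qed (use pb in \<open>auto intro!: poly_bounded_intros\<close>)
  then show ?case by blast
next
  case Empty
  have "wprog_ok R d Empty (\<lambda>_. 1)"
    by (rule wprog_okI) (auto intro: runs_skip[unfolded One_nat_def] poly_bounded_const)
  then show ?case by blast
next
  case (Cat a b)
  obtain f g where f: "wprog_ok R d a f" and g: "wprog_ok R d b g"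
    using Cat.IH[of d] Cat.prems by auto
  then have pb: "poly_bounded f" "poly_bounded g" by (auto simp: wprog_ok_def)
  have "wprog_ok R d (Cat a b) (\<lambda>m. f m + g m)"
  proof (rule wprog_okI)
    fix x out and \<rho> :: "nat \<Rightarrow> nat" and m :: nat
    assume b: "\<And>r. r \<in> wvars (Cat a b) \<Longrightarrow> \<rho> r \<le> m" and z: "\<And>r. r \<ge> d \<Longrightarrow> \<rho> r = 0"
    have 1: "length (wval x \<rho> a) \<le> f m"
      "runs (wprog d a) (mem R x 0 0 \<rho> out) (f m) (mem R x 0 0 \<rho> (out @ wval x \<rho> a))" for out
      using wprog_okD[OF f, of \<rho> m x] b z by auto
    have 2: "length (wval x \<rho> b) \<le> g m"
      "runs (wprog d b) (mem R x 0 0 \<rho> out) (g m) (mem R x 0 0 \<rho> (out @ wval x \<rho> b))" for out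
      using wprog_okD[OF g, of \<rho> m x] b z by auto
    show "length (wval x \<rho> (Cat a b)) \<le> f m + g m" using 1 2 by simp
    show "runs (wprog d (Cat a b)) (mem R x 0 0 \<rho> out) (f m + g m)
        (mem R x 0 0 \<rho> (out @ wval x \<rho> (Cat a b)))"
      using runs_Seq[OF 1(2)[of out] 2(2)] by simp
  qed (use pb in \<open>auto intro!: poly_bounded_intros\<close>)
  then show ?case by blast
next
  case (If_w c a)
  obtain f where f: "nprog_ok R d c f" using nprog_correct[of c d R] If_w by auto
  obtain g where g: "wprog_ok R d a g" using If_w.IH[of d] If_w.prems by auto
  have pb: "poly_bounded f" "poly_bounded g" using f g by (auto simp: nprog_ok_def wprog_ok_def)
  have "wprog_ok R d (If_w c a) (\<lambda>m. 4 * f m + (g m + 1) + 3)"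
  proof (rule wprog_okI)
    fix x out and \<rho> :: "nat \<Rightarrow> nat" and m :: nat
    assume b: "\<And>r. r \<in> wvars (If_w c a) \<Longrightarrow> \<rho> r \<le> m" and z: "\<And>r. r \<ge> d \<Longrightarrow> \<rho> r = 0"
    have 1: "length (wval x \<rho> a) \<le> g m"
      "runs (wprog d a) (mem R x 0 0 \<rho> out) (g m) (mem R x 0 0 \<rho> (out @ wval x \<rho> a))"
      using wprog_okD[OF g, of \<rho> m x] b z by auto
    show "length (wval x \<rho> (If_w c a)) \<le> 4 * f m + (g m + 1) + 3" using 1(1) by simp
    show "runs (wprog d (If_w c a)) (mem R x 0 0 \<rho> out) (4 * f m + (g m + 1) + 3)
        (mem R x 0 0 \<rho> (out @ wval x \<rho> (If_w c a)))"
      unfolding wprog.simps using If_w.prems b z runs_mono[OF 1(2)] runs_mono[OF runs_skip]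
      by (intro runs_test[OF f]) auto
  qed (use pb in \<open>auto intro!: poly_bounded_intros\<close>)
  then show ?case by blast
next
  case (For i e a)
  obtain f where "nprog_ok R d e f" using nprog_correct[of e d R] For.prems by auto
  moreover obtain g where "wprog_ok R (d + 2) a g" using For.IH[of "d + 2"] For.prems by force
  ultimately show ?case using For.prems by (intro wprog_ok_For) auto
qed

subsection \<open>Programs as polynomial-time machines\<close>

text \<open>Moves the input from tape 0 to tape 1 and counts its length in counter 0.\<close>
definition load_prog :: prog where
  "load_prog = Seq (act (\<lambda>rs i. if i < 3 then stay (rs ! i) else (3, Stay)))
    (Seq (While (\<lambda>rs. rs ! 0 \<noteq> 0) (act (\<lambda>rs i.
        if i = 0 then (0, Right) else if i = 1 then (rs ! 0, Right) else (rs ! i, moves [(3, Right)] i))))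
    (Seq (mv (moves [(0, Left), (1, Left)]))
    (Seq (While (\<lambda>rs. rs ! 1 \<noteq> 0) (mv (moves [(0, Left), (1, Left)])))
      (mv (moves [(0, Right), (1, Right)])))))"

text \<open>A computed word has to be left with the head on cell 0. The output contains no blank, so
  walking left until a blank is read and then one cell right finds that cell.\<close>

definition finish_prog :: prog where
  "finish_prog = Seq (mv (moves [(0, Left)])) (Seq (While (\<lambda>rs. rs ! 0 \<noteq> 0) (mv (moves [(0, Left)])))
     (mv (moves [(0, Right)])))"

lemma wf_load_finish: "1 \<le> K \<Longrightarrow> wf_prog K load_prog" "wf_prog K finish_prog"
proof -
  assume K: "1 \<le> K"
  have lt: "rs ! 0 < 4" if "set rs \<subseteq> {..<4::nat}" "length rs = K" for rs
  proof -
    have "rs ! 0 \<in> set rs" using K that(2) by (intro nth_mem) simp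
    then show ?thesis using that(1) by auto
  qed
  show "wf_prog K load_prog"
    unfolding load_prog_def
    by (simp, intro conjI) (rule wf_act; use lt in \<open>auto simp: subset_iff\<close>)+
qed (simp add: finish_prog_def)


lemma word_cells_eq_0_iff: "word_cells x p = 0 \<longleftrightarrow> \<not> (0 \<le> p \<and> p < int (length x))"
  by (auto simp: word_cells_def word_tape_def bits_def nat_less_iff)

text \<open>\<open>L j\<close> is the memory after \<open>j\<close> symbols have been moved, and
  \<open>B h\<close> the memory with tape 0 erased and both heads at position \<open>h\<close>. The
  very first action writes the mark 3 on every counter tape.\<close>

lemma runs_load_prog:
  assumes R: "1 \<le> R"
  shows "runs load_prog (word_tape (bits x) # replicate (R + 2) (word_tape [])) (6 * length x + 5)
    (mem R x 0 0 ((\<lambda>_. 0)(0 := length x)) [])"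
proof -
  define n where "n = length x"
  define L where "L j = map (\<lambda>i. if i = 0 then (\<lambda>p. if p < int j then 0 else word_cells x p, int j)
      else if i = 1 then (\<lambda>p. if p < int j then word_cells x p else 0, int j)
      else if i = 2 then (\<lambda>_. 0, 0)
      else (\<lambda>p. if p = 0 then 3 else 0, if i = 3 then int j else 0)) [0..<R + 3]" for j
  define B where "B h = map (\<lambda>i. if i = 0 then (\<lambda>_. 0, h)
      else if i = 1 then (word_cells x, h)
      else if i = 2 then (\<lambda>_. 0, 0)
      else (\<lambda>p. if p = 0 then 3 else 0, if i = 3 then int n else 0)) [0..<R + 3]" for h
  have len: "length (L j) = R + 3" "length (B h) = R + 3" for j h
    by (simp_all add: L_def B_def)
  have nth_L: "L j ! i = (if i = 0 then (\<lambda>p. if p < int j then 0 else word_cells x p, int j)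
      else if i = 1 then (\<lambda>p. if p < int j then word_cells x p else 0, int j)
      else if i = 2 then (\<lambda>_. 0, 0)
      else (\<lambda>p. if p = 0 then 3 else 0, if i = 3 then int j else 0))" if "i < R + 3" for i j
    using that unfolding L_def by (simp del: upt_Suc)
  have nth_B: "B h ! i = (if i = 0 then (\<lambda>_. 0, h)
      else if i = 1 then (word_cells x, h)
      else if i = 2 then (\<lambda>_. 0, 0)
      else (\<lambda>p. if p = 0 then 3 else 0, if i = 3 then int n else 0))" if "i < R + 3" for i h
    using that unfolding B_def by (simp del: upt_Suc)
  have wt: "word_tape [] = (\<lambda>_. 0, 0)" by (auto simp: word_tape_def)
  have wx: "word_tape (bits x) = (word_cells x, 0)" by (simp add: word_cells_def word_tape_def)
  have neg: "(\<lambda>p. if p < 0 then 0 else word_cells x p) = word_cells x"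
    by (auto simp: fun_eq_iff word_cells_eq_0_iff)
  have neg2: "(\<lambda>p. if p < 0 then word_cells x p else 0) = (\<lambda>_. 0)"
    by (auto simp: fun_eq_iff word_cells_eq_0_iff)
  have 1: "runs (act (\<lambda>rs i. if i < 3 then stay (rs ! i) else (3, Stay)))
      (word_tape (bits x) # replicate (R + 2) (word_tape [])) 1 (L 0)"
  proof (rule runs_act)
    fix i assume "i < length (word_tape (bits x) # replicate (R + 2) (word_tape []))"
    then have i: "i < R + 3" by simp
    consider "i = 0" | "i = 1" | "i = 2" | "i \<ge> 3" by linarith
    then show "act_tape (if i < 3 then stay (map read_tape (word_tape (bits x) # replicate (R + 2) (word_tape [])) ! i)
         else (3, Stay)) ((word_tape (bits x) # replicate (R + 2) (word_tape [])) ! i) = L 0 ! i"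
    proof cases
      case 4
      then show ?thesis using i by (cases i) (auto simp: nth_L wt)
    qed (use i in \<open>auto simp: nth_L wt wx neg neg2 stay_def\<close>)
  qed (simp add: len)
  have 2: "runs (While (\<lambda>rs. rs ! 0 \<noteq> 0) (act (\<lambda>rs i.
        if i = 0 then (0, Right) else if i = 1 then (rs ! 0, Right) else (rs ! i, moves [(3, Right)] i))))
      (L 0) (n * (1 + 2) + 1) (L n)"
  proof (rule runs_While)
    fix j assume j: "j < n"
    show "map read_tape (L j) ! 0 \<noteq> 0"
      using j by (simp add: len nth_L word_cells_eq_0_iff n_def)
    show "runs (act (\<lambda>rs i. if i = 0 then (0, Right) else if i = 1 then (rs ! 0, Right)
        else (rs ! i, moves [(3, Right)] i))) (L j) 1 (L (Suc j))"
    proof (rule runs_act)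
      fix i assume "i < length (L j)"
      then have i: "i < R + 3" by (simp add: len)
      consider "i = 0" | "i = 1" | "i = 2" | "i = 3" | "i > 3" by linarith
      then show "act_tape (if i = 0 then (0, Right) else if i = 1 then (map read_tape (L j) ! 0, Right)
          else (map read_tape (L j) ! i, moves [(3, Right)] i)) (L j ! i) = L (Suc j) ! i"
        by cases (use i in \<open>auto simp: nth_L len moves_def fun_eq_iff\<close>)
    qed (simp add: len)
  next
    show "\<not> map read_tape (L n) ! 0 \<noteq> 0"
      by (simp add: len nth_L word_cells_eq_0_iff n_def)
  qed
  have LB: "L n = B (int n)"
  proof (rule nth_equalityI)
    fix i assume "i < length (L n)"
    then have i: "i < R + 3" by (simp add: len)
    have "(\<lambda>p. if p < int n then 0 else word_cells x p) = (\<lambda>_. 0)"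
      "(\<lambda>p. if p < int n then word_cells x p else 0) = word_cells x"
      by (auto simp: fun_eq_iff word_cells_eq_0_iff n_def)
    then show "L n ! i = B (int n) ! i"
      by (simp add: nth_L[OF i] nth_B[OF i])
  qed (simp add: len)
  have mv: "runs (mv (moves [(0, m), (1, m)])) (B h) 1 (B (h + move_offset m))" for h m
    unfolding mv_def
  proof (rule runs_act)
    fix i assume "i < length (B h)"
    then have i: "i < R + 3" by (simp add: len)
    show "act_tape (map read_tape (B h) ! i, moves [(0, m), (1, m)] i) (B h ! i) =
        B (h + move_offset m) ! i"
      using i by (auto simp: len nth_B[OF i] moves_def)
  qed (simp add: len)
  \<comment> \<open>The trailing \<open>- int 0\<close> matches the family
    \<open>B (int n - 1 - int j)\<close> of states of the rewinding loop.\<close>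
  have 3: "runs (mv (moves [(0, Left), (1, Left)])) (L n) 1 (B (int n - 1 - int 0))"
    using mv[of Left "int n"] LB by simp
  have 4: "runs (While (\<lambda>rs. rs ! 1 \<noteq> 0) (mv (moves [(0, Left), (1, Left)])))
      (B (int n - 1 - int 0)) (n * (1 + 2) + 1) (B (int n - 1 - int n))"
  proof (rule runs_While)
    fix j assume j: "j < n"
    show "map read_tape (B (int n - 1 - int j)) ! 1 \<noteq> 0"
      using j by (simp add: len nth_B word_cells_eq_0_iff n_def)
    show "runs (mv (moves [(0, Left), (1, Left)])) (B (int n - 1 - int j)) 1 (B (int n - 1 - int (Suc j)))"
      using mv[of Left "int n - 1 - int j"] by (simp add: algebra_simps)
  next
    show "\<not> map read_tape (B (int n - 1 - int n)) ! 1 \<noteq> 0"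
      by (simp add: len nth_B word_cells_eq_0_iff n_def)
  qed
  have 5: "runs (mv (moves [(0, Right), (1, Right)])) (B (int n - 1 - int n)) 1 (B 0)"
    using mv[of Right "-1"] by simp
  have "B 0 = mem R x 0 0 ((\<lambda>_. 0)(0 := length x)) []"
  proof (rule nth_equalityI)
    fix i assume "i < length (B 0)"
    then have i: "i < R + 3" by (simp add: len)
    have "word_cells [] = (\<lambda>_. 0)" by (auto simp: fun_eq_iff word_cells_eq_0_iff)
    moreover have "i = 3 \<longleftrightarrow> i - 3 = 0" if "i \<noteq> 0" "i \<noteq> 1" "i \<noteq> 2" using that by auto
    ultimately show "B 0 ! i = mem R x 0 0 ((\<lambda>_. 0)(0 := length x)) [] ! i"
      using i by (auto simp: nth_B[OF i] mem_tape_def n_def)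
  qed (simp add: len)
  with runs_Seq[OF 1 runs_Seq[OF 2 runs_Seq[OF 3 runs_Seq[OF 4 5]]]]
  show ?thesis unfolding load_prog_def by (rule_tac runs_mono) (auto simp: n_def)
qed

lemma runs_finish_prog:
  "\<exists>ts. runs finish_prog (mem R x h s \<rho> out) (3 * length out + 3) ts \<and> hd ts = word_tape (bits out)"
proof -
  define n where "n = length out"
  define E where "E h' = (mem R x h s \<rho> out)[0 := (word_cells out, h')]" for h'
  have len: "length (E h') = R + 3" for h' by (simp add: E_def)
  have nth_E: "E h' ! i = (if i = 0 then (word_cells out, h') else mem R x h s \<rho> out ! i)"
    if "i < R + 3" for i h' using that by (simp add: E_def)
  have mv: "runs (mv (moves [(0, m)])) (E h') 1 (E (h' + move_offset m))" for h' m
    unfolding mv_def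
  proof (rule runs_act)
    fix i assume "i < length (E h')"
    then have i: "i < R + 3" by (simp add: len)
    show "act_tape (map read_tape (E h') ! i, moves [(0, m)] i) (E h' ! i) = E (h' + move_offset m) ! i"
      using i by (auto simp: len nth_E[OF i] moves_def act_tape_move)
  qed (simp add: len)
  have start: "mem R x h s \<rho> out = E (int n)"
    by (rule nth_equalityI) (auto simp: len nth_E mem_tape_def n_def)
  have 1: "runs (mv (moves [(0, Left)])) (mem R x h s \<rho> out) 1 (E (int n - 1 - int 0))"
    using mv[of Left "int n"] start by simp
  have 2: "runs (While (\<lambda>rs. rs ! 0 \<noteq> 0) (mv (moves [(0, Left)])))
      (E (int n - 1 - int 0)) (n * (1 + 2) + 1) (E (int n - 1 - int n))"
  proof (rule runs_While)
    fix j assume j: "j < n"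
    show "map read_tape (E (int n - 1 - int j)) ! 0 \<noteq> 0"
      using j by (simp add: len nth_E word_cells_eq_0_iff n_def)
    show "runs (mv (moves [(0, Left)])) (E (int n - 1 - int j)) 1 (E (int n - 1 - int (Suc j)))"
      using mv[of Left "int n - 1 - int j"] by (simp add: algebra_simps)
  next
    show "\<not> map read_tape (E (int n - 1 - int n)) ! 0 \<noteq> 0"
      by (simp add: len nth_E word_cells_eq_0_iff n_def)
  qed
  have 3: "runs (mv (moves [(0, Right)])) (E (int n - 1 - int n)) 1 (E 0)"
    using mv[of Right "-1"] by simp
  have "E 0 ! 0 = word_tape (bits out)"
    by (simp add: nth_E word_cells_def word_tape_def)
  then have "hd (E 0) = word_tape (bits out)"
    using len[of 0] by (cases "E 0") auto
  moreover have "runs finish_prog (mem R x h s \<rho> out) (3 * length out + 3) (E 0)"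
    unfolding finish_prog_def
    by (rule runs_mono[OF runs_Seq[OF 1 runs_Seq[OF 2 3]]]) (simp add: n_def)
  ultimately show ?thesis by blast
qed

text \<open>The bound limits the length of the result as well as the time, so that it can be passed
  to the bound of a subsequent machine.\<close>

definition computes_within :: "tm \<Rightarrow> (nat \<Rightarrow> nat) \<Rightarrow> (bool list \<Rightarrow> bool list) \<Rightarrow> bool" where
  "computes_within M b F \<longleftrightarrow> wf_tm M \<and> poly_bounded b \<and>
     (\<forall>x. length (F x) \<le> b (length x) \<and> halted M (tm_run M (bits x) (b (length x))) \<and>
        hd (snd (tm_run M (bits x) (b (length x)))) = word_tape (bits (F x)))"

theorem wexp_computable:
  "\<exists>M b. computes_within M b (\<lambda>x. wval x ((\<lambda>_. 0)(0 := length x)) e)"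
proof -
  \<comment> \<open>The working counters start above all variables of the expression; inserting 0
    protects the counter with the input length even if no variable occurs.\<close>
  define d where "d = Suc (Max (insert 0 (wvars e)))"
  have vars: "wvars e \<subseteq> {..<d}" by (auto simp: d_def less_Suc_eq_le)
  define R where "R = d + wregs e"
  have R: "1 \<le> R" by (simp add: R_def d_def)
  obtain f where f: "wprog_ok R d e f" using wprog_correct[OF vars, of R] by (auto simp: R_def)
  define c where "c = Seq load_prog (Seq (wprog d e) finish_prog)"
  define M where "M = code_tm (R + 3) (code 0 c)"
  define b where "b n = 6 * n + 5 + (f n + (3 * f n + 3))" for n
  define F where "F x = wval x ((\<lambda>_. 0)(0 := length x)) e" for x
  have "wf_tm M"
    unfolding M_def by (rule wf_code_tm) (simp_all add: c_def wf_load_finish)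
  moreover have "poly_bounded b"
    unfolding b_def using f by (intro poly_bounded_intros) (auto simp: wprog_ok_def)
  moreover have "length (F x) \<le> b (length x) \<and> halted M (tm_run M (bits x) (b (length x))) \<and>
      hd (snd (tm_run M (bits x) (b (length x)))) = word_tape (bits (F x))" for x
  proof -
    let ?\<rho> = "(\<lambda>_. 0)(0 := length x)"
    have 2: "length (F x) \<le> f (length x)"
      "runs (wprog d e) (mem R x 0 0 ?\<rho> []) (f (length x)) (mem R x 0 0 ?\<rho> (F x))"
      using wprog_okD(1)[OF f, of ?\<rho> "length x" x] wprog_okD(2)[OF f, of ?\<rho> "length x" x "[]"]
      by (auto simp: F_def d_def)
    obtain ts where ts: "runs finish_prog (mem R x 0 0 ?\<rho> (F x)) (3 * length (F x) + 3) ts"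
      "hd ts = word_tape (bits (F x))" using runs_finish_prog by blast
    have "runs c (word_tape (bits x) # replicate (R + 2) (word_tape [])) (b (length x)) ts"
      unfolding c_def
      by (rule runs_mono[OF runs_Seq[OF runs_load_prog[OF R] runs_Seq[OF 2(2) ts(1)]]])
        (use 2(1) in \<open>simp add: b_def\<close>)
    then obtain t where t: "t \<le> b (length x)"
      "exec c (word_tape (bits x) # replicate (R + 3 - 1) (word_tape [])) t ts"
      by (auto simp: runs_def)
    have h: "halted M (tm_run M (bits x) t)" "snd (tm_run M (bits x) t) = ts"
      using exec_tm_run[OF t(2)] unfolding M_def by auto
    then have "tm_run M (bits x) (b (length x)) = tm_run M (bits x) t"
      using t(1) by (intro tm_run_halted_le)
    then show ?thesis using h ts(2) 2(1) by (simp add: b_def)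
  qed
  ultimately have "computes_within M b F" by (simp add: computes_within_def)
  then show ?thesis unfolding F_def by blast
qed

lemma computes_within_poly_time:
  assumes "computes_within M b F"
  shows "poly_time_computable F"
proof -
  have M: "wf_tm M" "poly_bounded b" and run: "\<And>x. halted M (tm_run M (bits x) (b (length x)))"
    "\<And>x. hd (snd (tm_run M (bits x) (b (length x)))) = word_tape (bits (F x))"
    using assms by (auto simp: computes_within_def)
  obtain p :: "nat poly" where p: "\<And>n. b n \<le> poly p n" using poly_bounded_poly[OF M(2)] by blast
  have "tm_run M (bits x) (poly p (length x)) = tm_run M (bits x) (b (length x))" for x
    by (rule tm_run_halted_le[OF run(1) p])
  then show ?thesis
    unfolding poly_time_computable_def Let_def using M run by (intro exI[of _ M] exI[of _ p]) simp
qed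

lemma computes_within_compose:
  assumes 1: "computes_within M1 b1 F" and 2: "computes_within M2 b2 G"
  shows "\<exists>M b. computes_within M b (\<lambda>x. G (F x))"
proof -
  have wf: "wf_tm M1" "wf_tm M2" and pb: "poly_bounded b1" "poly_bounded b2"
    using 1 2 by (auto simp: computes_within_def)
  define b where "b n = b1 n + b2 (b1 n) + 1" for n
  have "length (G (F x)) \<le> b (length x) \<and>
      halted (compose_tm M1 M2) (tm_run (compose_tm M1 M2) (bits x) (b (length x))) \<and>
      hd (snd (tm_run (compose_tm M1 M2) (bits x) (b (length x)))) = word_tape (bits (G (F x)))" for x
  proof -
    let ?y = "F x"
    have a: "length ?y \<le> b1 (length x)" "halted M1 (tm_run M1 (bits x) (b1 (length x)))"
      "hd (snd (tm_run M1 (bits x) (b1 (length x)))) = word_tape (bits ?y)"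
      using 1 by (auto simp: computes_within_def)
    have c: "length (G ?y) \<le> b2 (length ?y)" "halted M2 (tm_run M2 (bits ?y) (b2 (length ?y)))"
      "hd (snd (tm_run M2 (bits ?y) (b2 (length ?y)))) = word_tape (bits (G ?y))"
      using 2 by (auto simp: computes_within_def)
    have le: "b2 (length ?y) \<le> b2 (b1 (length x))" using poly_bounded_mono[OF pb(2) a(1)] .
    obtain t where t: "t \<le> b1 (length x) + b2 (length ?y) + 1"
      "halted (compose_tm M1 M2) (tm_run (compose_tm M1 M2) (bits x) t)"
      "hd (snd (tm_run (compose_tm M1 M2) (bits x) t)) = hd (snd (tm_run M2 (bits ?y) (b2 (length ?y))))"
      using compose_tm_run[OF wf set_bits_symbols[OF wf(1)] set_bits_symbols[OF wf(2)] a(2,3) c(2)]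
      by blast
    have "tm_run (compose_tm M1 M2) (bits x) (b (length x)) = tm_run (compose_tm M1 M2) (bits x) t"
      using t(1) le by (intro tm_run_halted_le[OF t(2)]) (simp add: b_def)
    then show ?thesis using t c le by (simp add: b_def)
  qed
  moreover have "poly_bounded b"
    unfolding b_def using pb by (intro poly_bounded_intros poly_bounded_compose[of b2 b1])
  ultimately show ?thesis
    unfolding computes_within_def using wf_compose_tm[OF wf] by blast
qed

subsection \<open>Digraphs given by a list of vertices\<close>

text \<open>A nonempty closed walk contains a cycle, so the absence of cycles is a statement about
  the transitive closure of the arcs.\<close>

lemma acyclic_digraph_induce:
  fixes D :: "'a pair_pre_digraph"
  shows "acyclic_digraph (with_proj D \<restriction> A) \<longleftrightarrow> acyclic (parcs D \<inter> A \<times> A)"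
proof -
  interpret wf_digraph "with_proj D \<restriction> A" by unfold_locales auto
  have ends: "arcs_ends (with_proj D \<restriction> A) = parcs D \<inter> A \<times> A"
    by (force simp: arcs_ends_conv)
  have "(\<exists>p. cycle p) \<longleftrightarrow> (\<exists>v. (v, v) \<in> (arcs_ends (with_proj D \<restriction> A))\<^sup>+)"
  proof
    assume "\<exists>p. cycle p"
    then obtain u p where "awalk u p u" "p \<noteq> []" by (auto simp: cycle_def)
    then show "\<exists>v. (v, v) \<in> (arcs_ends (with_proj D \<restriction> A))\<^sup>+" using reachable1_awalk by blast
  next
    assume "\<exists>v. (v, v) \<in> (arcs_ends (with_proj D \<restriction> A))\<^sup>+"
    then obtain v p where "awalk v p v" "p \<noteq> []" using reachable1_awalk by blast
    then have "closed_w p" by (auto simp: closed_w_def)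
    then show "\<exists>p. cycle p" by (rule closed_w_imp_cycle)
  qed
  then show ?thesis
    unfolding acyclic_digraph_def acyclic_def ends by blast
qed

text \<open>Instances must have an initial segment of the naturals as vertex set. Positions in a
  list provide the numbers, while adjacency can be specified on named vertices.\<close>

definition list_digraph :: "'a list \<Rightarrow> ('a \<Rightarrow> 'a \<Rightarrow> bool) \<Rightarrow> nat pair_pre_digraph" where
  "list_digraph vs adj = \<lparr> pverts = {..<length vs},
     parcs = {(u, v). u < length vs \<and> v < length vs \<and> adj (vs ! u) (vs ! v)} \<rparr>"

lemma list_digraph_simps [simp]:
  "pverts (list_digraph vs adj) = {..<length vs}"
  "(u, v) \<in> parcs (list_digraph vs adj) \<longleftrightarrow>
     u < length vs \<and> v < length vs \<and> adj (vs ! u) (vs ! v)"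
  by (simp_all add: list_digraph_def)

lemma list_digraph_instance:
  assumes "\<And>a. a \<in> set vs \<Longrightarrow> \<not> adj a a"
  shows "list_digraph vs adj \<in> digraph_instances"
proof -
  have "finite (parcs (list_digraph vs adj))"
    by (rule finite_subset[of _ "{..<length vs} \<times> {..<length vs}"]) auto
  moreover have "fst e \<noteq> snd e" if "e \<in> parcs (list_digraph vs adj)" for e
    using that assms by (cases e) auto
  ultimately have "pair_digraph (list_digraph vs adj)"
    by unfold_locales auto
  then show ?thesis by (simp add: digraph_instances_def)
qed

lemma encode_list_digraph:
  "encode_digraph (list_digraph vs adj) =
     replicate (length vs) True @ [False] @ concat (map (\<lambda>a. map (adj a) vs) vs)"
proof -
  have row: "map (\<lambda>v. (u, v) \<in> parcs (list_digraph vs adj)) [0..<length vs] = map (adj (vs ! u)) vs"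
    if "u < length vs" for u
    using that by (intro nth_equalityI) auto
  have "map (\<lambda>u. map (\<lambda>v. (u, v) \<in> parcs (list_digraph vs adj)) [0..<length vs]) [0..<length vs] =
      map (\<lambda>a. map (adj a) vs) vs"
    by (rule nth_equalityI) (simp_all add: row del: list_digraph_simps)
  then show ?thesis
    by (simp add: encode_digraph_def Let_def del: list_digraph_simps(2))
qed

lemma monochromatic_trancl:
  assumes "(a, b) \<in> {(u, v). (u, v) \<in> R \<and> c u = c v}\<^sup>+"
  shows "c a = c b \<and> (a, b) \<in> (R \<inter> {v. c v = c a} \<times> {v. c v = c a})\<^sup>+"
  using assms
proof induction
  case (base y)
  then show ?case by (simp add: r_into_trancl)
next
  case (step y z)
  then have "(y, z) \<in> R \<inter> {v. c v = c a} \<times> {v. c v = c a}" by simp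
  then have "(a, z) \<in> (R \<inter> {v. c v = c a} \<times> {v. c v = c a})\<^sup>+"
    by (rule trancl_into_trancl[OF conjunct2[OF step.IH]])
  then show ?case using step by simp
qed

text \<open>A walk along monochromatic arcs never leaves its colour class. Acyclicity of all classes
  is therefore acyclicity of one relation, the form in which the gadget is analysed.\<close>

lemma k_colorable_pair:
  fixes D :: "'a pair_pre_digraph"
  shows "k_colorable k (with_proj D) \<longleftrightarrow>
    (\<exists>c. c ` pverts D \<subseteq> {..<k} \<and>
       acyclic {(u, v). (u, v) \<in> parcs D \<and> u \<in> pverts D \<and> v \<in> pverts D \<and> c u = c v})"
proof -
  have key: "(\<forall>i<k. acyclic_digraph (with_proj D \<restriction> {v \<in> pverts D. c v = i})) \<longleftrightarrow>
      acyclic {(u, v). (u, v) \<in> parcs D \<and> u \<in> pverts D \<and> v \<in> pverts D \<and> c u = c v}"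
    (is "?L \<longleftrightarrow> acyclic ?R")
    if c: "c ` pverts D \<subseteq> {..<k}" for c
  proof
    assume L: ?L
    show "acyclic ?R"
    proof (rule acyclicI, rule allI, rule notI)
      fix a assume a: "(a, a) \<in> ?R\<^sup>+"
      then obtain b where "(a, b) \<in> ?R" by (meson tranclD)
      then have ck: "c a < k" using c by auto
      let ?A = "{v \<in> pverts D. c v = c a}"
      have "?R \<subseteq> {(u, v). (u, v) \<in> parcs D \<inter> pverts D \<times> pverts D \<and> c u = c v}" by auto
      from monochromatic_trancl[OF trancl_mono[OF a this]]
      have cyc: "(a, a) \<in> (parcs D \<inter> pverts D \<times> pverts D \<inter> {v. c v = c a} \<times> {v. c v = c a})\<^sup>+"
        by (rule conjunct2)
      have "(a, a) \<in> (parcs D \<inter> ?A \<times> ?A)\<^sup>+"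
        by (rule trancl_mono[OF cyc]) auto
      moreover have "acyclic (parcs D \<inter> ?A \<times> ?A)"
        using L[rule_format, OF ck] by (simp only: acyclic_digraph_induce)
      ultimately show False unfolding acyclic_def by (elim allE[of _ a] notE)
    qed
  next
    assume R: "acyclic ?R"
    show ?L
      unfolding acyclic_digraph_induce
      by (intro allI impI acyclic_subset[OF R]) auto
  qed
  show ?thesis
  proof
    assume "k_colorable k (with_proj D)"
    then obtain c where "c ` verts (with_proj D) \<subseteq> {..<k}"
      "\<forall>i<k. acyclic_digraph (with_proj D \<restriction> {v \<in> verts (with_proj D). c v = i})"
      by (auto simp only: k_colorable_def)
    then show "\<exists>c. c ` pverts D \<subseteq> {..<k} \<and>
       acyclic {(u, v). (u, v) \<in> parcs D \<and> u \<in> pverts D \<and> v \<in> pverts D \<and> c u = c v}"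
      using key[of c] by (intro exI[of _ c]) (simp only: with_proj_simps simp_thms)
  next
    assume "\<exists>c. c ` pverts D \<subseteq> {..<k} \<and>
       acyclic {(u, v). (u, v) \<in> parcs D \<and> u \<in> pverts D \<and> v \<in> pverts D \<and> c u = c v}"
    then obtain c where c: "c ` pverts D \<subseteq> {..<k}"
      "acyclic {(u, v). (u, v) \<in> parcs D \<and> u \<in> pverts D \<and> v \<in> pverts D \<and> c u = c v}"
      by (elim exE conjE)
    show "k_colorable k (with_proj D)"
      unfolding k_colorable_def
      by (rule exI[of _ c]) (simp only: with_proj_simps c(1) key[OF c(1)] c(2) simp_thms)
  qed
qed

lemma k_colorable_list_digraph:
  assumes "distinct vs"
  shows "k_colorable k (with_proj (list_digraph vs adj)) \<longleftrightarrow>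
    (\<exists>c. (\<forall>a\<in>set vs. c a < k) \<and>
       acyclic {(a, b). a \<in> set vs \<and> b \<in> set vs \<and> adj a b \<and> c a = c b})"
proof
  assume "k_colorable k (with_proj (list_digraph vs adj))"
  then obtain c where c: "c ` {..<length vs} \<subseteq> {..<k}"
    and ac: "acyclic {(u, v). (u, v) \<in> parcs (list_digraph vs adj) \<and> u \<in> {..<length vs} \<and>
      v \<in> {..<length vs} \<and> c u = c v}" (is "acyclic ?R")
    unfolding k_colorable_pair by (auto simp del: list_digraph_simps(2))
  \<comment> \<open>The colouring of positions is transported to names; since the list is distinct,
    \<open>ix\<close> inverts list indexing.\<close>
  define ix where "ix a = (THE i. i < length vs \<and> vs ! i = a)" for a
  have ix: "ix (vs ! i) = i" if "i < length vs" for i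
    unfolding ix_def using that assms by (auto simp: nth_eq_iff_index_eq)
  let ?S = "{(a, b). a \<in> set vs \<and> b \<in> set vs \<and> adj a b \<and> c (ix a) = c (ix b)}"
  have "?S \<subseteq> inv_image ?R ix"
    by (auto simp: in_set_conv_nth ix)
  moreover have "acyclic (inv_image ?R ix)"
  proof -
    have "(ix a, ix b) \<in> ?R\<^sup>+" if "(a, b) \<in> (inv_image ?R ix)\<^sup>+" for a b
      using that
      by induction (auto simp: inv_image_def intro: r_into_trancl trancl_into_trancl)
    then show ?thesis using ac unfolding acyclic_def by blast
  qed
  ultimately have "acyclic ?S" by (rule acyclic_subset[rotated])
  moreover have "\<forall>a\<in>set vs. c (ix a) < k" using c by (auto simp: in_set_conv_nth ix image_subset_iff)
  ultimately show "\<exists>c. (\<forall>a\<in>set vs. c a < k) \<and>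
       acyclic {(a, b). a \<in> set vs \<and> b \<in> set vs \<and> adj a b \<and> c a = c b}"
    by (intro exI[of _ "\<lambda>a. c (ix a)"]) blast
next
  assume "\<exists>c. (\<forall>a\<in>set vs. c a < k) \<and>
       acyclic {(a, b). a \<in> set vs \<and> b \<in> set vs \<and> adj a b \<and> c a = c b}"
  then obtain c where c: "\<forall>a\<in>set vs. c a < k"
    and ac: "acyclic {(a, b). a \<in> set vs \<and> b \<in> set vs \<and> adj a b \<and> c a = c b}" (is "acyclic ?S")
    by blast
  let ?R = "{(u, v). (u, v) \<in> parcs (list_digraph vs adj) \<and> u \<in> pverts (list_digraph vs adj) \<and>
    v \<in> pverts (list_digraph vs adj) \<and> c (vs ! u) = c (vs ! v)}"
  have "(vs ! a, vs ! b) \<in> ?S\<^sup>+" if "(a, b) \<in> ?R\<^sup>+" for a b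
    using that by induction (auto intro: r_into_trancl trancl_into_trancl)
  then have "acyclic ?R" using ac unfolding acyclic_def by blast
  then show "k_colorable k (with_proj (list_digraph vs adj))"
    unfolding k_colorable_pair using c by (intro exI[of _ "\<lambda>u. c (vs ! u)"]) auto
qed

subsection \<open>The colouring gadget\<close>

text \<open>
  A clause is written as its literals followed by an end token. Vertices \<open>Special 0\<close> and
  \<open>Special 1\<close> represent the colours \<open>false\<close> and \<open>true\<close>.
\<close>

type_synonym token = "literal option"

definition tokens :: "literal list list \<Rightarrow> token list" where
  "tokens cs = concat (map (\<lambda>C. map Some C @ [None]) cs)"

datatype vertex = Special nat | Pos nat | Neg nat | Tok nat

definition clause_start :: "token list \<Rightarrow> nat \<Rightarrow> bool" where
  "clause_start ts t \<longleftrightarrow> t = 0 \<or> ts ! (t - 1) = None"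

text \<open>Beyond the digons, the triangles are as follows. \<open>Special 0\<close>,
  \<open>Pos v\<close>, \<open>Neg v\<close> prevents both literals of a variable from being false.
  \<open>Special 1\<close>, \<open>Neg v\<close>, \<open>Tok t\<close> at an occurrence of
  \<open>v\<close>, and \<open>Special 1\<close>, \<open>Pos v\<close>, \<open>Tok t\<close> at a
  negated occurrence, prevent an occurrence and its opposite literal from both being true. An end
  token forms a digon with \<open>Special 1\<close>, hence is false, and leads back to
  \<open>Special 0\<close>. For an empty clause the only token is start and end at once; its digons
  with all special vertices make it uncolourable.\<close>

fun gadget :: "token list \<Rightarrow> vertex \<Rightarrow> vertex \<Rightarrow> bool" where
  "gadget ts (Special i) (Special j) \<longleftrightarrow> i \<noteq> j"
| "gadget ts (Special i) (Pos v) \<longleftrightarrow> True"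
| "gadget ts (Special i) (Neg v) \<longleftrightarrow> i \<noteq> 0"
| "gadget ts (Special i) (Tok t) \<longleftrightarrow> i \<ge> 2 \<or> i = 0 \<and> clause_start ts t \<or> i = 1 \<and> ts ! t = None"
| "gadget ts (Pos v) (Special i) \<longleftrightarrow> i \<ge> 2"
| "gadget ts (Neg v) (Special i) \<longleftrightarrow> i \<noteq> 1"
| "gadget ts (Tok t) (Special i) \<longleftrightarrow> i \<noteq> 0 \<or> ts ! t = None"
| "gadget ts (Pos v) (Neg w) \<longleftrightarrow> v = w"
| "gadget ts (Pos v) (Tok t) \<longleftrightarrow> ts ! t = Some (v, False)"
| "gadget ts (Neg v) (Tok t) \<longleftrightarrow> ts ! t = Some (v, True)"
| "gadget ts (Tok s) (Tok t) \<longleftrightarrow> ts ! s \<noteq> None \<and> t = Suc s"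
| "gadget ts _ _ \<longleftrightarrow> False"

definition gadget_vertices :: "nat \<Rightarrow> nat \<Rightarrow> token list \<Rightarrow> vertex list" where
  "gadget_vertices k n ts =
     map Special [0..<k] @ map Pos [0..<n] @ map Neg [0..<n] @ map Tok [0..<length ts]"

lemma set_gadget_vertices: "set (gadget_vertices k n ts) =
    Special ` {..<k} \<union> Pos ` {..<n} \<union> Neg ` {..<n} \<union> Tok ` {..<length ts}"
  by (auto simp: gadget_vertices_def)

lemma distinct_gadget_vertices: "distinct (gadget_vertices k n ts)"
  by (auto simp: gadget_vertices_def distinct_map inj_on_def)

definition gadget_digraph :: "nat \<Rightarrow> cnf \<Rightarrow> nat pair_pre_digraph" where
  "gadget_digraph k \<phi> =
     list_digraph (gadget_vertices k (fst \<phi>) (tokens (snd \<phi>))) (gadget (tokens (snd \<phi>)))"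

section \<open>Truth of a formula in terms of token positions\<close>

definition tokens_true :: "(nat \<Rightarrow> bool) \<Rightarrow> token list \<Rightarrow> bool" where
  "tokens_true \<sigma> ts \<longleftrightarrow> (\<forall>e<length ts. ts ! e = None \<longrightarrow>
     (\<exists>s<e. (\<exists>v. ts ! s = Some (v, \<sigma> v)) \<and> (\<forall>r. s \<le> r \<and> r < e \<longrightarrow> ts ! r \<noteq> None)))"

text \<open>The end token at position \<open>m\<close> cuts the list: a witness for a later clause
  cannot lie at or before it, because no end token may occur from the witness up to the end of its
  own clause.\<close>

lemma tokens_true_clause:
  "tokens_true \<sigma> (map Some C @ None # ts) \<longleftrightarrow> (\<exists>v. (v, \<sigma> v) \<in> set C) \<and> tokens_true \<sigma> ts"
proof -
  define m where "m = length C"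
  let ?us = "map Some C @ None # ts"
  have lo: "?us ! r = Some (C ! r)" if "r < m" for r using that by (simp add: nth_append m_def)
  have mid: "?us ! m = None" by (simp add: nth_append m_def)
  have hi: "?us ! (Suc m + r) = ts ! r" for r by (simp add: nth_append m_def)
  have len: "length ?us = Suc m + length ts" by (simp add: m_def)
  let ?ok = "\<lambda>us e. \<exists>s<e. (\<exists>v. us ! s = Some (v, \<sigma> v)) \<and> (\<forall>r. s \<le> r \<and> r < e \<longrightarrow> us ! r \<noteq> None)"
  have 1: "?ok ?us m \<longleftrightarrow> (\<exists>v. (v, \<sigma> v) \<in> set C)"
  proof
    assume "?ok ?us m"
    then obtain s v where "s < m" "?us ! s = Some (v, \<sigma> v)" by blast
    then have "(v, \<sigma> v) = C ! s" "s < length C" using lo[of s] by (simp_all add: m_def)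
    then show "\<exists>v. (v, \<sigma> v) \<in> set C" by (metis nth_mem)
  next
    assume "\<exists>v. (v, \<sigma> v) \<in> set C"
    then obtain v s where "s < m" "C ! s = (v, \<sigma> v)" by (metis in_set_conv_nth m_def)
    then show "?ok ?us m" using lo by auto
  qed
  have 2: "?ok ?us (Suc m + e) \<longleftrightarrow> ?ok ts e" for e
  proof
    assume "?ok ?us (Suc m + e)"
    then obtain s v where s: "s < Suc m + e" "?us ! s = Some (v, \<sigma> v)"
      "\<forall>r. s \<le> r \<and> r < Suc m + e \<longrightarrow> ?us ! r \<noteq> None" by blast
    have "s > m"
    proof (rule ccontr)
      assume "\<not> s > m"
      then show False using s(3)[rule_format, of m] mid by simp
    qed
    define s' where "s' = s - Suc m"
    with \<open>s > m\<close> have s': "s = Suc m + s'" by simp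
    have "ts ! r \<noteq> None" if "s' \<le> r" "r < e" for r
      using s(3)[rule_format, of "Suc m + r"] that hi[of r] s' by simp
    moreover have "ts ! s' = Some (v, \<sigma> v)" using s(2) hi[of s'] s' by simp
    moreover have "s' < e" using s(1) s' by simp
    ultimately show "?ok ts e" by blast
  next
    assume "?ok ts e"
    then obtain s v where s: "s < e" "ts ! s = Some (v, \<sigma> v)"
      "\<forall>r. s \<le> r \<and> r < e \<longrightarrow> ts ! r \<noteq> None" by blast
    have "?us ! r \<noteq> None" if "Suc m + s \<le> r" "r < Suc m + e" for r
    proof -
      define r' where "r' = r - Suc m"
      then have "r = Suc m + r'" using that by simp
      then show ?thesis using that s(3)[rule_format, of r'] hi[of r'] by simp
    qed
    moreover have "?us ! (Suc m + s) = Some (v, \<sigma> v)" using s(2) hi[of s] by simp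
    moreover have "Suc m + s < Suc m + e" using s(1) by simp
    ultimately show "?ok ?us (Suc m + e)" by blast
  qed
  have "tokens_true \<sigma> ?us \<longleftrightarrow> ?ok ?us m \<and> (\<forall>e<length ts. ts ! e = None \<longrightarrow> ?ok ?us (Suc m + e))"
    unfolding tokens_true_def len
  proof (intro iffI conjI allI impI)
    fix e assume "?ok ?us m \<and> (\<forall>e<length ts. ts ! e = None \<longrightarrow> ?ok ?us (Suc m + e))"
      and e: "e < Suc m + length ts" "?us ! e = None"
    moreover have "e = m \<or> (\<exists>e'<length ts. e = Suc m + e')"
    proof (cases "e < Suc m")
      case True then show ?thesis using lo[of e] e(2) by (cases "e = m") auto
    next
      case False
      then show ?thesis using e(1) by (intro disjI2 exI[of _ "e - Suc m"]) auto
    qed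
    ultimately show "?ok ?us e" using hi by auto
  next
    assume a: "\<forall>e<Suc m + length ts. ?us ! e = None \<longrightarrow> ?ok ?us e"
    show "?ok ?us m" using a mid by simp
    fix e assume "e < length ts" "ts ! e = None"
    then show "?ok ?us (Suc m + e)" using a hi[of e] by simp
  qed
  then show ?thesis unfolding 1 2 tokens_true_def by simp
qed

lemma tokens_true_tokens:
  "tokens_true \<sigma> (tokens cs) \<longleftrightarrow> (\<forall>C\<in>set cs. \<exists>v. (v, \<sigma> v) \<in> set C)"
proof (induction cs)
  case Nil
  then show ?case by (simp add: tokens_def tokens_true_def)
next
  case (Cons C cs)
  have "tokens (C # cs) = map Some C @ None # tokens cs" by (simp add: tokens_def)
  then show ?case using Cons tokens_true_clause by simp
qed

lemma satisfiable_tokens: "satisfiable \<phi> \<longleftrightarrow> (\<exists>\<sigma>. tokens_true \<sigma> (tokens (snd \<phi>)))"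
proof -
  have "(\<exists>(v, b)\<in>set C. \<sigma> v = b) \<longleftrightarrow> (\<exists>v. (v, \<sigma> v) \<in> set C)" for \<sigma> and C :: "literal list" by auto
  then show ?thesis by (simp add: satisfiable_def tokens_true_tokens)
qed

text \<open>If no literal of a clause were true, all its tokens would have the colour of
  \<open>Special 0\<close>, and the path through them would close to a monochromatic cycle
  there.\<close>

lemma gadget_sound:
  assumes k: "k \<ge> 2" and ts: "\<And>t v b. t < length ts \<Longrightarrow> ts ! t = Some (v, b) \<Longrightarrow> v < n"
    and c: "\<forall>a\<in>set (gadget_vertices k n ts). c a < k"
    and ac: "acyclic {(a, b). a \<in> set (gadget_vertices k n ts) \<and> b \<in> set (gadget_vertices k n ts) \<and>
      gadget ts a b \<and> c a = c b}" (is "acyclic ?R")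
  shows "tokens_true (\<lambda>v. c (Pos v) = c (Special 1)) ts"
proof -
  let ?V = "set (gadget_vertices k n ts)"
  let ?F = "c (Special 0)" and ?T = "c (Special 1)"
  have V: "Special i \<in> ?V \<longleftrightarrow> i < k" "Pos v \<in> ?V \<longleftrightarrow> v < n" "Neg v \<in> ?V \<longleftrightarrow> v < n"
    "Tok t \<in> ?V \<longleftrightarrow> t < length ts" for i v t
    by (auto simp: set_gadget_vertices)
  have arc: "(a, b) \<in> ?R" if "a \<in> ?V" "b \<in> ?V" "gadget ts a b" "c a = c b" for a b
    using that by simp
  have digon: "c a \<noteq> c b" if "a \<in> ?V" "b \<in> ?V" "gadget ts a b" "gadget ts b a" for a b
  proof
    assume "c a = c b"
    then have "(a, b) \<in> ?R" "(b, a) \<in> ?R" using that by auto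
    then have "(a, a) \<in> ?R\<^sup>+" by (meson r_into_trancl trancl_into_trancl)
    then show False using ac by (auto simp: acyclic_def)
  qed
  have triangle: "\<not> (c a = c b \<and> c b = c d)"
    if "a \<in> ?V" "b \<in> ?V" "d \<in> ?V" "gadget ts a b" "gadget ts b d" "gadget ts d a" for a b d
  proof
    assume "c a = c b \<and> c b = c d"
    then have "(a, b) \<in> ?R" "(b, d) \<in> ?R" "(d, a) \<in> ?R" using that by auto
    then have "(a, a) \<in> ?R\<^sup>+" by (meson r_into_trancl trancl_into_trancl)
    then show False using ac by (auto simp: acyclic_def)
  qed
  have inj: "inj_on (\<lambda>i. c (Special i)) {..<k}"
    using digon by (intro inj_onI) (metis V(1) gadget.simps(1) lessThan_iff)
  have "(\<lambda>i. c (Special i)) ` {..<k} \<subseteq> {..<k}" using c V(1) by auto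
  \<comment> \<open>By counting, every colour occurs on a special vertex. A vertex with digons to
    those numbered 2 and higher is left with the first two colours.\<close>
  then have surj: "(\<lambda>i. c (Special i)) ` {..<k} = {..<k}"
    by (intro endo_inj_surj inj) auto
  have two: "c a = ?F \<or> c a = ?T" if a: "a \<in> ?V" "\<And>i. i \<ge> 2 \<Longrightarrow> gadget ts a (Special i) \<and> gadget ts (Special i) a" for a
  proof -
    have "c a \<in> (\<lambda>i. c (Special i)) ` {..<k}" unfolding surj using c a(1) by simp
    then obtain i where i: "i < k" "c a = c (Special i)" by auto
    have "\<not> i \<ge> 2" using digon[of a "Special i"] a i V(1) by auto
    then have "i = 0 \<or> i = 1" by linarith
    then show ?thesis using i by auto
  qed
  have FT: "?F \<noteq> ?T" using digon[of "Special 0" "Special 1"] k V(1) by auto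
  have posc: "c (Pos v) = ?F \<or> c (Pos v) = ?T" if "v < n" for v
    using that V by (intro two) auto
  have negc: "c (Neg v) = ?F \<or> c (Neg v) = ?T" if "v < n" for v
    using that V by (intro two) auto
  have tokc: "c (Tok t) = ?F \<or> c (Tok t) = ?T" if "t < length ts" for t
    using that V by (intro two) auto
  let ?\<sigma> = "\<lambda>v. c (Pos v) = ?T"
  \<comment> \<open>A true occurrence of \<open>v\<close> makes \<open>Neg v\<close> false and
    thereby \<open>Pos v\<close> true; a true negated occurrence excludes a true
    \<open>Pos v\<close> directly.\<close>
  have lit: "?\<sigma> v = b" if t: "t < length ts" "ts ! t = Some (v, b)" "c (Tok t) = ?T" for t v b
  proof -
    have v: "v < n" using ts t by blast
    have k1: "Special 0 \<in> ?V" "Special 1 \<in> ?V" using k V(1) by auto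
    show ?thesis
    proof (cases b)
      case True
      have "c (Neg v) \<noteq> ?T"
        using triangle[of "Neg v" "Tok t" "Special 1"] t v k1 V True by auto
      then have "c (Neg v) = ?F" using negc[OF v] by blast
      then have "c (Pos v) \<noteq> ?F"
        using triangle[of "Special 0" "Pos v" "Neg v"] v k1 V by auto
      then show ?thesis using posc[OF v] True by blast
    next
      case False
      have "c (Pos v) \<noteq> ?T"
        using triangle[of "Pos v" "Tok t" "Special 1"] t v k1 V False by auto
      then show ?thesis using False by blast
    qed
  qed
  show ?thesis
    unfolding tokens_true_def
  proof (intro allI impI, rule ccontr)
    fix e assume e: "e < length ts" "ts ! e = None"
      and no: "\<not> (\<exists>s<e. (\<exists>v. ts ! s = Some (v, ?\<sigma> v)) \<and> (\<forall>r. s \<le> r \<and> r < e \<longrightarrow> ts ! r \<noteq> None))"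
    \<comment> \<open>\<open>ok s\<close> says that no clause ends from \<open>s\<close> up to but
      excluding \<open>e\<close>, so the least such \<open>s\<close> is the first token of the
      clause that ends at \<open>e\<close>.\<close>
    define ok where "ok s \<longleftrightarrow> s \<le> e \<and> (\<forall>r. s \<le> r \<and> r < e \<longrightarrow> ts ! r \<noteq> None)" for s
    define s where "s = (LEAST s. ok s)"
    have "ok e" by (auto simp: ok_def)
    then have oks: "ok s" unfolding s_def by (rule LeastI)
    have start: "clause_start ts s"
    proof (rule ccontr)
      assume "\<not> clause_start ts s"
      then have s0: "s \<noteq> 0" "ts ! (s - 1) \<noteq> None" by (auto simp: clause_start_def)
      have "ts ! r \<noteq> None" if "s - 1 \<le> r" "r < e" for r
        using that s0 oks by (cases "r = s - 1") (auto simp: ok_def)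
      then have "ok (s - 1)" using oks by (auto simp: ok_def)
      then have "s \<le> s - 1" unfolding s_def by (rule Least_le)
      then show False using s0 by simp
    qed
    have colF: "c (Tok r) = ?F" if "s \<le> r" "r \<le> e" for r
    proof (cases "r = e")
      case True
      then have "c (Tok r) \<noteq> ?T" using digon[of "Tok r" "Special 1"] e V k by auto
      then show ?thesis using tokc[of r] e True by auto
    next
      case False
      then have r: "r < e" using that by simp
      then have "ts ! r \<noteq> None" using oks that by (auto simp: ok_def)
      then obtain v b where vb: "ts ! r = Some (v, b)" by auto
      have "\<forall>r'. r \<le> r' \<and> r' < e \<longrightarrow> ts ! r' \<noteq> None" using oks that by (auto simp: ok_def)
      then have "b \<noteq> ?\<sigma> v" using no r vb by blast
      then have "c (Tok r) \<noteq> ?T" using lit[of r v b] r e vb by auto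
      then show ?thesis using tokc[of r] r e by auto
    qed
    have se: "s \<le> e" using oks by (simp add: ok_def)
    have path: "(Special 0, Tok r) \<in> ?R\<^sup>+" if "s \<le> r" "r \<le> e" for r
      using that
    proof (induction r rule: dec_induct)
      case base
      have "(Special 0, Tok s) \<in> ?R"
        using start se e k V colF[of s] by (intro arc) auto
      then show ?case by blast
    next
      case (step r)
      have "ts ! r \<noteq> None" using step oks by (auto simp: ok_def)
      then have "(Tok r, Tok (Suc r)) \<in> ?R"
        using step e V colF[of r] colF[of "Suc r"] by (intro arc) auto
      then show ?case using step by (meson trancl_into_trancl Suc_leD)
    qed
    have "(Tok e, Special 0) \<in> ?R"
      using e V k colF[of e] se by (intro arc) auto
    then have "(Special 0, Special 0) \<in> ?R\<^sup>+"
      using path[of e] se by (meson trancl_into_trancl order_refl)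
    then show False using ac by (auto simp: acyclic_def)
  qed
qed

fun gadget_colouring :: "(nat \<Rightarrow> bool) \<Rightarrow> token list \<Rightarrow> vertex \<Rightarrow> nat" where
  "gadget_colouring \<sigma> ts (Special i) = i"
| "gadget_colouring \<sigma> ts (Pos v) = (if \<sigma> v then 1 else 0)"
| "gadget_colouring \<sigma> ts (Neg v) = (if \<sigma> v then 0 else 1)"
| "gadget_colouring \<sigma> ts (Tok t) =
     (case ts ! t of None \<Rightarrow> 0 | Some (v, b) \<Rightarrow> if \<sigma> v = b then 1 else 0)"

text \<open>A topological order of the monochromatic arcs is given. In colour 0 late tokens precede
  \<open>Special 0\<close> and the other tokens follow it; a clause start is never late, because a
  true occurrence of colour 1 separates it from its end. In colour 1 the tokens precede
  \<open>Special 1\<close>, which precedes the variable vertices.\<close>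

lemma gadget_complete:
  assumes sat: "tokens_true \<sigma> ts"
  shows "acyclic {(a, b). a \<in> set (gadget_vertices k n ts) \<and> b \<in> set (gadget_vertices k n ts) \<and>
      gadget ts a b \<and> gadget_colouring \<sigma> ts a = gadget_colouring \<sigma> ts b}"
proof -
  let ?c = "gadget_colouring \<sigma> ts"
  define N where "N = length ts"
  \<comment> \<open>from a late token the end of its clause is reached inside colour 0\<close>
  define late where "late t \<longleftrightarrow> (\<exists>e. t \<le> e \<and> e < N \<and> ts ! e = None \<and>
    (\<forall>r. t \<le> r \<and> r \<le> e \<longrightarrow> ?c (Tok r) = 0 \<and> (r < e \<longrightarrow> ts ! r \<noteq> None)))" for t
  \<comment> \<open>The value \<open>N + 1\<close> lies above all token indices, the offset
    \<open>N + 2\<close> moves a token behind the special vertex, and \<open>3 * N + 5\<close>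
    exceeds all of these. A variable vertex has monochromatic arcs only with special vertices; among
    them \<open>Neg v\<close> of colour 0 is the one that needs the low rank, as its arc leads to
    \<open>Special 0\<close>.\<close>
  define rank where "rank a = (case a of
      Special i \<Rightarrow> N + 1
    | Pos v \<Rightarrow> 3 * N + 5
    | Neg v \<Rightarrow> if \<sigma> v then 0 else 3 * N + 5
    | Tok t \<Rightarrow> if ?c (Tok t) = 1 \<or> late t then t else N + 2 + t)" for a
  have first: "\<not> late t" if t: "clause_start ts t" for t
  proof
    assume "late t"
    then obtain e where e: "t \<le> e" "e < N" "ts ! e = None"
      and z: "\<And>r. t \<le> r \<Longrightarrow> r \<le> e \<Longrightarrow> ?c (Tok r) = 0"
      unfolding late_def by blast
    obtain s v where s: "s < e" "ts ! s = Some (v, \<sigma> v)" "\<forall>r. s \<le> r \<and> r < e \<longrightarrow> ts ! r \<noteq> None"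
      using sat e unfolding tokens_true_def N_def by blast
    have "t \<le> s"
    proof (rule ccontr)
      assume "\<not> t \<le> s"
      then have "s \<le> t - 1" "t - 1 < e" "t \<noteq> 0" using e by auto
      then show False using s(3) t by (auto simp: clause_start_def)
    qed
    then have "?c (Tok s) = 0" using z[of s] s(1) by simp
    then show False using s(2) by simp
  qed
  have last: "late t" if "t < N" "ts ! t = None" for t
    unfolding late_def using that by (intro exI[of _ t]) auto
  have prev: "late t" if t: "late (Suc t)" "ts ! t \<noteq> None" "?c (Tok t) = 0" for t
  proof -
    from t(1) obtain e where e: "Suc t \<le> e" "e < N" "ts ! e = None"
      and z: "\<forall>r. Suc t \<le> r \<and> r \<le> e \<longrightarrow> ?c (Tok r) = 0 \<and> (r < e \<longrightarrow> ts ! r \<noteq> None)"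
      unfolding late_def by blast
    have "?c (Tok r) = 0 \<and> (r < e \<longrightarrow> ts ! r \<noteq> None)" if "t \<le> r" "r \<le> e" for r
      using z t(2,3) that by (cases "r = t") auto
    then show ?thesis unfolding late_def using e by (intro exI[of _ e]) auto
  qed
  have "rank a < rank b"
    if a: "a \<in> set (gadget_vertices k n ts)" and b: "b \<in> set (gadget_vertices k n ts)"
      and ab: "gadget ts a b" "?c a = ?c b" for a b
  proof (cases a)
    case a: (Special i)
    show ?thesis
    proof (cases b)
      case (Tok t)
      then show ?thesis
        using a ab first[of t] by (auto simp: rank_def split: option.splits if_splits)
    qed (use a ab in \<open>auto simp: rank_def split: if_splits\<close>)
  next
    case a: (Pos v)
    then show ?thesis using ab by (cases b) (auto split: if_splits)
  next
    case a: (Neg v)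
    then show ?thesis using ab by (cases b) (auto simp: rank_def split: if_splits)
  next
    case a: (Tok t)
    have t: "t < N" using \<open>a \<in> _\<close> a by (auto simp: set_gadget_vertices N_def)
    show ?thesis
    proof (cases b)
      case b: (Special i)
      show ?thesis
      proof (cases "?c (Tok t) = 1 \<or> late t")
        case True then show ?thesis using a b t by (simp add: rank_def)
      next
        case False
        then have "ts ! t \<noteq> None" using last t by blast
        then show ?thesis using False a b ab by (auto split: option.splits if_splits)
      qed
    next
      case b: (Tok s)
      then have s: "s = Suc t" "ts ! t \<noteq> None" using a ab by auto
      have eq: "?c (Tok t) = ?c (Tok s)" using a b ab by simp
      have "?c (Tok t) = 0 \<or> ?c (Tok t) = 1" by (auto split: option.split)
      then show ?thesis using eq s t prev[of t] unfolding rank_def a b by auto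
    qed (use a ab in auto)
  qed
  then show ?thesis
    \<comment> \<open>The order criterion wants a measure that decreases along arcs, hence the
      sign.\<close>
    by (intro acyclicI_order[where f = "\<lambda>a. - int (rank a)"]) auto
qed

lemma gadget_irrefl: "\<not> gadget ts a a"
  by (cases a) auto

theorem gadget_digraph_colorable:
  assumes "k \<ge> 2" and "\<forall>C\<in>set (snd \<phi>). fst ` set C \<subseteq> {..<fst \<phi>}"
  shows "k_colorable k (with_proj (gadget_digraph k \<phi>)) \<longleftrightarrow> satisfiable \<phi>"
proof -
  let ?ts = "tokens (snd \<phi>)" and ?n = "fst \<phi>"
  have vars: "v < ?n" if "t < length ?ts" "?ts ! t = Some (v, b)" for t v b
  proof -
    have "Some (v, b) \<in> set ?ts" using that by (metis nth_mem)
    then obtain C where "C \<in> set (snd \<phi>)" "(v, b) \<in> set C" by (auto simp: tokens_def split: if_splits)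
    then show ?thesis using assms(2) by fastforce
  qed
  have "(\<exists>c. (\<forall>a\<in>set (gadget_vertices k ?n ?ts). c a < k) \<and>
       acyclic {(a, b). a \<in> set (gadget_vertices k ?n ?ts) \<and> b \<in> set (gadget_vertices k ?n ?ts) \<and>
         gadget ?ts a b \<and> c a = c b}) \<longleftrightarrow> (\<exists>\<sigma>. tokens_true \<sigma> ?ts)" (is "?L \<longleftrightarrow> ?R")
  proof
    assume ?L
    then obtain c where c: "\<forall>a\<in>set (gadget_vertices k ?n ?ts). c a < k"
      and ac: "acyclic {(a, b). a \<in> set (gadget_vertices k ?n ?ts) \<and> b \<in> set (gadget_vertices k ?n ?ts) \<and>
         gadget ?ts a b \<and> c a = c b}" by blast
    from gadget_sound[OF assms(1) _ c ac] vars show ?R by blast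
  next
    assume ?R
    then obtain \<sigma> where \<sigma>: "tokens_true \<sigma> ?ts" by blast
    have "\<forall>a\<in>set (gadget_vertices k ?n ?ts). gadget_colouring \<sigma> ?ts a < k"
      using assms(1) by (auto simp: set_gadget_vertices split: option.split)
    with gadget_complete[OF \<sigma>] show ?L by (intro exI[of _ "gadget_colouring \<sigma> ?ts"] conjI)
  qed
  then show ?thesis
    unfolding gadget_digraph_def k_colorable_list_digraph[OF distinct_gadget_vertices]
      satisfiable_tokens .
qed

text \<open>Without special vertices the arcs run from positive to negative literals, from literals
  to tokens and from a token to its successor. The special vertices are the first \<open>k\<close>
  entries of the list, so the removed set is \<open>{..<k}\<close> and has exactly \<open>k\<close>
  elements.\<close>

lemma gadget_digraph_fvs: "gadget_digraph k \<phi> \<in> digraphs_with_fvs k"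
proof -
  let ?ts = "tokens (snd \<phi>)" and ?n = "fst \<phi>"
  let ?vs = "gadget_vertices k ?n ?ts"
  have len: "k \<le> length ?vs" by (simp add: gadget_vertices_def)
  define rank where "rank a = (case a of Special i \<Rightarrow> 0 | Pos v \<Rightarrow> 0 | Neg v \<Rightarrow> 1 | Tok t \<Rightarrow> 2 + int t)" for a
  have nonspecial: "?vs ! u \<notin> range Special" if "k \<le> u" "u < length ?vs" for u
  proof -
    have "?vs ! u = (map Pos [0..<?n] @ map Neg [0..<?n] @ map Tok [0..<length ?ts]) ! (u - k)"
      using that by (simp add: gadget_vertices_def nth_append)
    also have "\<dots> \<in> set (map Pos [0..<?n] @ map Neg [0..<?n] @ map Tok [0..<length ?ts])"
      using that by (intro nth_mem) (simp add: gadget_vertices_def)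
    finally show ?thesis by auto
  qed
  have inc: "rank a < rank b" if "gadget ?ts a b" "a \<notin> range Special" "b \<notin> range Special" for a b
    using that by (cases a; cases b) (auto simp: rank_def)
  let ?D = "gadget_digraph k \<phi>"
  let ?A = "pverts ?D - {..<k}"
  have "acyclic (parcs ?D \<inter> ?A \<times> ?A)"
  proof (rule acyclicI_order[where f = "\<lambda>u. - rank (?vs ! u)"])
    fix u v assume uv: "(u, v) \<in> parcs ?D \<inter> ?A \<times> ?A"
    then have "gadget ?ts (?vs ! u) (?vs ! v)" "?vs ! u \<notin> range Special" "?vs ! v \<notin> range Special"
      using nonspecial[of u] nonspecial[of v] by (auto simp: gadget_digraph_def)
    then show "- rank (?vs ! v) < - rank (?vs ! u)" using inc by auto
  qed
  then have "feedback_vertex_set (with_proj ?D) {..<k}"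
    unfolding feedback_vertex_set_def with_proj_simps acyclic_digraph_induce
    using len by (auto simp: gadget_digraph_def)
  moreover have "?D \<in> digraph_instances"
    unfolding gadget_digraph_def by (rule list_digraph_instance) (rule gadget_irrefl)
  ultimately show ?thesis unfolding digraphs_with_fvs_def by (auto intro!: exI[of _ "{..<k}"])
qed

subsection \<open>Writing the gadget digraph\<close>

fun encode_token :: "token \<Rightarrow> bool list" where
  "encode_token None = [False]"
| "encode_token (Some l) = encode_literal l"

definition token_word :: "token list \<Rightarrow> bool list" where
  "token_word ts = concat (map encode_token ts)"

lemma token_word_simps [simp]:
  "token_word [] = []" "token_word (t # ts) = encode_token t @ token_word ts"
  "token_word (ts @ us) = token_word ts @ token_word us"
  by (simp_all add: token_word_def)

text \<open>The first bit tells a literal from the end of a clause, so behind the header the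
  encoding is a plain concatenation of self-delimiting token words.\<close>

lemma encode_cnf_tokens:
  "encode_cnf (n, cs) = replicate n True @ False # token_word (tokens cs)"
proof -
  have "encode_clause C = token_word (map Some C @ [None])" for C
    by (simp add: encode_clause_def token_word_def comp_def)
  then have "concat (map encode_clause cs) = token_word (tokens cs)"
    by (induction cs) (simp_all add: tokens_def)
  then show ?thesis by simp
qed

text \<open>
  State 0: reading the number of variables; 1: at the start of a token; 2: at the sign of a
  literal; 3: inside the variable of a literal. The bits \<open>False\<close> and \<open>True\<close> are the symbols 1 and 2.
\<close>
definition parse :: "nat \<Rightarrow> nat \<Rightarrow> nat" where
  "parse q s = (if q = 0 then (if s = 1 then 1 else 0)
     else if q = 1 then (if s = 2 then 2 else 1)
     else if q = 2 then 3
     else if s = 1 then 1 else 3)"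

definition parse_word :: "nat \<Rightarrow> bool list \<Rightarrow> nat" where
  "parse_word = foldl (\<lambda>q b. parse q (if b then 2 else 1))"

lemma parse_word_simps [simp]:
  "parse_word q [] = q" "parse_word q (b # w) = parse_word (parse q (if b then 2 else 1)) w"
  "parse_word q (v @ w) = parse_word (parse_word q v) w"
  by (simp_all add: parse_word_def)

lemma parse_le: "parse q s \<le> 3"
  by (simp add: parse_def)

lemma word_cells_nth: "i < length x \<Longrightarrow> word_cells x (int i) = (if x ! i then 2 else 1)"
  by (simp add: word_cells_def word_tape_def bits_def)

lemma automaton_parse: "j \<le> length x \<Longrightarrow> automaton parse 0 x j = parse_word 0 (take j x)"
proof (induction j)
  case (Suc j)
  then show ?case
    by (simp add: take_Suc_conv_app_nth word_cells_nth parse_le min_absorb2)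
qed simp

lemma parse_word_nonzero: "q \<noteq> 0 \<Longrightarrow> parse_word q w \<noteq> 0"
  by (induction w arbitrary: q) (auto simp: parse_def)

lemma parse_word_header: "parse_word 0 (replicate n True) = 0"
  by (induction n) (auto simp: parse_def)

lemma parse_word_var: "parse_word 3 (replicate n True) = 3"
  by (induction n) (auto simp: parse_def)

lemma parse_word_token [simp]: "parse_word (Suc 0) (encode_token t) = Suc 0"
  by (cases t) (auto simp: parse_def parse_word_var)

lemma parse_word_token_word [simp]: "parse_word (Suc 0) (token_word ts) = Suc 0"
  by (induction ts) auto

text \<open>Together with the return to state 1 after each complete token, this makes state 1 the
  mark of a token start.\<close>

lemma parse_word_inside_token:
  assumes "0 < j" "j < length (encode_token t)"
  shows "parse_word 1 (take j (encode_token t)) \<ge> 2"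
proof -
  obtain v b where t: "t = Some (v, b)" using assms by (cases t) auto
  obtain i where j: "j = Suc i" using assms by (cases j) auto
  show ?thesis
  proof (cases i)
    case 0
    then show ?thesis using t j by (simp add: parse_def)
  next
    case (Suc m)
    then have "take j (encode_token t) = [True, b] @ replicate m True"
      using t j assms by (simp add: min_absorb1)
    then show ?thesis by (simp add: parse_def parse_word_var)
  qed
qed

lemma length_encode_token_pos: "0 < length (encode_token t)"
  by (cases t) auto

lemma upt_add_eq_map: "[0..<a + b] = [0..<a] @ map ((+) a) [0..<b]"
  by (induction b) auto

lemma token_starts:
  "filter (\<lambda>i. parse_word 1 (take i (token_word ts)) = 1) [0..<length (token_word ts)] =
     map (\<lambda>t. length (token_word (take t ts))) [0..<length ts]"
proof (induction ts)
  case (Cons u ts)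
  let ?a = "length (encode_token u)" and ?w = "token_word ts"
  have first: "filter (\<lambda>i. parse_word 1 (take i (encode_token u @ ?w)) = 1) [0..<?a] = [0]"
  proof -
    have "[0..<?a] = 0 # [1..<?a]" using upt_conv_Cons[OF length_encode_token_pos[of u]] by simp
    moreover have "parse_word 1 (take i (encode_token u @ ?w)) \<noteq> 1" if "i \<in> set [1..<?a]" for i
      using parse_word_inside_token[of i u] that by simp
    then have "filter (\<lambda>i. parse_word 1 (take i (encode_token u @ ?w)) = 1) [1..<?a] = []"
      unfolding filter_empty_conv by blast
    ultimately show ?thesis by simp
  qed
  have rest: "filter (\<lambda>i. parse_word 1 (take i (encode_token u @ ?w)) = 1) (map ((+) ?a) [0..<length ?w]) =
      map ((+) ?a) (filter (\<lambda>i. parse_word 1 (take i ?w) = 1) [0..<length ?w])"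
    by (simp add: filter_map comp_def)
  have upt: "[0..<length (u # ts)] = 0 # map Suc [0..<length ts]"
    using upt_conv_Cons[of 0 "length (u # ts)"] by (simp add: map_Suc_upt del: upt_Suc)
  show ?case
    unfolding upt
    by (simp only: token_word_simps length_append upt_add_eq_map filter_append first rest Cons)
      (simp add: comp_def)
qed simp

definition token_pos :: "nat \<Rightarrow> token list \<Rightarrow> nat \<Rightarrow> nat" where
  "token_pos n ts t = Suc n + length (token_word (take t ts))"

lemma cnf_word_at_token:
  assumes "t < length ts"
  shows "replicate n True @ False # token_word ts =
    (replicate n True @ False # token_word (take t ts)) @ encode_token (ts ! t) @ token_word (drop (Suc t) ts)"
proof -
  have "token_word ts = token_word (take t ts) @ encode_token (ts ! t) @ token_word (drop (Suc t) ts)"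
    using arg_cong[OF id_take_nth_drop[OF assms], of token_word] by simp
  then show ?thesis by simp
qed

locale cnf_word =
  fixes n :: nat and ts :: "token list" and x :: "bool list"
  assumes x: "x = replicate n True @ False # token_word ts"
begin

lemma length_x: "length x = Suc n + length (token_word ts)"
  by (simp add: x)

lemma state_header: "i \<le> n \<Longrightarrow> automaton parse 0 x i = 0"
  by (simp add: automaton_parse length_x) (simp add: x parse_word_header min_absorb1)

lemma state_after_header:
  assumes "i \<le> length (token_word ts)"
  shows "automaton parse 0 x (Suc n + i) = parse_word 1 (take i (token_word ts))"
proof -
  have "take (Suc n + i) x = (replicate n True @ [False]) @ take i (token_word ts)"
    by (simp add: x)
  moreover have "automaton parse 0 x (Suc n + i) = parse_word 0 (take (Suc n + i) x)"
    using assms by (intro automaton_parse) (simp add: length_x)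
  ultimately show ?thesis by (simp add: parse_word_header) (simp add: parse_def)
qed

text \<open>The \<open>False\<close> that closes the header drives the automaton out of state 0 for
  good; state 0 after \<open>i + 1\<close> symbols thus singles out the \<open>n\<close> variable
  indices.\<close>

lemma header_iff: "i < length x \<Longrightarrow> automaton parse 0 x (Suc i) = 0 \<longleftrightarrow> i < n"
proof (cases "i < n")
  case False
  assume "i < length x"
  then have "automaton parse 0 x (Suc n + (i - n)) = parse_word 1 (take (i - n) (token_word ts))"
    using False by (intro state_after_header) (simp add: length_x)
  then show ?thesis using False parse_word_nonzero[of 1] by simp
qed (simp add: state_header del: automaton.simps)

text \<open>The range exceeds the input by \<open>k\<close> because one index range serves all
  classes of vertices, the special ones included.\<close>

lemma filter_tokens:
  "filter (\<lambda>i. i < length x \<and> automaton parse 0 x i = 1) [0..<k + length x] =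
     map (token_pos n ts) [0..<length ts]"
proof -
  let ?P = "\<lambda>i. i < length x \<and> automaton parse 0 x i = 1"
  have "[0..<k + length x] = [0..<Suc n] @ map ((+) (Suc n)) [0..<length (token_word ts)]
      @ map ((+) (length x)) [0..<k]"
    by (simp only: add.commute[of k] upt_add_eq_map length_x append_assoc)
  moreover have "filter ?P [0..<Suc n] = []"
    by (auto simp: filter_empty_conv state_header simp del: upt_Suc)
  moreover have "filter ?P (map ((+) (length x)) [0..<k]) = []"
    by (auto simp: filter_empty_conv)
  moreover have "filter ?P (map ((+) (Suc n)) [0..<length (token_word ts)]) =
      map ((+) (Suc n)) (filter (\<lambda>i. parse_word 1 (take i (token_word ts)) = 1) [0..<length (token_word ts)])"
  proof -
    have "filter (?P \<circ> (+) (Suc n)) [0..<length (token_word ts)] =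
        filter (\<lambda>i. parse_word 1 (take i (token_word ts)) = 1) [0..<length (token_word ts)]"
      using state_after_header by (intro filter_cong refl) (auto simp: length_x simp del: automaton.simps add_Suc)
    then show ?thesis by (simp only: filter_map)
  qed
  ultimately show ?thesis
    unfolding token_starts by (simp add: comp_def token_pos_def[abs_def] del: upt_Suc)
qed

lemma token_pos_less: "t < length ts \<Longrightarrow> token_pos n ts t < length x"
  using arg_cong[OF cnf_word_at_token[of t ts n], of length] length_encode_token_pos[of "ts ! t"]
  by (simp add: x token_pos_def)

lemma token_pos_Suc: "t < length ts \<Longrightarrow> token_pos n ts (Suc t) = token_pos n ts t + length (encode_token (ts ! t))"
  by (simp add: token_pos_def take_Suc_conv_app_nth)

lemma token_pos_mono:
  assumes "s < t" "t < length ts"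
  shows "token_pos n ts s < token_pos n ts t"
  using assms
proof (induction t)
  case (Suc t)
  then have "token_pos n ts t < token_pos n ts (Suc t)"
    using token_pos_Suc[of t] length_encode_token_pos[of "ts ! t"] by simp
  then show ?case using Suc by (cases "s = t") auto
qed simp

lemma token_pos_less_iff:
  assumes "s < length ts" "t < length ts"
  shows "token_pos n ts s < token_pos n ts t \<longleftrightarrow> s < t"
  using token_pos_mono[of s t] token_pos_mono[of t s] assms
  by (cases s t rule: linorder_cases) auto

lemma token_iff:
  assumes "i < length x"
  shows "automaton parse 0 x i = 1 \<longleftrightarrow> (\<exists>t<length ts. i = token_pos n ts t)"
proof -
  have "i \<in> set (filter (\<lambda>i. i < length x \<and> automaton parse 0 x i = 1) [0..<0 + length x]) \<longleftrightarrow>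
      i \<in> set (map (token_pos n ts) [0..<length ts])"
    unfolding filter_tokens ..
  then show ?thesis using assms by auto
qed

text \<open>Counting the token starts before a position recovers the index of the token, which is
  how consecutive tokens of varying length are recognised.\<close>

lemma token_rank:
  assumes "t < length ts"
  shows "(\<Sum>j<token_pos n ts t. if automaton parse 0 x j = 1 then 1 else 0) = t"
proof -
  have "(\<Sum>j<token_pos n ts t. if automaton parse 0 x j = 1 then 1 else 0) =
      card {j. j < token_pos n ts t \<and> automaton parse 0 x j = 1}"
    by (simp add: sum.If_cases Int_def)
  also have "{j. j < token_pos n ts t \<and> automaton parse 0 x j = 1} = token_pos n ts ` {..<t}"
  proof (intro equalityI subsetI)
    fix j assume "j \<in> {j. j < token_pos n ts t \<and> automaton parse 0 x j = 1}"
    then have j: "j < token_pos n ts t" "automaton parse 0 x j = 1" by auto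
    then obtain s where s: "s < length ts" "j = token_pos n ts s"
      using token_iff[of j] token_pos_less[OF assms] by auto
    then show "j \<in> token_pos n ts ` {..<t}" using j token_pos_less_iff[of s t] assms by auto
  next
    fix j assume "j \<in> token_pos n ts ` {..<t}"
    then obtain s where s: "s < t" "j = token_pos n ts s" by auto
    then have "j < token_pos n ts t" "j < length x"
      using token_pos_mono[of s t] assms token_pos_less[OF assms] by auto
    then show "j \<in> {j. j < token_pos n ts t \<and> automaton parse 0 x j = 1}"
      using token_iff[of j] s assms order_less_trans[OF s(1) assms] by blast
  qed
  also have "card (token_pos n ts ` {..<t}) = card {..<t}"
  proof (intro card_image inj_onI)
    fix a b assume "a \<in> {..<t}" "b \<in> {..<t}" "token_pos n ts a = token_pos n ts b"
    then show "a = b"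
      using token_pos_less_iff[of a b] token_pos_less_iff[of b a] assms
      by (cases a b rule: linorder_cases) auto
  qed
  finally show ?thesis by simp
qed

lemma cell_token:
  assumes "t < length ts" "j < length (encode_token (ts ! t))"
  shows "word_cells x (int (token_pos n ts t + j)) = (if encode_token (ts ! t) ! j then 2 else 1)"
proof -
  have len: "length (replicate n True @ False # token_word (take t ts)) = token_pos n ts t"
    by (simp add: token_pos_def)
  have "x ! (token_pos n ts t + j) = encode_token (ts ! t) ! j"
    unfolding x cnf_word_at_token[OF assms(1)] using assms(2)
    by (simp only: len[symmetric] nth_append_length_plus) (simp add: nth_append)
  moreover have "token_pos n ts t + j < length x"
    using arg_cong[OF cnf_word_at_token[OF assms(1), of n], of length] assms(2) len by (simp add: x)
  ultimately show ?thesis by (simp only: word_cells_nth)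
qed

lemma cell_token_start:
  assumes "t < length ts"
  shows "word_cells x (int (token_pos n ts t)) = (if ts ! t = None then 1 else 2)"
  using cell_token[OF assms, of 0] length_encode_token_pos[of "ts ! t"]
  by (cases "ts ! t") (auto split: if_splits)

text \<open>The run of \<open>True\<close> symbols behind the sign ends at exactly one place, so the
  pattern fits only for the variable actually written.\<close>

lemma cell_literal:
  assumes t: "t < length ts"
  shows "word_cells x (int (token_pos n ts t)) = 2 \<and>
    word_cells x (int (token_pos n ts t + 1)) = (if b then 2 else 1) \<and>
    (\<forall>j<v. word_cells x (int (token_pos n ts t + 2 + j)) = 2) \<and>
    word_cells x (int (token_pos n ts t + 2 + v)) = 1 \<longleftrightarrow> ts ! t = Some (v, b)"
proof (cases "ts ! t")
  case None
  then show ?thesis using cell_token_start[OF t] by simp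
next
  case (Some l)
  obtain w d where l: "l = (w, d)" by (cases l)
  have len: "length (encode_token (ts ! t)) = w + 3" using Some l by simp
  have "word_cells x (int (token_pos n ts t)) = 2" using cell_token_start[OF t] Some by simp
  moreover have "word_cells x (int (token_pos n ts t + 1)) = (if d then 2 else 1)"
    using cell_token[OF t, of 1] len Some l by simp
  moreover have var: "word_cells x (int (token_pos n ts t + 2 + j)) = (if j < w then 2 else 1)" if "j \<le> w" for j
    using cell_token[OF t, of "2 + j"] len Some l that
    by (simp add: nth_append add.assoc)
  have "(\<forall>j<v. word_cells x (int (token_pos n ts t + 2 + j)) = 2) \<and>
    word_cells x (int (token_pos n ts t + 2 + v)) = 1 \<longleftrightarrow> v = w"
  proof
    assume a: "(\<forall>j<v. word_cells x (int (token_pos n ts t + 2 + j)) = 2) \<and>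
      word_cells x (int (token_pos n ts t + 2 + v)) = 1"
    have "\<not> v < w" using var[of v] a by auto
    moreover have "\<not> w < v"
    proof
      assume "w < v"
      then have "word_cells x (int (token_pos n ts t + 2 + w)) = 2" using a by blast
      then show False using var[of w] by simp
    qed
    ultimately show "v = w" by simp
  next
    assume v: "v = w"
    show "(\<forall>j<v. word_cells x (int (token_pos n ts t + 2 + j)) = 2) \<and>
      word_cells x (int (token_pos n ts t + 2 + v)) = 1"
      unfolding v using var by auto
  qed
  ultimately show ?thesis using Some l by (cases b; cases d) auto
qed

text \<open>One symbol before a token the automaton is about to read the last symbol of what
  precedes. It is then in state 0 if that is the header, in state 1 if it is the single symbol of an
  end token, and in a higher state inside a literal.\<close>

lemma clause_start_iff:
  assumes t: "t < length ts"
  shows "automaton parse 0 x (token_pos n ts t - 1) \<le> 1 \<longleftrightarrow> clause_start ts t"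
proof (cases t)
  case 0
  then show ?thesis using state_header[of n] by (simp add: token_pos_def clause_start_def)
next
  case (Suc s)
  then have s: "s < length ts" using t by simp
  let ?u = "ts ! s"
  have pos: "token_pos n ts t - 1 = token_pos n ts s + (length (encode_token ?u) - 1)"
    unfolding Suc token_pos_Suc[OF s] using length_encode_token_pos[of ?u] by arith
  have "length (token_word (take s ts) @ encode_token ?u) \<le> length (token_word ts)"
    using arg_cong[OF cnf_word_at_token[OF s, of n], of length] by simp
  then have "automaton parse 0 x (token_pos n ts t - 1) =
      parse_word 1 (take (length (token_word (take s ts)) + (length (encode_token ?u) - 1)) (token_word ts))"
    unfolding pos token_pos_def[of n ts s] add.assoc by (intro state_after_header) simp
  also have "token_word ts = token_word (take s ts) @ encode_token ?u @ token_word (drop (Suc s) ts)"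
    using cnf_word_at_token[OF s, of n] by simp
  also have "take (length (token_word (take s ts)) + (length (encode_token ?u) - 1)) \<dots> =
      token_word (take s ts) @ take (length (encode_token ?u) - 1) (encode_token ?u)"
    by simp
  finally have "automaton parse 0 x (token_pos n ts t - 1) =
      parse_word 1 (take (length (encode_token ?u) - 1) (encode_token ?u))" by simp
  then show ?thesis
    using Suc parse_word_inside_token[of "length (encode_token ?u) - 1" ?u]
    by (cases ?u) (auto simp: clause_start_def)
qed

end


section \<open>Boolean tests on the input and on encoded vertices\<close>

abbreviation holds :: "bool list \<Rightarrow> (nat \<Rightarrow> nat) \<Rightarrow> nexp \<Rightarrow> bool" where
  "holds x \<rho> e \<equiv> nval x \<rho> e \<noteq> 0"

definition Not_n :: "nexp \<Rightarrow> nexp" where "Not_n a = Sub (Num 1) a"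
definition And_n :: "nexp \<Rightarrow> nexp \<Rightarrow> nexp" where "And_n a b = Cond a b (Num 0)"
definition Or_n :: "nexp \<Rightarrow> nexp \<Rightarrow> nexp" where "Or_n a b = Cond a (Num 1) b"
definition Le_n :: "nexp \<Rightarrow> nexp \<Rightarrow> nexp" where "Le_n a b = Not_n (Sub a b)"
definition Eq_n :: "nexp \<Rightarrow> nexp \<Rightarrow> nexp" where "Eq_n a b = And_n (Le_n a b) (Le_n b a)"
definition All_n :: "nat \<Rightarrow> nexp \<Rightarrow> nexp \<Rightarrow> nexp" where "All_n i e p = Not_n (Sum i e (Not_n p))"
text \<open>The automaton whose state is the last symbol read: after \<open>e + 1\<close> symbols
  this is the symbol in cell \<open>e\<close>, and 0 beyond the input.\<close>

definition Cell :: "nexp \<Rightarrow> nexp" where "Cell e = Aut (\<lambda>q s. s) 0 (Add e (Num 1))"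
definition State :: "nexp \<Rightarrow> nexp" where "State e = Aut parse 0 e"

lemma holds_simps [simp]:
  "holds x \<rho> (Not_n a) \<longleftrightarrow> \<not> holds x \<rho> a"
  "holds x \<rho> (And_n a b) \<longleftrightarrow> holds x \<rho> a \<and> holds x \<rho> b"
  "holds x \<rho> (Or_n a b) \<longleftrightarrow> holds x \<rho> a \<or> holds x \<rho> b"
  "holds x \<rho> (Le_n a b) \<longleftrightarrow> nval x \<rho> a \<le> nval x \<rho> b"
  "holds x \<rho> (Eq_n a b) \<longleftrightarrow> nval x \<rho> a = nval x \<rho> b"
  by (auto simp: Not_n_def And_n_def Or_n_def Le_n_def Eq_n_def)

lemma holds_All_n [simp]:
  "holds x \<rho> (All_n i e p) \<longleftrightarrow> (\<forall>k<nval x \<rho> e. holds x (\<rho>(i := k)) p)"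
proof -
  have "holds x \<rho> (All_n i e p) \<longleftrightarrow> (\<Sum>k<nval x \<rho> e. nval x (\<rho>(i := k)) (Not_n p)) = 0"
    by (simp only: All_n_def holds_simps nval.simps not_not)
  also have "\<dots> \<longleftrightarrow> (\<forall>k<nval x \<rho> e. \<not> holds x (\<rho>(i := k)) (Not_n p))"
    by (auto simp del: holds_simps)
  finally show ?thesis by (simp only: holds_simps not_not)
qed

lemma word_cells_le: "word_cells x p \<le> 2"
  by (auto simp: word_cells_def word_tape_def bits_def nat_less_iff)

lemma nval_Cell [simp]: "nval x \<rho> (Cell e) = word_cells x (int (nval x \<rho> e))"
  using word_cells_le[of x "int (nval x \<rho> e)"] by (simp add: Cell_def)

lemma nval_State [simp]: "nval x \<rho> (State e) = automaton parse 0 x (nval x \<rho> e)"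
  by (simp add: State_def)

text \<open>
  In the expressions below a vertex is a pair of a class (0: special, 1: positive literal,
  2: negative literal, 3: token) and an index, which for a token is its position in the input.
  Variable 0 always holds the length of the input.
\<close>

fun vclass :: "vertex \<Rightarrow> nat" where
  "vclass (Special i) = 0"
| "vclass (Pos v) = 1"
| "vclass (Neg v) = 2"
| "vclass (Tok t) = 3"

fun vindex :: "nat \<Rightarrow> token list \<Rightarrow> vertex \<Rightarrow> nat" where
  "vindex n ts (Special i) = i"
| "vindex n ts (Pos v) = v"
| "vindex n ts (Neg v) = v"
| "vindex n ts (Tok t) = token_pos n ts t"

definition By_class :: "nat \<Rightarrow> nexp \<Rightarrow> nexp \<Rightarrow> nexp \<Rightarrow> nexp \<Rightarrow> nexp" where
  "By_class c a0 a1 a2 a3 = Cond (Eq_n (Var c) (Num 0)) a0 (Cond (Eq_n (Var c) (Num 1)) a1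
     (Cond (Eq_n (Var c) (Num 2)) a2 a3))"

lemma nval_By_class [simp]:
  "nval x \<rho> (By_class c a0 a1 a2 a3) = (if \<rho> c = 0 then nval x \<rho> a0 else if \<rho> c = 1 then nval x \<rho> a1
     else if \<rho> c = 2 then nval x \<rho> a2 else nval x \<rho> a3)"
  using holds_simps(5)[of x \<rho> "Var c"] by (simp add: By_class_def)

definition Is_vertex :: "nat \<Rightarrow> nat \<Rightarrow> nat \<Rightarrow> nexp" where
  "Is_vertex k c i =
     (let header = And_n (Not_n (Le_n (Var 0) (Var i))) (Eq_n (State (Add (Var i) (Num 1))) (Num 0))
      in By_class c (Not_n (Le_n (Num k) (Var i))) header header
        (And_n (Not_n (Le_n (Var 0) (Var i))) (Eq_n (State (Var i)) (Num 1))))"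

text \<open>The index range is generous and the test discards what is not a vertex. Running through
  the classes first and the indices second reproduces the order of
  \<open>gadget_vertices\<close>.\<close>

definition For_vertices :: "nat \<Rightarrow> nat \<Rightarrow> nat \<Rightarrow> wexp \<Rightarrow> wexp" where
  "For_vertices k c i w = For c (Num 4) (For i (Add (Num k) (Var 0)) (If_w (Is_vertex k c i) w))"

text \<open>Variables 1 to 4 are taken by the two vertices under comparison; 5 is the bound variable
  here and in \<open>Token_rank\<close>.\<close>

definition Is_literal :: "nat \<Rightarrow> bool \<Rightarrow> nat \<Rightarrow> nexp" where
  "Is_literal i b v = And_n (Eq_n (Cell (Var i)) (Num 2))
     (And_n (Eq_n (Cell (Add (Var i) (Num 1))) (Num (if b then 2 else 1)))
     (And_n (All_n 5 (Var v) (Eq_n (Cell (Add (Add (Var i) (Num 2)) (Var 5))) (Num 2)))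
       (Eq_n (Cell (Add (Add (Var i) (Num 2)) (Var v))) (Num 1))))"

definition Token_rank :: "nat \<Rightarrow> nexp" where
  "Token_rank i = Sum 5 (Var i) (Cond (Eq_n (State (Var 5)) (Num 1)) (Num 1) (Num 0))"

text \<open>The case distinction of \<open>gadget\<close>, with variables 1 and 2 for the class and
  index of the tail and 3 and 4 for those of the head. A clause start is recognised by the automaton
  state one symbol earlier.\<close>

definition Gadget_adj :: nexp where
  "Gadget_adj = By_class 1
     (By_class 3 (Not_n (Eq_n (Var 2) (Var 4))) (Num 1) (Var 2)
        (Or_n (Le_n (Num 2) (Var 2))
        (Or_n (And_n (Eq_n (Var 2) (Num 0)) (Le_n (State (Sub (Var 4) (Num 1))) (Num 1)))
              (And_n (Eq_n (Var 2) (Num 1)) (Eq_n (Cell (Var 4)) (Num 1))))))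
     (By_class 3 (Le_n (Num 2) (Var 4)) (Num 0) (Eq_n (Var 2) (Var 4)) (Is_literal 4 False 2))
     (By_class 3 (Not_n (Eq_n (Var 4) (Num 1))) (Num 0) (Num 0) (Is_literal 4 True 2))
     (By_class 3 (Or_n (Var 4) (Eq_n (Cell (Var 2)) (Num 1))) (Num 0) (Num 0)
        (And_n (Eq_n (Cell (Var 2)) (Num 2)) (Eq_n (Token_rank 4) (Add (Token_rank 2) (Num 1)))))"

definition Gadget_word :: "nat \<Rightarrow> wexp" where
  "Gadget_word k = Cat (For_vertices k 1 2 (Bit (Num 1))) (Cat (Bit (Num 0))
     (For_vertices k 1 2 (For_vertices k 3 4 (Bit Gadget_adj))))"

lemma concat_map_if: "concat (map (\<lambda>i. if P i then f i else []) is) = concat (map f (filter P is))"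
  by (induction "is") auto

lemma filter_less_upt: "k \<le> m \<Longrightarrow> filter (\<lambda>i. i < k) [0..<m] = [0..<k]"
proof -
  assume "k \<le> m"
  then have "[0..<m] = [0..<k] @ [k..<m]" by (metis le0 le_Suc_ex upt_add_eq_append)
  then show ?thesis by simp
qed

context cnf_word
begin

lemma holds_Is_literal:
  assumes "t < length ts" "\<rho> i = token_pos n ts t" "i \<noteq> 5" "v \<noteq> 5"
  shows "holds x \<rho> (Is_literal i b v) \<longleftrightarrow> ts ! t = Some (\<rho> v, b)"
  using cell_literal[OF assms(1), of b "\<rho> v"] assms(2-4)
  unfolding Is_literal_def holds_simps holds_All_n by (simp add: algebra_simps)

lemma nval_Token_rank:
  assumes "t < length ts" "\<rho> i = token_pos n ts t"
  shows "nval x \<rho> (Token_rank i) = t"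
proof -
  have "nval x \<rho> (Token_rank i) = (\<Sum>j<token_pos n ts t. if automaton parse 0 x j = 1 then 1 else 0)"
    unfolding Token_rank_def nval.simps holds_simps nval_State assms(2) fun_upd_same ..
  then show ?thesis using token_rank[OF assms(1)] by simp
qed

lemma holds_Gadget_adj:
  assumes u: "u \<in> set (gadget_vertices k n ts)" and w: "w \<in> set (gadget_vertices k n ts)"
    and \<rho>: "\<rho> 1 = vclass u" "\<rho> 2 = vindex n ts u" "\<rho> 3 = vclass w" "\<rho> 4 = vindex n ts w"
  shows "holds x \<rho> Gadget_adj \<longleftrightarrow> gadget ts u w"
proof (cases u)
  case a: (Special i)
  show ?thesis
  proof (cases w)
    case b: (Tok t)
    then have t: "t < length ts" using w by (auto simp: set_gadget_vertices)
    show ?thesis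
      unfolding Gadget_adj_def using a b \<rho> clause_start_iff[OF t] cell_token_start[OF t]
      by (cases "ts ! t") (simp_all del: neq0_conv)
  qed (use a \<rho> in \<open>simp_all add: Gadget_adj_def del: neq0_conv\<close>)
next
  case a: (Pos v)
  show ?thesis
  proof (cases w)
    case b: (Tok t)
    then have t: "t < length ts" using w by (auto simp: set_gadget_vertices)
    show ?thesis
      unfolding Gadget_adj_def using a b \<rho> holds_Is_literal[OF t, of \<rho> 4 2 False]
      by (simp del: neq0_conv)
  qed (use a \<rho> in \<open>simp_all add: Gadget_adj_def del: neq0_conv\<close>)
next
  case a: (Neg v)
  show ?thesis
  proof (cases w)
    case b: (Tok t)
    then have t: "t < length ts" using w by (auto simp: set_gadget_vertices)
    show ?thesis
      unfolding Gadget_adj_def using a b \<rho> holds_Is_literal[OF t, of \<rho> 4 2 True]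
      by (simp del: neq0_conv)
  qed (use a \<rho> in \<open>simp_all add: Gadget_adj_def del: neq0_conv\<close>)
next
  case a: (Tok s)
  then have s: "s < length ts" using u by (auto simp: set_gadget_vertices)
  show ?thesis
  proof (cases w)
    case b: (Tok t)
    then have t: "t < length ts" using w by (auto simp: set_gadget_vertices)
    show ?thesis
      unfolding Gadget_adj_def
      using a b \<rho> cell_token_start[OF s] nval_Token_rank[OF s, of \<rho> 2] nval_Token_rank[OF t, of \<rho> 4]
      by (simp del: neq0_conv)
  qed (use a \<rho> cell_token_start[OF s] in \<open>cases "ts ! s"; simp add: Gadget_adj_def del: neq0_conv\<close>)+
qed

lemma wval_For_vertices:
  assumes "\<rho> 0 = length x" "c \<noteq> 0" "i \<noteq> 0" "c \<noteq> i"
  shows "wval x \<rho> (For_vertices k c i a) =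
    concat (map (\<lambda>u. wval x (\<rho>(c := vclass u, i := vindex n ts u)) a) (gadget_vertices k n ts))"
proof -
  define f where "f = (\<lambda>q j. wval x (\<rho>(c := q, i := j)) a)"
  let ?B = "[0..<k + length x]"
  have hdr: "filter (\<lambda>j. j < length x \<and> automaton parse 0 x (Suc j) = 0) ?B = [0..<n]"
  proof -
    have "filter (\<lambda>j. j < length x \<and> automaton parse 0 x (Suc j) = 0) ?B = filter (\<lambda>j. j < n) ?B"
      using header_iff length_x by (intro filter_cong refl) (auto simp del: automaton.simps)
    then show ?thesis using length_x by (simp add: filter_less_upt)
  qed
  have val: "holds x (\<rho>(c := q, i := j)) (Is_vertex k c i) \<longleftrightarrow>
      (if q = 0 then j < k else if q = 1 \<or> q = 2 then j < length x \<and> automaton parse 0 x (Suc j) = 0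
       else j < length x \<and> automaton parse 0 x j = 1)" for q j
    using assms by (simp add: Is_vertex_def Let_def not_le del: neq0_conv automaton.simps)
  have "wval x \<rho> (For_vertices k c i a) = concat (map (\<lambda>q. concat (map (f q)
      (filter (\<lambda>j. holds x (\<rho>(c := q, i := j)) (Is_vertex k c i)) ?B))) [0..<4])"
    unfolding For_vertices_def wval.simps using assms by (simp add: concat_map_if f_def del: neq0_conv)
  also have "[0..<4] = [0, 1, 2, 3::nat]" by (simp add: upt_rec)
  finally have "wval x \<rho> (For_vertices k c i a) =
      concat (map (f 0) [0..<k]) @ concat (map (f 1) [0..<n]) @ concat (map (f 2) [0..<n]) @
      concat (map (f 3) (map (token_pos n ts) [0..<length ts]))"
    unfolding val by (simp add: filter_less_upt hdr filter_tokens[of k, simplified] del: automaton.simps map_map)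
  then show ?thesis
    by (simp add: gadget_vertices_def f_def comp_def)
qed

lemma wval_Gadget_word:
  assumes "\<rho> 0 = length x"
  shows "wval x \<rho> (Gadget_word k) = encode_digraph (list_digraph (gadget_vertices k n ts) (gadget ts))"
proof -
  let ?vs = "gadget_vertices k n ts"
  have "wval x \<rho> (For_vertices k 1 2 (Bit (Num 1))) = replicate (length ?vs) True"
    using assms by (simp add: wval_For_vertices concat_map_singleton map_replicate_const)
  moreover have "wval x \<rho> (For_vertices k 1 2 (For_vertices k 3 4 (Bit Gadget_adj))) =
      concat (map (\<lambda>u. map (gadget ts u) ?vs) ?vs)"
  proof -
    have inner: "wval x (\<rho>(1 := vclass u, 2 := vindex n ts u)) (For_vertices k 3 4 (Bit Gadget_adj)) =
        map (gadget ts u) ?vs" if u: "u \<in> set ?vs" for u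
    proof -
      have "wval x (\<rho>(1 := vclass u, 2 := vindex n ts u)) (For_vertices k 3 4 (Bit Gadget_adj)) =
          concat (map (\<lambda>w. wval x (\<rho>(1 := vclass u, 2 := vindex n ts u, 3 := vclass w, 4 := vindex n ts w))
            (Bit Gadget_adj)) ?vs)"
        using assms by (intro wval_For_vertices) auto
      also have "\<dots> = concat (map (\<lambda>w. [gadget ts u w]) ?vs)"
        using u by (intro arg_cong[of _ _ concat] map_cong refl) (simp add: holds_Gadget_adj del: neq0_conv)
      finally show ?thesis by (simp add: concat_map_singleton)
    qed
    have "wval x \<rho> (For_vertices k 1 2 (For_vertices k 3 4 (Bit Gadget_adj))) =
        concat (map (\<lambda>u. wval x (\<rho>(1 := vclass u, 2 := vindex n ts u)) (For_vertices k 3 4 (Bit Gadget_adj))) ?vs)"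
      using assms by (intro wval_For_vertices) auto
    also have "\<dots> = concat (map (\<lambda>u. map (gadget ts u) ?vs) ?vs)"
      by (intro arg_cong[of _ _ concat] map_cong refl inner)
    finally show ?thesis .
  qed
  ultimately show ?thesis by (simp add: Gadget_word_def encode_list_digraph)
qed

end

theorem gadget_computable:
  "\<exists>M b G. computes_within M b G \<and> (\<forall>\<phi>. G (encode_cnf \<phi>) = encode_digraph (gadget_digraph k \<phi>))"
proof -
  define G where "G x = wval x ((\<lambda>_. 0)(0 := length x)) (Gadget_word k)" for x
  obtain M b where "computes_within M b G"
    using wexp_computable[of "Gadget_word k"] unfolding G_def by blast
  moreover have "G (encode_cnf \<phi>) = encode_digraph (gadget_digraph k \<phi>)" for \<phi>
  proof -
    obtain n cs where \<phi>: "\<phi> = (n, cs)" by (cases \<phi>)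
    interpret cnf_word n "tokens cs" "encode_cnf \<phi>"
      by unfold_locales (simp only: \<phi> encode_cnf_tokens)
    show ?thesis
      unfolding G_def gadget_digraph_def \<phi> fst_conv snd_conv
      by (rule wval_Gadget_word[unfolded \<phi>]) simp
  qed
  ultimately show ?thesis by blast
qed

subsection \<open>Tableaux of computations\<close>

text \<open>
  The facts recorded at time \<open>t\<close>: the state, the head position and the cells of each tape, the
  symbol under each head, and the transition applied. Position \<open>p\<close> stands for cell
  \<open>p - T - 1\<close>, and kinds without a position use position 0.
\<close>

datatype kind =
    KState nat
  | KHead nat
  | KCell nat nat
  | KRead nat nat
  | KStep nat "nat list"

text \<open>Halting states stutter, in agreement with \<open>tm_step\<close>, so a tableau can
  always run up to time \<open>T\<close>.\<close>

definition next_of :: "tm \<Rightarrow> nat \<Rightarrow> nat list \<Rightarrow> nat \<times> (nat \<times> move) list" where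
  "next_of M q rs = (if q \<in> {tm_accept M, tm_reject M} then (q, map stay rs) else tm_delta M q rs)"

lemma tm_step_next_of:
  "tm_step M c = (fst (next_of M (fst c) (map read_tape (snd c))),
     map2 act_tape (snd (next_of M (fst c) (map read_tape (snd c)))) (snd c))"
proof (cases "halted M c")
  case True
  then show ?thesis
    using map2_act_stay[of "snd c"] unfolding tm_step_def next_of_def halted_def by simp
next
  case False
  then show ?thesis
    unfolding tm_step_def next_of_def halted_def by (simp add: case_prod_beta)
qed

lemma wf_next_of:
  assumes "wf_tm M" "q < tm_states M" "length rs = tm_tapes M" "set rs \<subseteq> {..<tm_symbols M}"
  shows "fst (next_of M q rs) < tm_states M" "length (snd (next_of M q rs)) = tm_tapes M"
    "fst ` set (snd (next_of M q rs)) \<subseteq> {..<tm_symbols M}"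
proof -
  obtain q' as where d: "tm_delta M q rs = (q', as)" by fastforce
  show "fst (next_of M q rs) < tm_states M" "length (snd (next_of M q rs)) = tm_tapes M"
    "fst ` set (snd (next_of M q rs)) \<subseteq> {..<tm_symbols M}"
    using wf_delta[OF assms d] d assms(2-4) by (auto simp: next_of_def)
qed

text \<open>Offsets are raised by one: the head at position \<open>p + 1\<close> moves to
  \<open>p + shift d\<close>, which avoids subtraction on the naturals.\<close>

fun shift :: "move \<Rightarrow> nat" where
  "shift Left = 0"
| "shift Stay = 1"
| "shift Right = 2"

lemma shift_offset: "int (shift d) = move_offset d + 1"
  by (cases d) auto

text \<open>The window has \<open>2 * T + 1\<close> cells, all that \<open>T\<close> steps can reach
  from the starting cell. In the zone of the certificate a blank must be followed by blanks, so that
  the guess can be read as a word of length at most \<open>Y\<close>.\<close>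

definition tableau_init :: "tm \<Rightarrow> bool list \<Rightarrow> nat \<Rightarrow> nat \<Rightarrow> (kind \<Rightarrow> nat \<Rightarrow> nat \<Rightarrow> bool) \<Rightarrow> bool" where
  "tableau_init M x Y T \<Phi> \<longleftrightarrow>
     \<Phi> (KState (tm_start M)) 0 0 \<and>
     (\<forall>j<tm_tapes M. \<Phi> (KHead j) 0 (T + 1)) \<and>
     (\<forall>j<tm_tapes M. j \<noteq> 0 \<longrightarrow> (\<forall>p<2 * T + 1. \<Phi> (KCell j 0) 0 (p + 1))) \<and>
     (\<forall>p<2 * T + 1.
        (p < T \<longrightarrow> \<Phi> (KCell 0 0) 0 (p + 1)) \<and>
        (T \<le> p \<and> p < T + length x \<and> word_cells x (int (p - T)) = 1 \<longrightarrow> \<Phi> (KCell 0 1) 0 (p + 1)) \<and>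
        (T \<le> p \<and> p < T + length x \<and> word_cells x (int (p - T)) = 2 \<longrightarrow> \<Phi> (KCell 0 2) 0 (p + 1)) \<and>
        (p = T + length x \<longrightarrow> \<Phi> (KCell 0 3) 0 (p + 1)) \<and>
        (T + length x < p \<and> p \<le> T + length x + Y \<longrightarrow>
          \<Phi> (KCell 0 0) 0 (p + 1) \<or> \<Phi> (KCell 0 1) 0 (p + 1) \<or> \<Phi> (KCell 0 2) 0 (p + 1)) \<and>
        (T + length x < p \<and> p < T + length x + Y \<longrightarrow>
          \<Phi> (KCell 0 0) 0 (p + 1) \<longrightarrow> \<Phi> (KCell 0 0) 0 (p + 2)) \<and>
        (T + length x + Y < p \<longrightarrow> \<Phi> (KCell 0 0) 0 (p + 1)))"

text \<open>\<open>KRead\<close> forgets the head position, so a transition need not range over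
  combinations of the positions of all heads; \<open>KStep\<close> then lets every tape be updated
  by clauses of its own.\<close>

definition tableau_step :: "tm \<Rightarrow> nat \<Rightarrow> (kind \<Rightarrow> nat \<Rightarrow> nat \<Rightarrow> bool) \<Rightarrow> nat \<Rightarrow> bool" where
  "tableau_step M T \<Phi> t \<longleftrightarrow>
     (\<forall>j<tm_tapes M. \<forall>a<tm_symbols M. \<forall>p<2 * T + 1.
        \<Phi> (KHead j) t (p + 1) \<and> \<Phi> (KCell j a) t (p + 1) \<longrightarrow> \<Phi> (KRead j a) t 0) \<and>
     (\<forall>q<tm_states M. \<forall>rs\<in>set (List.n_lists (tm_tapes M) [0..<tm_symbols M]).
        (\<Phi> (KState q) t 0 \<and> (\<forall>j<tm_tapes M. \<Phi> (KRead j (rs ! j)) t 0) \<longrightarrow> \<Phi> (KStep q rs) t 0) \<and>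
        (\<Phi> (KStep q rs) t 0 \<longrightarrow> \<Phi> (KState (fst (next_of M q rs))) (t + 1) 0) \<and>
        (\<forall>j<tm_tapes M. \<forall>p<2 * T + 1.
           (\<Phi> (KStep q rs) t 0 \<and> \<Phi> (KHead j) t (p + 1) \<longrightarrow>
              \<Phi> (KHead j) (t + 1) (p + shift (snd (snd (next_of M q rs) ! j)))) \<and>
           (\<Phi> (KStep q rs) t 0 \<and> \<Phi> (KHead j) t (p + 1) \<longrightarrow>
              \<Phi> (KCell j (fst (snd (next_of M q rs) ! j))) (t + 1) (p + 1)))) \<and>
     (\<forall>j<tm_tapes M. \<forall>a<tm_symbols M. \<forall>p<2 * T + 1. \<forall>p'<2 * T + 1. p \<noteq> p' \<longrightarrow>
        \<Phi> (KCell j a) t (p + 1) \<and> \<Phi> (KHead j) t (p' + 1) \<longrightarrow> \<Phi> (KCell j a) (t + 1) (p + 1))"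

text \<open>Acceptance is expressed by excluding the other states. A run that ends elsewhere forces
  the excluded fact, whatever spurious facts hold in addition.\<close>

definition tableau_final :: "tm \<Rightarrow> nat \<Rightarrow> (kind \<Rightarrow> nat \<Rightarrow> nat \<Rightarrow> bool) \<Rightarrow> bool" where
  "tableau_final M T \<Phi> \<longleftrightarrow> (\<forall>q<tm_states M. q \<noteq> tm_accept M \<longrightarrow> \<not> \<Phi> (KState q) T 0)"

definition tableau :: "tm \<Rightarrow> bool list \<Rightarrow> nat \<Rightarrow> nat \<Rightarrow> (kind \<Rightarrow> nat \<Rightarrow> nat \<Rightarrow> bool) \<Rightarrow> bool" where
  "tableau M x Y T \<Phi> \<longleftrightarrow> tableau_init M x Y T \<Phi> \<and> (\<forall>t<T. tableau_step M T \<Phi> t) \<and> tableau_final M T \<Phi>"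

lemma pair_word_nth:
  "fst (word_tape (pair_word x y)) i =
     (if i < int (length x) then word_cells x i
      else if i = int (length x) then 3 else word_cells y (i - int (length x) - 1))"
proof -
  have "nat (i - int (length x) - 1) = nat i - length x - 1" if "i > int (length x)" using that by simp
  then show ?thesis
    by (auto simp: word_tape_def word_cells_def pair_word_def nth_append nth_Cons'
        not_less nat_less_iff nat_le_iff)
qed

lemma set_pair_word: "wf_tm M \<Longrightarrow> set (pair_word x y) \<subseteq> {..<tm_symbols M}"
  using set_bits[of x] set_bits[of y] by (auto simp: pair_word_def wf_tm_def)

subsection \<open>Accepting computations yield tableaux\<close>

definition run_facts :: "tm \<Rightarrow> nat list \<Rightarrow> nat \<Rightarrow> kind \<Rightarrow> nat \<Rightarrow> nat \<Rightarrow> bool" where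
  "run_facts M w T \<kappa> t p = (let c = tm_run M w t in case \<kappa> of
     KState q \<Rightarrow> fst c = q
   | KHead j \<Rightarrow> int p = snd (snd c ! j) + int T + 1
   | KCell j a \<Rightarrow> fst (snd c ! j) (int p - int T - 1) = a
   | KRead j a \<Rightarrow> read_tape (snd c ! j) = a
   | KStep q rs \<Rightarrow> fst c = q \<and> map read_tape (snd c) = rs)"

lemma tableau_step_run_facts:
  assumes M: "wf_tm M" and w: "set w \<subseteq> {..<tm_symbols M}"
  shows "tableau_step M T (run_facts M w T) t"
proof -
  define c where "c = tm_run M w t"
  have wf: "wf_config M c" unfolding c_def using wf_config_run[OF M w] .
  then have len: "length (snd c) = tm_tapes M" and q: "fst c < tm_states M" by (auto simp: wf_config_def)
  define rs where "rs = map read_tape (snd c)"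
  define as where "as = snd (next_of M (fst c) rs)"
  have rs: "length rs = tm_tapes M" "set rs \<subseteq> {..<tm_symbols M}"
    using len wf_config_read[OF wf] by (auto simp: rs_def)
  have las: "length as = tm_tapes M" using wf_next_of(2)[OF M q rs] by (simp add: as_def)
  have c': "tm_run M w (Suc t) = (fst (next_of M (fst c) rs), map2 act_tape as (snd c))"
    unfolding tm_run_Suc c_def[symmetric] tm_step_next_of rs_def[symmetric] as_def ..
  have tape: "snd (tm_run M w (Suc t)) ! j = ((fst (snd c ! j))(snd (snd c ! j) := fst (as ! j)),
      snd (snd c ! j) + move_offset (snd (as ! j)))" if "j < tm_tapes M" for j
    unfolding c' using that len las by (cases "as ! j"; cases "snd c ! j") simp
  have rd: "read_tape (snd c ! j) = fst (snd c ! j) (snd (snd c ! j))" for j by (rule read_tape_eq)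
  have KS: "run_facts M w T (KStep q rs') t p \<longleftrightarrow> q = fst c \<and> rs' = rs" for q rs' p
    by (auto simp: run_facts_def c_def[symmetric] rs_def)
  show ?thesis
    unfolding tableau_step_def
  proof (intro conjI allI impI ballI)
    fix j a p assume "run_facts M w T (KHead j) t (p + 1) \<and> run_facts M w T (KCell j a) t (p + 1)"
    then show "run_facts M w T (KRead j a) t 0"
      by (auto simp: run_facts_def c_def[symmetric] rd)
  next
    fix q rs' assume "rs' \<in> set (List.n_lists (tm_tapes M) [0..<tm_symbols M])"
      and a: "run_facts M w T (KState q) t 0 \<and> (\<forall>j<tm_tapes M. run_facts M w T (KRead j (rs' ! j)) t 0)"
    then have "length rs' = tm_tapes M" by (simp add: set_n_lists)
    then have "rs' = rs"
      using a len by (intro nth_equalityI) (auto simp: run_facts_def c_def[symmetric] rs_def)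
    then show "run_facts M w T (KStep q rs') t 0"
      using a by (simp add: KS) (simp add: run_facts_def c_def[symmetric])
  next
    fix q rs' assume "run_facts M w T (KStep q rs') t 0"
    then show "run_facts M w T (KState (fst (next_of M q rs'))) (t + 1) 0"
      by (simp add: KS) (simp add: run_facts_def c')
  next
    fix q rs' j p assume j: "j < tm_tapes M"
      and a: "run_facts M w T (KStep q rs') t 0 \<and> run_facts M w T (KHead j) t (p + 1)"
    then have e: "q = fst c" "rs' = rs" by (auto simp: KS)
    have h: "int (p + 1) = snd (snd c ! j) + int T + 1"
      using a by (simp add: run_facts_def c_def[symmetric])
    show "run_facts M w T (KHead j) (t + 1) (p + shift (snd (snd (next_of M q rs') ! j)))"
      unfolding e as_def[symmetric] using h tape[OF j]
      by (simp add: run_facts_def shift_offset)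
    show "run_facts M w T (KCell j (fst (snd (next_of M q rs') ! j))) (t + 1) (p + 1)"
      unfolding e as_def[symmetric] using h tape[OF j]
      by (simp add: run_facts_def)
  next
    fix j a p p' assume j: "j < tm_tapes M" and pp: "p \<noteq> p'"
      and a: "run_facts M w T (KCell j a) t (p + 1) \<and> run_facts M w T (KHead j) t (p' + 1)"
    have h: "int (p' + 1) = snd (snd c ! j) + int T + 1" "fst (snd c ! j) (int (p + 1) - int T - 1) = a"
      using a by (auto simp: run_facts_def c_def[symmetric])
    then show "run_facts M w T (KCell j a) (t + 1) (p + 1)"
      using tape[OF j] pp by (auto simp: run_facts_def)
  qed
qed

lemma tableau_run_facts:
  assumes M: "wf_tm M" and y: "length y \<le> Y"
    and acc: "fst (tm_run M (pair_word x y) T) = tm_accept M"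
  shows "tableau M x Y T (run_facts M (pair_word x y) T)"
proof -
  let ?w = "pair_word x y"
  have one: "1 \<le> tm_tapes M" using M by (simp add: wf_tm_def)
  have tape0: "snd (tm_init M ?w) ! 0 = word_tape ?w" by (simp add: tm_init_def)
  have tapej: "snd (tm_init M ?w) ! j = word_tape []" if "j < tm_tapes M" "j \<noteq> 0" for j
    using that by (cases j) (auto simp: tm_init_def)
  have head: "snd (word_tape v) = 0" for v by (simp add: word_tape_def)
  have cell0: "run_facts M ?w T (KCell 0 a) 0 (p + 1) \<longleftrightarrow>
      fst (word_tape ?w) (int p - int T) = a" for a p
    by (simp add: run_facts_def tape0)
  have cell0': "run_facts M ?w T (KCell 0 a) 0 (Suc p) \<longleftrightarrow> fst (word_tape ?w) (int p - int T) = a" for a p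
    using cell0[of a p] by simp
  have "tableau_init M x Y T (run_facts M ?w T)"
    unfolding tableau_init_def
  proof (intro conjI allI impI)
    show "run_facts M ?w T (KState (tm_start M)) 0 0" by (simp add: run_facts_def tm_init_def)
  next
    fix j assume "j < tm_tapes M"
    then show "run_facts M ?w T (KHead j) 0 (T + 1)"
      by (cases "j = 0") (auto simp: run_facts_def tape0 tapej head)
  next
    fix j p assume "j < tm_tapes M" "j \<noteq> 0"
    then show "run_facts M ?w T (KCell j 0) 0 (p + 1)"
      by (simp add: run_facts_def tapej) (simp add: word_tape_def)
  next
    fix p assume p: "T + length x < p \<and> p < T + length x + Y"
      "run_facts M ?w T (KCell 0 0) 0 (p + 1)"
    have "run_facts M ?w T (KCell 0 0) 0 (p + 1 + 1)"
      using p unfolding cell0 pair_word_nth by (auto simp: word_cells_eq_0_iff split: if_splits)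
    then show "run_facts M ?w T (KCell 0 0) 0 (p + 2)" by simp
  next
    fix p assume "T + length x < p \<and> p \<le> T + length x + Y"
    then show "run_facts M ?w T (KCell 0 0) 0 (p + 1) \<or> run_facts M ?w T (KCell 0 1) 0 (p + 1) \<or>
        run_facts M ?w T (KCell 0 2) 0 (p + 1)"
      unfolding cell0 pair_word_nth
      using word_cells_le[of y "int p - int T - int (length x) - 1"] by auto
  next
    fix p assume "T + length x + Y < p"
    then show "run_facts M ?w T (KCell 0 0) 0 (p + 1)"
      unfolding cell0 pair_word_nth using y by (auto simp: word_cells_eq_0_iff)
  qed (auto simp: cell0' pair_word_nth word_cells_eq_0_iff of_nat_diff)
  moreover have "tableau_final M T (run_facts M ?w T)"
    using acc by (auto simp: tableau_final_def run_facts_def)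
  ultimately show ?thesis
    unfolding tableau_def using tableau_step_run_facts[OF M set_pair_word[OF M]] by blast
qed

subsection \<open>Tableaux yield accepting computations\<close>

text \<open>The facts may allow several symbols in a guessed cell; it suffices to extract one word
  all of whose cells are among those allowed.\<close>

lemma tableau_guess:
  assumes init: "tableau_init M x Y T \<Phi>" and T: "length x + Y \<le> T"
  shows "\<exists>y. length y \<le> Y \<and>
    (\<forall>p<2 * T + 1. \<Phi> (KCell 0 (fst (word_tape (pair_word x y)) (int p - int T))) 0 (p + 1))"
proof -
  let ?n = "length x"
  let ?C = "\<lambda>a i. \<Phi> (KCell 0 a) 0 (T + ?n + 1 + i + 1)"
  have cl: "(p < T \<longrightarrow> \<Phi> (KCell 0 0) 0 (p + 1)) \<and>
        (T \<le> p \<and> p < T + ?n \<and> word_cells x (int (p - T)) = 1 \<longrightarrow> \<Phi> (KCell 0 1) 0 (p + 1)) \<and>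
        (T \<le> p \<and> p < T + ?n \<and> word_cells x (int (p - T)) = 2 \<longrightarrow> \<Phi> (KCell 0 2) 0 (p + 1)) \<and>
        (p = T + ?n \<longrightarrow> \<Phi> (KCell 0 3) 0 (p + 1)) \<and>
        (T + ?n < p \<and> p \<le> T + ?n + Y \<longrightarrow>
          \<Phi> (KCell 0 0) 0 (p + 1) \<or> \<Phi> (KCell 0 1) 0 (p + 1) \<or> \<Phi> (KCell 0 2) 0 (p + 1)) \<and>
        (T + ?n < p \<and> p < T + ?n + Y \<longrightarrow>
          \<Phi> (KCell 0 0) 0 (p + 1) \<longrightarrow> \<Phi> (KCell 0 0) 0 (p + 2)) \<and>
        (T + ?n + Y < p \<longrightarrow> \<Phi> (KCell 0 0) 0 (p + 1))" if "p < 2 * T + 1" for p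
    by (rule init[unfolded tableau_init_def, THEN conjunct2, THEN conjunct2, THEN conjunct2,
        THEN spec, THEN mp, OF that])
  \<comment> \<open>The certificate ends at the first guessed cell that admits no bit; that cell
    must be blank, and the blanks propagate to the end of the zone.\<close>
  define m where "m = (LEAST i. i = Y \<or> \<not> (?C 1 i \<or> ?C 2 i))"
  have m: "m = Y \<or> \<not> (?C 1 m \<or> ?C 2 m)"
    unfolding m_def by (rule LeastI[of _ Y]) simp
  have mY: "m \<le> Y" unfolding m_def by (rule Least_le) simp
  have below: "?C 1 i \<or> ?C 2 i" if "i < m" for i
    using not_less_Least[OF that[unfolded m_def]] by blast
  have above: "?C 0 i" if "m \<le> i" "i < Y" for i
    using that
  proof (induction i rule: dec_induct)
    case base
    then show ?case using cl[of "T + ?n + 1 + m"] m T by auto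
  next
    case (step i)
    then have "?C 0 i" by simp
    then show ?case using cl[of "T + ?n + 1 + i"] step T by (simp add: numeral_2_eq_2)
  qed
  \<comment> \<open>A cell that admits both bits is read as \<open>True\<close>.\<close>
  define y where "y = map (\<lambda>i. ?C 2 i) [0..<m]"
  have len: "length y = m" by (simp add: y_def)
  have "\<Phi> (KCell 0 (fst (word_tape (pair_word x y)) (int p - int T))) 0 (p + 1)" if p: "p < 2 * T + 1" for p
  proof -
    consider "p < T" | "T \<le> p" "p < T + ?n" | "p = T + ?n" | "T + ?n < p" "p \<le> T + ?n + Y"
      | "T + ?n + Y < p" by linarith
    then show ?thesis
    proof cases
      case 1
      then have "word_cells x (int p - int T) = 0" by (simp add: word_cells_eq_0_iff)
      then show ?thesis using cl[OF p] 1 by (simp add: pair_word_nth)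
    next
      case 2
      have e: "int (p - T) = int p - int T" using 2 by simp
      have "word_cells x (int p - int T) \<noteq> 0" using 2 by (simp add: word_cells_eq_0_iff)
      then have "word_cells x (int p - int T) = 1 \<or> word_cells x (int p - int T) = 2"
        using word_cells_le[of x "int p - int T"] by linarith
      then show ?thesis using cl[OF p] 2 unfolding pair_word_nth e by auto
    next
      case 3
      then show ?thesis using cl[OF p] by (simp add: pair_word_nth)
    next
      case 4
      define i where "i = p - (T + ?n + 1)"
      have pi: "p = T + ?n + 1 + i" "i < Y" using 4 by (auto simp: i_def)
      have w: "fst (word_tape (pair_word x y)) (int p - int T) = word_cells y (int i)"
        unfolding pair_word_nth pi by (simp add: algebra_simps)
      show ?thesis
      proof (cases "i < m")
        case True
        then have "word_cells y (int i) = (if ?C 2 i then 2 else 1)"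
          using word_cells_nth[of i y] len by (simp add: y_def)
        then show ?thesis unfolding w using below[OF True] unfolding pi by auto
      next
        case False
        then have "word_cells y (int i) = 0" by (simp add: word_cells_eq_0_iff len)
        then show ?thesis unfolding w using above[of i] False pi by simp
      qed
    next
      case 5
      then have "word_cells y (int p - int T - int ?n - 1) = 0"
        using mY by (simp add: word_cells_eq_0_iff len)
      then show ?thesis using cl[OF p] 5 by (simp add: pair_word_nth)
    qed
  qed
  then show ?thesis using len mY by blast
qed

text \<open>By induction on time all true facts of the run on the extracted certificate hold in
  \<open>\<Phi>\<close>; facts beyond these are harmless because only the state at time
  \<open>T\<close> is restricted.\<close>

lemma tableau_sound:
  assumes M: "wf_tm M" and tab: "tableau M x Y T \<Phi>" and T: "length x + Y \<le> T"
  shows "\<exists>y. length y \<le> Y \<and> fst (tm_run M (pair_word x y) T) = tm_accept M"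
proof -
  have init: "tableau_init M x Y T \<Phi>" and step: "\<And>t. t < T \<Longrightarrow> tableau_step M T \<Phi> t"
    and final: "tableau_final M T \<Phi>" using tab by (auto simp: tableau_def)
  obtain y where y: "length y \<le> Y"
    and cells: "\<And>p. p < 2 * T + 1 \<Longrightarrow> \<Phi> (KCell 0 (fst (word_tape (pair_word x y)) (int p - int T))) 0 (p + 1)"
    using tableau_guess[OF init T] by blast
  let ?w = "pair_word x y"
  note wfr = wf_config_run[OF M set_pair_word[OF M], of x y]
  \<comment> \<open>The bound on the head position keeps every cell that is read or written inside
    the window.\<close>
  have inv: "\<Phi> (KState (fst (tm_run M ?w t))) t 0 \<and>
      (\<forall>j<tm_tapes M. \<bar>snd (snd (tm_run M ?w t) ! j)\<bar> \<le> int t \<and>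
         \<Phi> (KHead j) t (nat (snd (snd (tm_run M ?w t) ! j) + int T + 1)) \<and>
         (\<forall>p<2 * T + 1. \<Phi> (KCell j (fst (snd (tm_run M ?w t) ! j) (int p - int T))) t (p + 1)))"
    if "t \<le> T" for t
    using that
  proof (induction t)
    case 0
    have tape0: "snd (tm_init M ?w) ! 0 = word_tape ?w" by (simp add: tm_init_def)
    have tapej: "snd (tm_init M ?w) ! j = word_tape []" if "j < tm_tapes M" "j \<noteq> 0" for j
      using that by (cases j) (auto simp: tm_init_def)
    have head: "snd (snd (tm_init M ?w) ! j) = 0" if "j < tm_tapes M" for j
      using that tape0 tapej[of j] by (cases "j = 0") (auto simp: word_tape_def)
    have cellj: "fst (snd (tm_init M ?w) ! j) i = 0" if "j < tm_tapes M" "j \<noteq> 0" for j i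
      using tapej[OF that] by (simp add: word_tape_def)
    have nat: "nat (0 + int T + 1) = T + 1" by simp
    have "\<Phi> (KCell j (fst (snd (tm_init M ?w) ! j) (int p - int T))) 0 (p + 1)"
      if "j < tm_tapes M" "p < 2 * T + 1" for j p
    proof (cases "j = 0")
      case True
      then show ?thesis using cells[OF that(2)] tape0 by simp
    next
      case False
      show ?thesis
        unfolding cellj[OF that(1) False]
        by (rule init[unfolded tableau_init_def, THEN conjunct2, THEN conjunct2, THEN conjunct1,
              THEN spec, THEN mp, OF that(1), THEN mp, OF False, THEN spec, THEN mp, OF that(2)])
    qed
    moreover have "\<Phi> (KState (fst (tm_init M ?w))) 0 0" "\<And>j. j < tm_tapes M \<Longrightarrow> \<Phi> (KHead j) 0 (T + 1)"
      using init by (auto simp: tableau_init_def tm_init_def)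
    ultimately show ?case using head nat by simp
  next
    case (Suc t)
    then have t: "t < T" by simp
    define c where "c = tm_run M ?w t"
    have IH: "\<Phi> (KState (fst c)) t 0"
      "\<And>j. j < tm_tapes M \<Longrightarrow> \<bar>snd (snd c ! j)\<bar> \<le> int t"
      "\<And>j. j < tm_tapes M \<Longrightarrow> \<Phi> (KHead j) t (nat (snd (snd c ! j) + int T + 1))"
      "\<And>j p. j < tm_tapes M \<Longrightarrow> p < 2 * T + 1 \<Longrightarrow> \<Phi> (KCell j (fst (snd c ! j) (int p - int T))) t (p + 1)"
      using Suc by (auto simp: c_def)
    have wf: "wf_config M c" unfolding c_def by (rule wfr)
    then have len: "length (snd c) = tm_tapes M" and q: "fst c < tm_states M"
      and sym: "\<And>j i. j < tm_tapes M \<Longrightarrow> fst (snd c ! j) i < tm_symbols M"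
      by (auto simp: wf_config_def)
    define rs where "rs = map read_tape (snd c)"
    define as where "as = snd (next_of M (fst c) rs)"
    have rs: "length rs = tm_tapes M" "set rs \<subseteq> {..<tm_symbols M}"
      using len wf_config_read[OF wf] by (auto simp: rs_def)
    have rsn: "rs \<in> set (List.n_lists (tm_tapes M) [0..<tm_symbols M])"
      using rs by (simp add: set_n_lists atLeast0LessThan)
    have las: "length as = tm_tapes M" using wf_next_of(2)[OF M q rs] by (simp add: as_def)
    have c': "tm_run M ?w (Suc t) = (fst (next_of M (fst c) rs), map2 act_tape as (snd c))"
      unfolding tm_run_Suc c_def[symmetric] tm_step_next_of rs_def[symmetric] as_def ..
    have tape: "snd (tm_run M ?w (Suc t)) ! j = ((fst (snd c ! j))(snd (snd c ! j) := fst (as ! j)),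
        snd (snd c ! j) + move_offset (snd (as ! j)))" if "j < tm_tapes M" for j
      unfolding c' using that len las by (cases "as ! j"; cases "snd c ! j") simp
    define h where "h j = nat (snd (snd c ! j) + int T)" for j
    have h: "int (h j) = snd (snd c ! j) + int T" "h j < 2 * T + 1" if "j < tm_tapes M" for j
      using IH(2)[OF that] t unfolding h_def by auto
    have hd: "\<Phi> (KHead j) t (h j + 1)" if "j < tm_tapes M" for j
    proof -
      have "nat (snd (snd c ! j) + int T + 1) = h j + 1" using h(1)[OF that] by simp
      then show ?thesis using IH(3)[OF that] by simp
    qed
    note S = step[OF t, unfolded tableau_step_def]
    note S1 = S[THEN conjunct1, THEN spec, THEN mp, THEN spec, THEN mp, THEN spec, THEN mp, THEN mp]
    note S2 = S[THEN conjunct2, THEN conjunct1, THEN spec, THEN mp, OF q, THEN bspec, OF rsn]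
    note S4 = S2[THEN conjunct2, THEN conjunct2, THEN spec, THEN mp, THEN spec, THEN mp]
    note S3 = S[THEN conjunct2, THEN conjunct2, THEN spec, THEN mp, THEN spec, THEN mp, THEN spec, THEN mp,
      THEN spec, THEN mp, THEN mp, THEN mp]
    have rd: "\<Phi> (KRead j (rs ! j)) t 0" if j: "j < tm_tapes M" for j
    proof -
      have r: "rs ! j = fst (snd c ! j) (int (h j) - int T)"
        using j len h(1)[OF j] by (simp add: rs_def read_tape_eq)
      have "\<Phi> (KCell j (rs ! j)) t (h j + 1)" unfolding r using IH(4)[OF j h(2)[OF j]] .
      moreover have "rs ! j < tm_symbols M" unfolding r by (rule sym[OF j])
      ultimately show ?thesis using S1[OF j _ h(2)[OF j]] hd[OF j] by simp
    qed
    have st: "\<Phi> (KStep (fst c) rs) t 0" using S2[THEN conjunct1] IH(1) rd by simp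
    have "\<Phi> (KState (fst (tm_run M ?w (Suc t)))) (Suc t) 0"
      using S2[THEN conjunct2, THEN conjunct1] st unfolding c' by simp
    moreover have "\<bar>snd (snd (tm_run M ?w (Suc t)) ! j)\<bar> \<le> int (Suc t) \<and>
         \<Phi> (KHead j) (Suc t) (nat (snd (snd (tm_run M ?w (Suc t)) ! j) + int T + 1)) \<and>
         (\<forall>p<2 * T + 1. \<Phi> (KCell j (fst (snd (tm_run M ?w (Suc t)) ! j) (int p - int T))) (Suc t) (p + 1))"
      if j: "j < tm_tapes M" for j
    proof (intro conjI allI impI)
      show "\<bar>snd (snd (tm_run M ?w (Suc t)) ! j)\<bar> \<le> int (Suc t)"
        unfolding tape[OF j] using IH(2)[OF j] by (cases "snd (as ! j)") auto
      have "\<Phi> (KHead j) (t + 1) (h j + shift (snd (as ! j)))"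
        using S4[OF j h(2)[OF j]] st hd[OF j] unfolding as_def by simp
      moreover have "nat (snd (snd (tm_run M ?w (Suc t)) ! j) + int T + 1) = h j + shift (snd (as ! j))"
        unfolding tape[OF j] using h(1)[OF j] shift_offset[of "snd (as ! j)"] by simp
      ultimately show "\<Phi> (KHead j) (Suc t) (nat (snd (snd (tm_run M ?w (Suc t)) ! j) + int T + 1))"
        by simp
      fix p assume p: "p < 2 * T + 1"
      show "\<Phi> (KCell j (fst (snd (tm_run M ?w (Suc t)) ! j) (int p - int T))) (Suc t) (p + 1)"
      proof (cases "p = h j")
        case True
        have "\<Phi> (KCell j (fst (as ! j))) (t + 1) (h j + 1)"
          using S4[OF j h(2)[OF j]] st hd[OF j] unfolding as_def by simp
        then show ?thesis unfolding tape[OF j] True using h(1)[OF j] by simp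
      next
        case False
        let ?a = "fst (snd c ! j) (int p - int T)"
        have "\<Phi> (KCell j ?a) (t + 1) (p + 1)"
          using S3[OF j sym[OF j] p h(2)[OF j] False] hd[OF j] IH(4)[OF j p] by simp
        moreover have "int p - int T \<noteq> snd (snd c ! j)" using False h(1)[OF j] by auto
        ultimately show ?thesis unfolding tape[OF j] by simp
      qed
    qed
    ultimately show ?case by blast
  qed
  have "fst (tm_run M ?w T) = tm_accept M"
  proof (rule ccontr)
    assume ne: "fst (tm_run M ?w T) \<noteq> tm_accept M"
    have "fst (tm_run M ?w T) < tm_states M" using wfr[of T] by (simp add: wf_config_def)
    then show False using final ne inv[of T] by (auto simp: tableau_final_def)
  qed
  then show ?thesis using y by blast
qed

subsection \<open>Writing the tableau as a formula\<close>

text \<open>One loop description yields both the clauses, for reasoning about truth, and the program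
  that writes their encoding.\<close>

datatype cexp =
    Clause "(nexp \<times> bool) list"
  | CNone
  | CCat cexp cexp
  | CIf nexp cexp
  | CFor nat nexp cexp

fun cval :: "bool list \<Rightarrow> (nat \<Rightarrow> nat) \<Rightarrow> cexp \<Rightarrow> literal list list" where
  "cval x \<rho> (Clause ls) = [map (\<lambda>(e, b). (nval x \<rho> e, b)) ls]"
| "cval x \<rho> CNone = []"
| "cval x \<rho> (CCat a b) = cval x \<rho> a @ cval x \<rho> b"
| "cval x \<rho> (CIf e a) = (if nval x \<rho> e \<noteq> 0 then cval x \<rho> a else [])"
| "cval x \<rho> (CFor i e a) = concat (map (\<lambda>k. cval x (\<rho>(i := k)) a) [0..<nval x \<rho> e])"

definition Ones :: "nexp \<Rightarrow> wexp" where
  "Ones e = For 9 e (Bit (Num 1))"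

lemma wval_Ones [simp]: "wval x \<rho> (Ones e) = replicate (nval x \<rho> e) True"
  by (simp add: Ones_def concat_map_singleton map_replicate_const)

fun literal_word :: "nexp \<times> bool \<Rightarrow> wexp" where
  "literal_word (e, b) =
     Cat (Bit (Num 1)) (Cat (Bit (Num (if b then 1 else 0))) (Cat (Ones e) (Bit (Num 0))))"

fun cword :: "cexp \<Rightarrow> wexp" where
  "cword (Clause ls) = foldr (\<lambda>l w. Cat (literal_word l) w) ls (Bit (Num 0))"
| "cword CNone = Empty"
| "cword (CCat a b) = Cat (cword a) (cword b)"
| "cword (CIf e a) = If_w e (cword a)"
| "cword (CFor i e a) = For i e (cword a)"

lemma concat_map_concat: "concat (map f (concat xss)) = concat (map (\<lambda>xs. concat (map f xs)) xss)"
  by (induction xss) auto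

lemma wval_cword: "wval x \<rho> (cword c) = concat (map encode_clause (cval x \<rho> c))"
proof (induction c arbitrary: \<rho>)
  case (Clause ls)
  have "wval x \<rho> (foldr (\<lambda>l w. Cat (literal_word l) w) ls (Bit (Num 0))) =
      encode_clause (map (\<lambda>(e, b). (nval x \<rho> e, b)) ls)"
    by (induction ls) (auto simp: encode_clause_def)
  then show ?case by simp
next
  case (CFor i e a)
  show ?case
    by (simp only: cword.simps wval.simps cval.simps concat_map_concat CFor.IH map_map comp_def)
qed auto

definition csat :: "(nat \<Rightarrow> bool) \<Rightarrow> bool list \<Rightarrow> (nat \<Rightarrow> nat) \<Rightarrow> cexp \<Rightarrow> bool" where
  "csat \<sigma> x \<rho> c \<longleftrightarrow> (\<forall>C\<in>set (cval x \<rho> c). \<exists>(v, b)\<in>set C. \<sigma> v = b)"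

definition cbound :: "nat \<Rightarrow> bool list \<Rightarrow> (nat \<Rightarrow> nat) \<Rightarrow> cexp \<Rightarrow> bool" where
  "cbound N x \<rho> c \<longleftrightarrow> (\<forall>C\<in>set (cval x \<rho> c). fst ` set C \<subseteq> {..<N})"

fun ccats :: "cexp list \<Rightarrow> cexp" where
  "ccats [] = CNone"
| "ccats (c # cs) = CCat c (ccats cs)"

definition Horn :: "nexp list \<Rightarrow> nexp \<Rightarrow> cexp" where
  "Horn ps h = Clause ((h, True) # map (\<lambda>e. (e, False)) ps)"

lemma ball_upt: "(\<forall>j\<in>{0..<K}. P j) \<longleftrightarrow> (\<forall>j<K::nat. P j)"
  by auto

lemma csat_simps:
  "csat \<sigma> x \<rho> (Clause ls) \<longleftrightarrow> (\<exists>(e, b)\<in>set ls. \<sigma> (nval x \<rho> e) = b)"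
  "csat \<sigma> x \<rho> CNone \<longleftrightarrow> True"
  "csat \<sigma> x \<rho> (CCat a b) \<longleftrightarrow> csat \<sigma> x \<rho> a \<and> csat \<sigma> x \<rho> b"
  "csat \<sigma> x \<rho> (CIf e a) \<longleftrightarrow> (holds x \<rho> e \<longrightarrow> csat \<sigma> x \<rho> a)"
  "csat \<sigma> x \<rho> (CFor i e a) \<longleftrightarrow> (\<forall>k<nval x \<rho> e. csat \<sigma> x (\<rho>(i := k)) a)"
  by (simp_all add: csat_def case_prod_beta ball_Un ball_upt) blast

lemma csat_Horn: "csat \<sigma> x \<rho> (Horn ps h) \<longleftrightarrow> ((\<forall>e\<in>set ps. \<sigma> (nval x \<rho> e)) \<longrightarrow> \<sigma> (nval x \<rho> h))"
  by (auto simp: Horn_def csat_simps)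

lemma csat_ccats: "csat \<sigma> x \<rho> (ccats cs) \<longleftrightarrow> (\<forall>c\<in>set cs. csat \<sigma> x \<rho> c)"
  by (induction cs) (auto simp: csat_simps)

lemma csat_map: "csat \<sigma> x \<rho> (ccats (map f is)) \<longleftrightarrow> (\<forall>i\<in>set is. csat \<sigma> x \<rho> (f i))"
  by (simp add: csat_ccats)

lemma csat_upt: "csat \<sigma> x \<rho> (ccats (map f [0..<K])) \<longleftrightarrow> (\<forall>j<K. csat \<sigma> x \<rho> (f j))"
  by (auto simp: csat_ccats)

lemma cbound_simps:
  "cbound N x \<rho> (Clause ls) \<longleftrightarrow> (\<forall>l\<in>set ls. nval x \<rho> (fst l) < N)"
  "cbound N x \<rho> CNone \<longleftrightarrow> True"
  "cbound N x \<rho> (CCat a b) \<longleftrightarrow> cbound N x \<rho> a \<and> cbound N x \<rho> b"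
  "cbound N x \<rho> (CIf e a) \<longleftrightarrow> (holds x \<rho> e \<longrightarrow> cbound N x \<rho> a)"
  "cbound N x \<rho> (CFor i e a) \<longleftrightarrow> (\<forall>k<nval x \<rho> e. cbound N x (\<rho>(i := k)) a)"
  by (simp_all add: cbound_def case_prod_beta ball_Un ball_upt image_image image_subset_iff) blast

lemma cbound_Horn: "cbound N x \<rho> (Horn ps h) \<longleftrightarrow> nval x \<rho> h < N \<and> (\<forall>e\<in>set ps. nval x \<rho> e < N)"
  by (auto simp: Horn_def cbound_simps)

lemma cbound_ccats: "cbound N x \<rho> (ccats cs) \<longleftrightarrow> (\<forall>c\<in>set cs. cbound N x \<rho> c)"
  by (induction cs) (auto simp: cbound_simps)

lemma cbound_map: "cbound N x \<rho> (ccats (map f is)) \<longleftrightarrow> (\<forall>i\<in>set is. cbound N x \<rho> (f i))"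
  by (simp add: cbound_ccats)

lemma cbound_upt: "cbound N x \<rho> (ccats (map f [0..<K])) \<longleftrightarrow> (\<forall>j<K. cbound N x \<rho> (f j))"
  by (auto simp: cbound_ccats)

text \<open>The second factor must not depend on variable 9.\<close>
definition Mul :: "nexp \<Rightarrow> nexp \<Rightarrow> nexp" where
  "Mul a b = Sum 9 a b"

lemma nval_Mul: "(\<And>k. nval x (\<rho>(9 := k)) b = nval x \<rho> b) \<Longrightarrow> nval x \<rho> (Mul a b) = nval x \<rho> a * nval x \<rho> b"
  by (simp add: Mul_def)

text \<open>Horner's scheme in variable 0, the input length.\<close>

lemma poly_expressible: "\<exists>e. \<forall>x \<rho>. nval x \<rho> e = poly (p :: nat poly) (\<rho> 0)"
proof (induction p)
  case 0
  have "\<forall>x \<rho>. nval x \<rho> (Num 0) = poly (0 :: nat poly) (\<rho> 0)" by simp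
  then show ?case by blast
next
  case (pCons a p)
  then obtain e where e: "\<forall>x \<rho>. nval x \<rho> e = poly p (\<rho> 0)" by blast
  then have "\<forall>x \<rho>. nval x \<rho> (Add (Num a) (Mul (Var 0) e)) = poly (pCons a p) (\<rho> 0)"
    by (simp add: nval_Mul)
  then show ?case by blast
qed

definition kinds :: "tm \<Rightarrow> kind set" where
  "kinds M = KState ` {..<tm_states M} \<union> KHead ` {..<tm_tapes M} \<union>
     case_prod KCell ` ({..<tm_tapes M} \<times> {..<tm_symbols M}) \<union>
     case_prod KRead ` ({..<tm_tapes M} \<times> {..<tm_symbols M}) \<union>
     case_prod KStep ` ({..<tm_states M} \<times> set (List.n_lists (tm_tapes M) [0..<tm_symbols M]))"

lemma finite_kinds: "finite (kinds M)"
  unfolding kinds_def by (intro finite_UnI finite_imageI finite_cartesian_product) auto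

lemma kinds_simps:
  "KState q \<in> kinds M \<longleftrightarrow> q < tm_states M"
  "KHead j \<in> kinds M \<longleftrightarrow> j < tm_tapes M"
  "KCell j a \<in> kinds M \<longleftrightarrow> j < tm_tapes M \<and> a < tm_symbols M"
  "KRead j a \<in> kinds M \<longleftrightarrow> j < tm_tapes M \<and> a < tm_symbols M"
  "KStep q rs \<in> kinds M \<longleftrightarrow> q < tm_states M \<and> rs \<in> set (List.n_lists (tm_tapes M) [0..<tm_symbols M])"
  unfolding kinds_def by auto

lemma shift_le: "shift d \<le> 2"
  by (cases d) auto

lemma n_lists_nth: "rs \<in> set (List.n_lists K [0..<G]) \<Longrightarrow> j < K \<Longrightarrow> rs ! j < G"
  using nth_mem[of j rs] by (auto simp: set_n_lists subset_iff)

lemma wf_next_of_n_lists: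
  assumes "wf_tm M" "q < tm_states M" "rs \<in> set (List.n_lists (tm_tapes M) [0..<tm_symbols M])"
  shows "fst (next_of M q rs) < tm_states M"
    "j < tm_tapes M \<Longrightarrow> fst (snd (next_of M q rs) ! j) < tm_symbols M"
proof -
  have rs: "length rs = tm_tapes M" "set rs \<subseteq> {..<tm_symbols M}"
    using assms(3) by (auto simp: set_n_lists)
  show "fst (next_of M q rs) < tm_states M" by (rule wf_next_of[OF assms(1,2) rs])
  assume "j < tm_tapes M"
  then have "snd (next_of M q rs) ! j \<in> set (snd (next_of M q rs))"
    using wf_next_of(2)[OF assms(1,2) rs] by (intro nth_mem) simp
  then show "fst (snd (next_of M q rs) ! j) < tm_symbols M"
    using wf_next_of(3)[OF assms(1,2) rs] by auto
qed

text \<open>A tableau consults only facts of kinds belonging to \<open>M\<close> at positions below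
  \<open>2 * T + 3\<close>. This is what allows an assignment of variables to stand for the facts of
  a run.\<close>

lemma tableau_cong:
  assumes M: "wf_tm M" and tab: "tableau M x Y T \<Phi>"
    and eq: "\<And>\<kappa> t p. \<kappa> \<in> kinds M \<Longrightarrow> p < 2 * T + 3 \<Longrightarrow> \<Psi> \<kappa> t p = \<Phi> \<kappa> t p"
  shows "tableau M x Y T \<Psi>"
proof -
  have sizes: "tm_start M < tm_states M" "0 < tm_tapes M" "4 \<le> tm_symbols M"
    using M by (auto simp: wf_tm_def)
  have state: "\<Psi> (KState q) t 0 = \<Phi> (KState q) t 0" if "q < tm_states M" for q t
    using that by (intro eq) (auto simp: kinds_simps)
  have head: "\<Psi> (KHead j) t p = \<Phi> (KHead j) t p" if "j < tm_tapes M" "p < 2 * T + 3" for j t p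
    using that by (intro eq) (auto simp: kinds_simps)
  have cell: "\<Psi> (KCell j a) t p = \<Phi> (KCell j a) t p" if "j < tm_tapes M" "a < tm_symbols M" "p < 2 * T + 3" for j a t p
    using that by (intro eq) (auto simp: kinds_simps)
  have read: "\<Psi> (KRead j a) t 0 = \<Phi> (KRead j a) t 0" if "j < tm_tapes M" "a < tm_symbols M" for j a t
    using that by (intro eq) (auto simp: kinds_simps)
  have stp: "\<Psi> (KStep q rs) t 0 = \<Phi> (KStep q rs) t 0"
    if "q < tm_states M" "rs \<in> set (List.n_lists (tm_tapes M) [0..<tm_symbols M])" for q rs t
    using that by (intro eq) (auto simp: kinds_simps)
  have pos: "p + 1 < 2 * T + 3" "p + 2 < 2 * T + 3" "p + shift d < 2 * T + 3" if "p < 2 * T + 1" for p d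
    using that shift_le[of d] by auto
  have T: "T + 1 < 2 * T + 3" by simp
  have init: "tableau_init M x Y T \<Phi>" and step: "\<And>t. t < T \<Longrightarrow> tableau_step M T \<Phi> t"
    and final: "tableau_final M T \<Phi>" using tab by (auto simp: tableau_def)
  have "tableau_init M x Y T \<Psi>"
    unfolding tableau_init_def
  proof (intro conjI)
    note I = init[unfolded tableau_init_def]
    show "\<Psi> (KState (tm_start M)) 0 0" using I[THEN conjunct1] sizes by (simp only: state)
    show "\<forall>j<tm_tapes M. \<Psi> (KHead j) 0 (T + 1)"
      using I[THEN conjunct2, THEN conjunct1] by (simp add: head)
    show "\<forall>j<tm_tapes M. j \<noteq> 0 \<longrightarrow> (\<forall>p<2 * T + 1. \<Psi> (KCell j 0) 0 (p + 1))"
      using I[THEN conjunct2, THEN conjunct2, THEN conjunct1] sizes by (simp add: cell)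
    have c0: "\<Psi> (KCell 0 a) 0 (p + 1) = \<Phi> (KCell 0 a) 0 (p + 1)"
      "\<Psi> (KCell 0 a) 0 (p + 2) = \<Phi> (KCell 0 a) 0 (p + 2)"
      if "p < 2 * T + 1" "a < 4" for p a
      using cell[OF sizes(2) _ pos(1)[OF that(1)]] cell[OF sizes(2) _ pos(2)[OF that(1)]] that(2) sizes(3)
      by simp_all
    have less4: "0 < (4::nat)" "1 < (4::nat)" "2 < (4::nat)" "3 < (4::nat)" by simp_all
    note c0' = c0[OF _ less4(1)] c0[OF _ less4(2)] c0[OF _ less4(3)] c0[OF _ less4(4)]
    show "\<forall>p<2 * T + 1.
        (p < T \<longrightarrow> \<Psi> (KCell 0 0) 0 (p + 1)) \<and>
        (T \<le> p \<and> p < T + length x \<and> word_cells x (int (p - T)) = 1 \<longrightarrow> \<Psi> (KCell 0 1) 0 (p + 1)) \<and>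
        (T \<le> p \<and> p < T + length x \<and> word_cells x (int (p - T)) = 2 \<longrightarrow> \<Psi> (KCell 0 2) 0 (p + 1)) \<and>
        (p = T + length x \<longrightarrow> \<Psi> (KCell 0 3) 0 (p + 1)) \<and>
        (T + length x < p \<and> p \<le> T + length x + Y \<longrightarrow>
          \<Psi> (KCell 0 0) 0 (p + 1) \<or> \<Psi> (KCell 0 1) 0 (p + 1) \<or> \<Psi> (KCell 0 2) 0 (p + 1)) \<and>
        (T + length x < p \<and> p < T + length x + Y \<longrightarrow>
          \<Psi> (KCell 0 0) 0 (p + 1) \<longrightarrow> \<Psi> (KCell 0 0) 0 (p + 2)) \<and>
        (T + length x + Y < p \<longrightarrow> \<Psi> (KCell 0 0) 0 (p + 1))"
      by (rule allI, rule impI, simp only: c0')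
        (rule I[THEN conjunct2, THEN conjunct2, THEN conjunct2, THEN spec, THEN mp])
  qed
  moreover have "tableau_step M T \<Psi> t" if "t < T" for t
    unfolding tableau_step_def
  proof (intro conjI allI impI ballI)
    note S = step[OF that, unfolded tableau_step_def]
    {
      fix j a p assume a: "j < tm_tapes M" "a < tm_symbols M" "p < 2 * T + 1"
        "\<Psi> (KHead j) t (p + 1) \<and> \<Psi> (KCell j a) t (p + 1)"
      show "\<Psi> (KRead j a) t 0"
        using S[THEN conjunct1, THEN spec, THEN mp, OF a(1), THEN spec, THEN mp, OF a(2), THEN spec, THEN mp, OF a(3)] a
        by (simp add: head[OF _ pos(1)] cell[OF _ _ pos(1)] read del: add_Suc_right One_nat_def)
    next
      fix q rs assume a: "q < tm_states M" "rs \<in> set (List.n_lists (tm_tapes M) [0..<tm_symbols M])"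
      note S2 = S[THEN conjunct2, THEN conjunct1, THEN spec, THEN mp, OF a(1), THEN bspec, OF a(2)]
      show "\<Psi> (KStep q rs) t 0" if "\<Psi> (KState q) t 0 \<and> (\<forall>j<tm_tapes M. \<Psi> (KRead j (rs ! j)) t 0)"
        using S2[THEN conjunct1] that a n_lists_nth[OF a(2)] by (simp add: state read stp)
      show "\<Psi> (KState (fst (next_of M q rs))) (t + 1) 0" if "\<Psi> (KStep q rs) t 0"
        using S2[THEN conjunct2, THEN conjunct1] that a wf_next_of_n_lists(1)[OF M a] by (simp add: state stp)
      fix j p assume b: "j < tm_tapes M" "p < 2 * T + 1"
      note S3 = S2[THEN conjunct2, THEN conjunct2, THEN spec, THEN mp, OF b(1), THEN spec, THEN mp, OF b(2)]
      show "\<Psi> (KHead j) (t + 1) (p + shift (snd (snd (next_of M q rs) ! j)))"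
        if "\<Psi> (KStep q rs) t 0 \<and> \<Psi> (KHead j) t (p + 1)"
        using S3[THEN conjunct1] that stp[OF a] head[OF b(1) pos(1)[OF b(2)]] head[OF b(1) pos(3)[OF b(2)]]
        by simp
      show "\<Psi> (KCell j (fst (snd (next_of M q rs) ! j))) (t + 1) (p + 1)"
        if "\<Psi> (KStep q rs) t 0 \<and> \<Psi> (KHead j) t (p + 1)"
        using S3[THEN conjunct2] that stp[OF a] head[OF b(1) pos(1)[OF b(2)]]
          cell[OF b(1) wf_next_of_n_lists(2)[OF M a b(1)] pos(1)[OF b(2)]]
        by simp
    next
      fix j a p p' assume a: "j < tm_tapes M" "a < tm_symbols M" "p < 2 * T + 1" "p' < 2 * T + 1" "p \<noteq> p'"
        "\<Psi> (KCell j a) t (p + 1) \<and> \<Psi> (KHead j) t (p' + 1)"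
      show "\<Psi> (KCell j a) (t + 1) (p + 1)"
        using S[THEN conjunct2, THEN conjunct2, THEN spec, THEN mp, OF a(1), THEN spec, THEN mp, OF a(2),
            THEN spec, THEN mp, OF a(3), THEN spec, THEN mp, OF a(4), THEN mp, OF a(5)]
          a(6) head[OF a(1) pos(1)[OF a(4)]] cell[OF a(1,2) pos(1)[OF a(3)]]
        by simp
    }
  qed
  moreover have "tableau_final M T \<Psi>"
    using final unfolding tableau_final_def by (simp add: state)
  ultimately show ?thesis unfolding tableau_def by blast
qed

section \<open>The tableau formula of a fixed verifier\<close>

locale cook_levin =
  fixes M :: tm and Te Ye :: nexp and T Y :: "nat \<Rightarrow> nat" and \<iota> :: "kind \<Rightarrow> nat" and c :: nat
  assumes M: "wf_tm M"
    and Te: "\<And>x \<rho>. nval x \<rho> Te = T (\<rho> 0)" and Ye: "\<And>x \<rho>. nval x \<rho> Ye = Y (\<rho> 0)"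
    and inj: "inj_on \<iota> (kinds M)" and less: "\<And>\<kappa>. \<kappa> \<in> kinds M \<Longrightarrow> \<iota> \<kappa> < c"
begin

text \<open>A mixed-radix number with digits kind, position and time. The radix
  \<open>2 * T n + 3\<close> leaves room for a head that steps out of the window by one cell on
  either side.\<close>

definition var :: "nat \<Rightarrow> kind \<Rightarrow> nat \<Rightarrow> nat \<Rightarrow> nat" where
  "var n \<kappa> t p = \<iota> \<kappa> + c * (p + t * (2 * T n + 3))"

definition nvars_of :: "nat \<Rightarrow> nat" where
  "nvars_of n = c * ((T n + 1) * (2 * T n + 3))"

lemma var_less:
  assumes "\<kappa> \<in> kinds M" "t \<le> T n" "p < 2 * T n + 3"
  shows "var n \<kappa> t p < nvars_of n"
proof -
  let ?P = "2 * T n + 3"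
  have "var n \<kappa> t p < c * (p + t * ?P) + c" using less[OF assms(1)] by (simp add: var_def)
  also have "\<dots> = c * (p + t * ?P + 1)" by simp
  also have "p + t * ?P + 1 \<le> (t + 1) * ?P" using assms(3) by simp
  then have "c * (p + t * ?P + 1) \<le> c * ((t + 1) * ?P)" by (rule mult_le_mono2)
  also have "\<dots> \<le> nvars_of n"
    unfolding nvars_of_def using assms(2) by (intro mult_le_mono) auto
  finally show ?thesis .
qed

lemma var_inj:
  assumes "\<kappa> \<in> kinds M" "\<kappa>' \<in> kinds M" "p < 2 * T n + 3" "p' < 2 * T n + 3"
    and "var n \<kappa> t p = var n \<kappa>' t' p'"
  shows "\<kappa> = \<kappa>' \<and> t = t' \<and> p = p'"
proof -
  let ?P = "2 * T n + 3"
  have l: "\<iota> \<kappa> < c" "\<iota> \<kappa>' < c" using less assms by auto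
  have "var n \<kappa> t p mod c = \<iota> \<kappa>" "var n \<kappa>' t' p' mod c = \<iota> \<kappa>'" using l by (simp_all add: var_def)
  then have 1: "\<kappa> = \<kappa>'" using inj assms by (auto dest: inj_onD)
  have "var n \<kappa> t p div c = p + t * ?P" "var n \<kappa>' t' p' div c = p' + t' * ?P"
    using l by (simp_all add: var_def)
  then have e: "p + t * ?P = p' + t' * ?P" using assms(5) by simp
  have "(p + t * ?P) mod ?P = p" "(p' + t' * ?P) mod ?P = p'" using assms by simp_all
  then have 2: "p = p'" using e by simp
  with e have "t * ?P = t' * ?P" by simp
  then have "t = t'" by simp
  with 1 2 show ?thesis by simp
qed

definition Fact :: "kind \<Rightarrow> nexp \<Rightarrow> nexp \<Rightarrow> nexp" where
  "Fact \<kappa> t p = Add (Num (\<iota> \<kappa>)) (Mul (Num c) (Add p (Mul t (Add (Num 3) (Add Te Te)))))"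

lemma nval_Fact:
  assumes "\<And>k. nval x (\<rho>(9 := k)) t = nval x \<rho> t" "\<And>k. nval x (\<rho>(9 := k)) p = nval x \<rho> p"
  shows "nval x \<rho> (Fact \<kappa> t p) = var (\<rho> 0) \<kappa> (nval x \<rho> t) (nval x \<rho> p)"
  unfolding Fact_def nval.simps var_def using assms by (simp add: nval_Mul Te)

abbreviation Width :: nexp where "Width \<equiv> Add (Add Te Te) (Num 1)"

abbreviation Plus :: "nat \<Rightarrow> nat \<Rightarrow> nexp" where "Plus i k \<equiv> Add (Var i) (Num k)"

abbreviation Less_n :: "nexp \<Rightarrow> nexp \<Rightarrow> nexp" where "Less_n a b \<equiv> Not_n (Le_n b a)"

abbreviation Cell0 :: "nat \<Rightarrow> nexp" where
  "Cell0 a \<equiv> Fact (KCell 0 a) (Num 0) (Plus 2 1)"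

text \<open>In this and the following formulas variable 0 is the input length, 1 the time, and 2 and
  3 are positions; 9 is reserved for products.\<close>

definition Init :: cexp where
  "Init = ccats [
     Horn [] (Fact (KState (tm_start M)) (Num 0) (Num 0)),
     ccats (map (\<lambda>j. Horn [] (Fact (KHead j) (Num 0) (Add Te (Num 1)))) [0..<tm_tapes M]),
     ccats (map (\<lambda>j. CIf (Num j) (CFor 2 Width (Horn [] (Fact (KCell j 0) (Num 0) (Plus 2 1)))))
       [0..<tm_tapes M]),
     CFor 2 Width (ccats [
       CIf (Less_n (Var 2) Te) (Horn [] (Cell0 0)),
       CIf (And_n (Le_n Te (Var 2)) (And_n (Less_n (Var 2) (Add Te (Var 0)))
         (Eq_n (Cell (Sub (Var 2) Te)) (Num 1)))) (Horn [] (Cell0 1)),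
       CIf (And_n (Le_n Te (Var 2)) (And_n (Less_n (Var 2) (Add Te (Var 0)))
         (Eq_n (Cell (Sub (Var 2) Te)) (Num 2)))) (Horn [] (Cell0 2)),
       CIf (Eq_n (Var 2) (Add Te (Var 0))) (Horn [] (Cell0 3)),
       CIf (And_n (Less_n (Add Te (Var 0)) (Var 2)) (Le_n (Var 2) (Add (Add Te (Var 0)) Ye)))
         (Clause [(Cell0 0, True), (Cell0 1, True), (Cell0 2, True)]),
       CIf (And_n (Less_n (Add Te (Var 0)) (Var 2)) (Less_n (Var 2) (Add (Add Te (Var 0)) Ye)))
         (Horn [Cell0 0] (Fact (KCell 0 0) (Num 0) (Plus 2 2))),
       CIf (Less_n (Add (Add Te (Var 0)) Ye) (Var 2)) (Horn [] (Cell0 0))])]"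

definition Step :: cexp where
  "Step = CCat
     (ccats (map (\<lambda>j. ccats (map (\<lambda>a. CFor 2 Width
        (Horn [Fact (KHead j) (Var 1) (Plus 2 1), Fact (KCell j a) (Var 1) (Plus 2 1)]
          (Fact (KRead j a) (Var 1) (Num 0)))) [0..<tm_symbols M])) [0..<tm_tapes M]))
    (CCat (ccats (map (\<lambda>q. ccats (map (\<lambda>rs.
        CCat (Horn (Fact (KState q) (Var 1) (Num 0) #
                map (\<lambda>j. Fact (KRead j (rs ! j)) (Var 1) (Num 0)) [0..<tm_tapes M])
              (Fact (KStep q rs) (Var 1) (Num 0)))
        (CCat (Horn [Fact (KStep q rs) (Var 1) (Num 0)]
              (Fact (KState (fst (next_of M q rs))) (Plus 1 1) (Num 0)))
        (ccats (map (\<lambda>j. CFor 2 Width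
           (CCat (Horn [Fact (KStep q rs) (Var 1) (Num 0), Fact (KHead j) (Var 1) (Plus 2 1)]
              (Fact (KHead j) (Plus 1 1) (Plus 2 (shift (snd (snd (next_of M q rs) ! j))))))
            (Horn [Fact (KStep q rs) (Var 1) (Num 0), Fact (KHead j) (Var 1) (Plus 2 1)]
              (Fact (KCell j (fst (snd (next_of M q rs) ! j))) (Plus 1 1) (Plus 2 1)))))
          [0..<tm_tapes M]))))
        (List.n_lists (tm_tapes M) [0..<tm_symbols M]))) [0..<tm_states M]))
     (ccats (map (\<lambda>j. ccats (map (\<lambda>a. CFor 2 Width (CFor 3 Width (CIf (Not_n (Eq_n (Var 2) (Var 3)))
        (Horn [Fact (KCell j a) (Var 1) (Plus 2 1), Fact (KHead j) (Var 1) (Plus 3 1)]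
          (Fact (KCell j a) (Plus 1 1) (Plus 2 1)))))) [0..<tm_symbols M])) [0..<tm_tapes M])))"

definition Final :: cexp where
  "Final = ccats (map (\<lambda>q. CIf (Not_n (Eq_n (Num q) (Num (tm_accept M))))
     (Clause [(Fact (KState q) Te (Num 0), False)])) [0..<tm_states M])"

definition Formula :: cexp where
  "Formula = CCat Init (CCat (CFor 1 Te Step) Final)"

lemma csat_Init:
  assumes "\<rho> 0 = length x"
  shows "csat \<sigma> x \<rho> Init \<longleftrightarrow>
    tableau_init M x (Y (length x)) (T (length x)) (\<lambda>\<kappa> t p. \<sigma> (var (length x) \<kappa> t p))"
  unfolding Init_def tableau_init_def ccats.simps csat_simps(3) csat_upt
  using assms
  by (simp add: csat_simps csat_Horn nval_Fact Te Ye not_le mult_2 del: neq0_conv)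

lemma csat_Step:
  assumes "\<rho> 0 = length x"
  shows "csat \<sigma> x \<rho> Step \<longleftrightarrow>
    tableau_step M (T (length x)) (\<lambda>\<kappa> t p. \<sigma> (var (length x) \<kappa> t p)) (\<rho> 1)"
  unfolding Step_def tableau_step_def csat_simps(3) csat_upt csat_map
  using assms
  by (simp add: csat_simps csat_Horn csat_upt nval_Fact Te mult_2 ball_upt del: neq0_conv)

lemma csat_Final:
  assumes "\<rho> 0 = length x"
  shows "csat \<sigma> x \<rho> Final \<longleftrightarrow>
    tableau_final M (T (length x)) (\<lambda>\<kappa> t p. \<sigma> (var (length x) \<kappa> t p))"
  unfolding Final_def tableau_final_def csat_upt
  using assms by (simp add: csat_simps nval_Fact Te del: neq0_conv)

lemma cbound_Init:
  assumes "\<rho> 0 = length x"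
  shows "cbound (nvars_of (length x)) x \<rho> Init"
proof -
  let ?T = "T (length x)"
  have sizes: "tm_start M < tm_states M" "0 < tm_tapes M" "0 < tm_symbols M" "1 < tm_symbols M"
    "2 < tm_symbols M" "3 < tm_symbols M"
    using M by (auto simp: wf_tm_def)
  have v: "var (length x) \<kappa> 0 p < nvars_of (length x)" if "\<kappa> \<in> kinds M" "p \<le> 2 * ?T + 2" for \<kappa> p
    using var_less[OF that(1), of 0 "length x" p] that(2) by simp
  show ?thesis
    unfolding Init_def ccats.simps cbound_simps(3) cbound_upt
    using assms sizes by (simp add: cbound_simps cbound_Horn nval_Fact Te v kinds_simps del: neq0_conv)
qed

lemma cbound_Step:
  assumes "\<rho> 0 = length x" and "\<rho> 1 < T (length x)"
  shows "cbound (nvars_of (length x)) x \<rho> Step"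
proof -
  let ?T = "T (length x)"
  have v: "var (length x) \<kappa> t p < nvars_of (length x)" if "\<kappa> \<in> kinds M" "t \<le> ?T" "p \<le> 2 * ?T + 2" for \<kappa> t p
    using var_less[OF that(1,2), of p] that(3) by simp
  have sh: "k + shift d \<le> Suc (Suc (?T + ?T))" if "k < Suc (?T + ?T)" for k d
    using shift_le[of d] that by simp
  show ?thesis
    unfolding Step_def cbound_simps(3) cbound_upt cbound_map
    using assms
    by (simp add: cbound_simps cbound_Horn cbound_upt nval_Fact Te v kinds_simps ball_upt mult_2 sh
        n_lists_nth wf_next_of_n_lists[OF M] del: neq0_conv)
qed

lemma cbound_Formula:
  assumes "\<rho> 0 = length x"
  shows "cbound (nvars_of (length x)) x \<rho> Formula"
proof -
  have "cbound (nvars_of (length x)) x \<rho> Final"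
    unfolding Final_def cbound_upt using assms
    by (simp add: cbound_simps nval_Fact Te var_less kinds_simps del: neq0_conv)
  then show ?thesis
    unfolding Formula_def cbound_simps using assms by (simp add: cbound_Init cbound_Step Te)
qed

lemma csat_Formula:
  assumes "\<rho> 0 = length x"
  shows "csat \<sigma> x \<rho> Formula \<longleftrightarrow>
    tableau M x (Y (length x)) (T (length x)) (\<lambda>\<kappa> t p. \<sigma> (var (length x) \<kappa> t p))"
  unfolding Formula_def csat_simps tableau_def
  using assms by (simp add: csat_Init csat_Step csat_Final Te)

definition Formula_word :: wexp where
  "Formula_word = Cat (Ones (Mul (Num c) (Mul (Add Te (Num 1)) (Add (Num 3) (Add Te Te)))))
     (Cat (Bit (Num 0)) (cword Formula))"

definition formula_of :: "bool list \<Rightarrow> cnf" where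
  "formula_of x = (nvars_of (length x), cval x ((\<lambda>_. 0)(0 := length x)) Formula)"

lemma wval_Formula_word:
  "wval x ((\<lambda>_. 0)(0 := length x)) Formula_word = encode_cnf (formula_of x)"
proof -
  have "nval x \<rho> (Mul (Num c) (Mul (Add Te (Num 1)) (Add (Num 3) (Add Te Te)))) = nvars_of (\<rho> 0)" for \<rho>
    by (simp add: nval_Mul Te nvars_of_def)
  then show ?thesis
    unfolding Formula_word_def formula_of_def wval.simps wval_Ones wval_cword by simp
qed

lemma formula_of_bound: "\<forall>C\<in>set (snd (formula_of x)). fst ` set C \<subseteq> {..<fst (formula_of x)}"
  using cbound_Formula[of "(\<lambda>_. 0)(0 := length x)" x] by (simp add: cbound_def formula_of_def)

lemma satisfiable_formula_of:
  assumes T: "length x + Y (length x) \<le> T (length x)"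
  shows "satisfiable (formula_of x) \<longleftrightarrow>
    (\<exists>y. length y \<le> Y (length x) \<and> fst (tm_run M (pair_word x y) (T (length x))) = tm_accept M)"
proof -
  let ?n = "length x"
  have "satisfiable (formula_of x) \<longleftrightarrow> (\<exists>\<sigma>. csat \<sigma> x ((\<lambda>_. 0)(0 := ?n)) Formula)"
    by (simp add: satisfiable_def formula_of_def csat_def)
  also have "\<dots> \<longleftrightarrow> (\<exists>\<sigma>. tableau M x (Y ?n) (T ?n) (\<lambda>\<kappa> t p. \<sigma> (var ?n \<kappa> t p)))"
    by (simp add: csat_Formula)
  also have "\<dots> \<longleftrightarrow> (\<exists>y. length y \<le> Y ?n \<and> fst (tm_run M (pair_word x y) (T ?n)) = tm_accept M)"
  proof
    assume "\<exists>\<sigma>. tableau M x (Y ?n) (T ?n) (\<lambda>\<kappa> t p. \<sigma> (var ?n \<kappa> t p))"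
    then show "\<exists>y. length y \<le> Y ?n \<and> fst (tm_run M (pair_word x y) (T ?n)) = tm_accept M"
      using tableau_sound[OF M _ T] by blast
  next
    assume "\<exists>y. length y \<le> Y ?n \<and> fst (tm_run M (pair_word x y) (T ?n)) = tm_accept M"
    then obtain y where "length y \<le> Y ?n" "fst (tm_run M (pair_word x y) (T ?n)) = tm_accept M" by blast
    then have tab: "tableau M x (Y ?n) (T ?n) (run_facts M (pair_word x y) (T ?n))"
      by (rule tableau_run_facts[OF M])
    define \<Phi> where "\<Phi> = run_facts M (pair_word x y) (T ?n)"
    \<comment> \<open>A variable is true if it codes a true fact; injectivity of \<open>var\<close>
      makes this agree with the facts in the relevant range.\<close>
    define \<sigma> where "\<sigma> v \<longleftrightarrow> (\<exists>\<kappa> t p. \<kappa> \<in> kinds M \<and> p < 2 * T ?n + 3 \<and> v = var ?n \<kappa> t p \<and> \<Phi> \<kappa> t p)" for v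
    have "\<sigma> (var ?n \<kappa> t p) = \<Phi> \<kappa> t p" if "\<kappa> \<in> kinds M" "p < 2 * T ?n + 3" for \<kappa> t p
    proof
      assume "\<sigma> (var ?n \<kappa> t p)"
      then obtain \<kappa>' t' p' where "\<kappa>' \<in> kinds M" "p' < 2 * T ?n + 3" "var ?n \<kappa> t p = var ?n \<kappa>' t' p'" "\<Phi> \<kappa>' t' p'"
        unfolding \<sigma>_def by (elim exE conjE)
      then show "\<Phi> \<kappa> t p" using var_inj[of \<kappa> \<kappa>' p ?n p' t t'] that by simp
    next
      assume "\<Phi> \<kappa> t p"
      then show "\<sigma> (var ?n \<kappa> t p)" unfolding \<sigma>_def using that by (intro exI conjI) (assumption | rule refl)+
    qed
    then have "tableau M x (Y ?n) (T ?n) (\<lambda>\<kappa> t p. \<sigma> (var ?n \<kappa> t p))"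
      using tableau_cong[OF M tab[folded \<Phi>_def], of "\<lambda>\<kappa> t p. \<sigma> (var ?n \<kappa> t p)"] by simp
    then show "\<exists>\<sigma>. tableau M x (Y ?n) (T ?n) (\<lambda>\<kappa> t p. \<sigma> (var ?n \<kappa> t p))"
      by (rule exI[of "\<lambda>\<sigma>. tableau M x (Y ?n) (T ?n) (\<lambda>\<kappa> t p. \<sigma> (var ?n \<kappa> t p))"])
  qed
  finally show ?thesis .
qed

lemma reduction:
  "\<exists>N b F. computes_within N b (\<lambda>x. encode_cnf (F x)) \<and>
    (\<forall>x. (\<forall>C\<in>set (snd (F x)). fst ` set C \<subseteq> {..<fst (F x)}) \<and>
      (length x + Y (length x) \<le> T (length x) \<longrightarrow> (satisfiable (F x) \<longleftrightarrow>
        (\<exists>y. length y \<le> Y (length x) \<and> fst (tm_run M (pair_word x y) (T (length x))) = tm_accept M))))"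
proof -
  obtain N b where "computes_within N b (\<lambda>x. wval x ((\<lambda>_. 0)(0 := length x)) Formula_word)"
    using wexp_computable by blast
  then have "computes_within N b (\<lambda>x. encode_cnf (formula_of x))"
    unfolding wval_Formula_word .
  then show ?thesis
    using formula_of_bound satisfiable_formula_of
    by (intro exI[of _ N] exI[of _ b] exI[of _ formula_of]) simp
qed

end

theorem cook_levin_reduction:
  assumes "L \<in> NP"
  shows "\<exists>M b F. computes_within M b (\<lambda>x. encode_cnf (F x)) \<and>
    (\<forall>x. (\<forall>C\<in>set (snd (F x)). fst ` set C \<subseteq> {..<fst (F x)}) \<and> (satisfiable (F x) \<longleftrightarrow> x \<in> L))"
proof -
  have "\<exists>M (p :: nat poly) (q :: nat poly). wf_tm M \<and>
     (\<forall>x y. halted M (tm_run M (pair_word x y) (poly p (length x + length y)))) \<and>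
     (\<forall>x. x \<in> L \<longleftrightarrow>
        (\<exists>y. length y \<le> poly q (length x) \<and>
           fst (tm_run M (pair_word x y) (poly p (length x + length y))) = tm_accept M))"
    using assms by (simp only: NP_def mem_Collect_eq)
  then obtain M and p q :: "nat poly" where M: "wf_tm M"
    and halt: "\<forall>x y. halted M (tm_run M (pair_word x y) (poly p (length x + length y)))"
    and L: "\<forall>x. x \<in> L \<longleftrightarrow> (\<exists>y. length y \<le> poly q (length x) \<and>
      fst (tm_run M (pair_word x y) (poly p (length x + length y))) = tm_accept M)"
    by (elim exE conjE)
  \<comment> \<open>The first summand dominates the running time for every admissible certificate,
    the second makes the window large enough for input and certificate.\<close>
  define tp where "tp = pcompose p ([:0, 1:] + q) + ([:0, 1:] + q)"
  have tp: "poly tp n = poly p (n + poly q n) + (n + poly q n)" for n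
    by (simp add: tp_def poly_pcompose)
  obtain Te where Te: "\<forall>x \<rho>. nval x \<rho> Te = poly tp (\<rho> 0)" using poly_expressible[of tp] ..
  obtain Ye where Ye: "\<forall>x \<rho>. nval x \<rho> Ye = poly q (\<rho> 0)" using poly_expressible[of q] ..
  obtain \<iota> :: "kind \<Rightarrow> nat" and c where \<iota>: "\<iota> ` kinds M = {i. i < c}" "inj_on \<iota> (kinds M)"
    using finite_imp_inj_to_nat_seg[OF finite_kinds[of M]] by (elim exE conjE)
  have "cook_levin M Te Ye (poly tp) (poly q) \<iota> c"
  proof (rule cook_levin.intro)
    show "wf_tm M" by (rule M)
    show "nval x \<rho> Te = poly tp (\<rho> 0)" for x \<rho> using Te by blast
    show "nval x \<rho> Ye = poly q (\<rho> 0)" for x \<rho> using Ye by blast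
    show "inj_on \<iota> (kinds M)" by (rule \<iota>)
    show "\<iota> \<kappa> < c" if "\<kappa> \<in> kinds M" for \<kappa> using that \<iota>(1) by blast
  qed
  from cook_levin.reduction[OF this] obtain N b F
    where F: "computes_within N b (\<lambda>x. encode_cnf (F x))"
      "\<forall>x. (\<forall>C\<in>set (snd (F x)). fst ` set C \<subseteq> {..<fst (F x)}) \<and>
      (length x + poly q (length x) \<le> poly tp (length x) \<longrightarrow> (satisfiable (F x) \<longleftrightarrow>
        (\<exists>y. length y \<le> poly q (length x) \<and>
          fst (tm_run M (pair_word x y) (poly tp (length x))) = tm_accept M)))"
    by (elim exE conjE)
  have "satisfiable (F x) \<longleftrightarrow> x \<in> L" for x
  proof -
    let ?n = "length x"
    have run: "tm_run M (pair_word x y) (poly tp ?n) = tm_run M (pair_word x y) (poly p (?n + length y))"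
      if "length y \<le> poly q ?n" for y
    proof (rule tm_run_halted_le[OF halt[rule_format]])
      have "poly p (?n + length y) \<le> poly p (?n + poly q ?n)"
        using that by (intro poly_bounded_mono[OF poly_bounded_of_poly]) simp
      then show "poly p (?n + length y) \<le> poly tp ?n" by (simp add: tp)
    qed
    have "satisfiable (F x) \<longleftrightarrow>
        (\<exists>y. length y \<le> poly q ?n \<and> fst (tm_run M (pair_word x y) (poly tp ?n)) = tm_accept M)"
      by (rule F(2)[THEN spec, THEN conjunct2, THEN mp]) (simp add: tp)
    also have "\<dots> \<longleftrightarrow> (\<exists>y. length y \<le> poly q ?n \<and>
        fst (tm_run M (pair_word x y) (poly p (?n + length y))) = tm_accept M)"
      by (rule iff_exI) (simp add: run cong: conj_cong)
    also have "\<dots> \<longleftrightarrow> x \<in> L" by (rule L[rule_format, symmetric])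
    finally show ?thesis .
  qed
  then show ?thesis
    using F by (intro exI[of _ N] exI[of _ b] exI[of _ F]) simp
qed

subsection \<open>The hardness results\<close>

theorem colouring_NP_hard:
  assumes "k \<ge> 2"
  shows "NP_hard encode_digraph (digraphs_with_fvs k) (\<lambda>D. k_colorable k (with_proj D))"
  unfolding NP_hard_def
proof
  fix L assume "L \<in> NP"
  then obtain M1 b1 F where F: "computes_within M1 b1 (\<lambda>x. encode_cnf (F x))"
    "\<forall>x. (\<forall>C\<in>set (snd (F x)). fst ` set C \<subseteq> {..<fst (F x)}) \<and> (satisfiable (F x) \<longleftrightarrow> x \<in> L)"
    using cook_levin_reduction by blast
  obtain M2 b2 G where G: "computes_within M2 b2 G"
    "\<And>\<phi>. G (encode_cnf \<phi>) = encode_digraph (gadget_digraph k \<phi>)"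
    using gadget_computable[of k] by blast
  obtain M b where "computes_within M b (\<lambda>x. G (encode_cnf (F x)))"
    using computes_within_compose[OF F(1) G(1)] by (elim exE)
  then have "poly_time_computable (\<lambda>x. encode_digraph (gadget_digraph k (F x)))"
    unfolding G(2) by (rule computes_within_poly_time)
  moreover have "\<exists>d\<in>digraphs_with_fvs k. encode_digraph (gadget_digraph k (F x)) = encode_digraph d \<and>
      (x \<in> L \<longleftrightarrow> k_colorable k (with_proj d))" for x
  proof (intro bexI conjI)
    show "x \<in> L \<longleftrightarrow> k_colorable k (with_proj (gadget_digraph k (F x)))"
      using gadget_digraph_colorable[OF assms, of "F x"] F(2) by simp
  qed (simp_all add: gadget_digraph_fvs)
  ultimately show "\<exists>f. poly_time_computable f \<and>
      (\<forall>x. \<exists>d\<in>digraphs_with_fvs k. f x = encode_digraph d \<and> (x \<in> L \<longleftrightarrow> k_colorable k (with_proj d)))"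
    by (intro exI[of _ "\<lambda>x. encode_digraph (gadget_digraph k (F x))"]) simp
qed

section \<open>Size estimates and the lower bound under ETH\<close>

lemma length_encode_cnf_le:
  assumes "\<phi> \<in> three_cnf"
  shows "length (encode_cnf \<phi>) \<le> cnf_size \<phi> + 1 + cnf_size \<phi> * (3 * (cnf_size \<phi> + 3) + 1)"
proof -
  obtain n cs where \<phi>: "\<phi> = (n, cs)" by (cases \<phi>)
  let ?s = "cnf_size \<phi>"
  have s: "n \<le> ?s" "length cs \<le> ?s" by (simp_all add: \<phi> cnf_size_def)
  have clause: "length (encode_clause C) \<le> 3 * (?s + 3) + 1" if "C \<in> set cs" for C
  proof -
    have C: "length C \<le> 3" "fst ` set C \<subseteq> {..<n}" using assms that by (auto simp: \<phi> three_cnf_def)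
    have "length (encode_literal l) \<le> ?s + 3" if "l \<in> set C" for l
    proof -
      obtain v d where l: "l = (v, d)" by (cases l)
      have "v < n" using C(2) that l by force
      then show ?thesis using l s(1) by simp
    qed
    then have "sum_list (map (\<lambda>l. length (encode_literal l)) C) \<le> sum_list (map (\<lambda>_. ?s + 3) C)"
      by (rule sum_list_mono)
    also have "\<dots> = length C * (?s + 3)" by (simp add: sum_list_triv)
    also have "\<dots> \<le> 3 * (?s + 3)" using C(1) by (rule mult_le_mono1)
    finally show ?thesis by (simp add: encode_clause_def length_concat comp_def)
  qed
  have "length (concat (map encode_clause cs)) = sum_list (map (\<lambda>C. length (encode_clause C)) cs)"
    by (simp add: length_concat comp_def)
  also have "\<dots> \<le> sum_list (map (\<lambda>_. 3 * (?s + 3) + 1) cs)"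
    using clause by (rule sum_list_mono)
  also have "\<dots> \<le> ?s * (3 * (?s + 3) + 1)"
    using s(2) by (simp add: sum_list_triv mult_le_mono del: mult_Suc_right)
  finally show ?thesis using s(1) by (simp add: \<phi>)
qed

text \<open>There are \<open>k\<close> special vertices, two vertices per variable, and at most four
  tokens per clause: three literals and the end.\<close>

lemma card_gadget_digraph_le:
  assumes "\<phi> \<in> three_cnf"
  shows "card (pverts (gadget_digraph k \<phi>)) \<le> k + 4 * cnf_size \<phi>"
proof -
  obtain n cs where \<phi>: "\<phi> = (n, cs)" by (cases \<phi>)
  have "length (tokens cs) = sum_list (map (\<lambda>C. length C + 1) cs)"
    by (simp add: tokens_def length_concat comp_def)
  also have "\<dots> \<le> sum_list (map (\<lambda>_. 4) cs)"
    using assms by (intro sum_list_mono) (auto simp: \<phi> three_cnf_def)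
  finally have "length (tokens cs) \<le> 4 * length cs" by (simp add: sum_list_triv)
  then show ?thesis by (simp add: \<phi> gadget_digraph_def gadget_vertices_def cnf_size_def)
qed

text \<open>The running maximum replaces the possibly non-monotone \<open>f\<close> by its largest
  value on all admissible vertex counts, and the cut at 0 makes the resulting power of 2 at least 1.
  Sublinearity survives: large arguments are controlled by \<open>f\<close> itself, and the finitely
  many small ones by a constant.\<close>

lemma smallo_Max:
  fixes f :: "nat \<Rightarrow> real"
  assumes f: "f \<in> o(\<lambda>n. real n)"
  shows "(\<lambda>s. max 0 (Max (f ` {..a + 4 * s}))) \<in> o(\<lambda>s. real s)"
proof (rule landau_o.smallI)
  fix c :: real assume c: "c > 0"
  have "eventually (\<lambda>n. norm (f n) \<le> c / 8 * norm (real n)) at_top"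
    using landau_o.smallD[OF f, of "c / 8"] c by simp
  then obtain N where N: "\<And>n. n \<ge> N \<Longrightarrow> f n \<le> c / 8 * real n"
    by (fastforce simp: eventually_at_top_linorder)
  define K where "K = Max (insert 0 (f ` {..N}))"
  have K: "f n \<le> K" if "n \<le> N" for n unfolding K_def using that by (intro Max_ge) auto
  have K0: "0 \<le> K" unfolding K_def by (intro Max_ge) auto
  \<comment> \<open>For such \<open>s\<close> the maximum \<open>K\<close> over small arguments is
    at most \<open>c * s\<close>, and \<open>a\<close> is at most \<open>s\<close>; then
    \<open>a + 4 * s\<close> is at most \<open>8 * s\<close>, which explains the constant
    \<open>c / 8\<close>.\<close>
  have ev: "max 0 (Max (f ` {..a + 4 * s})) \<le> c * real s" if s: "real s \<ge> real a + K / c" for s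
  proof -
    have sK: "K \<le> c * real s"
    proof -
      have "K / c \<le> real s" using s by simp
      then show ?thesis using c by (simp add: field_simps)
    qed
    have sa: "real a \<le> real s"
    proof -
      have "0 \<le> K / c" using K0 c by simp
      then show ?thesis using s by linarith
    qed
    have "f n \<le> c * real s" if n: "n \<le> a + 4 * s" for n
    proof (cases "n \<le> N")
      case True then show ?thesis using K[of n] sK by linarith
    next
      case False
      then have "f n \<le> c / 8 * real n" using N by simp
      also have "\<dots> \<le> c / 8 * (real a + 4 * real s)"
        using n c by (intro mult_left_mono) auto
      also have "\<dots> \<le> c / 8 * (8 * real s)" using sa c by (intro mult_left_mono) auto
      finally show ?thesis by simp
    qed
    then have "Max (f ` {..a + 4 * s}) \<le> c * real s" by (subst Max_le_iff) auto
    moreover have "0 \<le> c * real s" using c by simp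
    ultimately show ?thesis by simp
  qed
  have "eventually (\<lambda>s. real s \<ge> real a + K / c) at_top"
    using filterlim_real_sequentially unfolding filterlim_at_top by blast
  then show "eventually (\<lambda>s. norm (max 0 (Max (f ` {..a + 4 * s}))) \<le> c * norm (real s)) at_top"
    by eventually_elim (use ev in simp)
qed

text \<open>The machine for the reduction followed by the assumed solver decides 3-SAT. The
  polynomial time of the former adds only a logarithmic term to the exponent, and the latter sees a
  digraph of linear size.\<close>

theorem colouring_ETH_hard:
  assumes k: "k \<ge> 2" and ETH
  shows "\<not> solvable_subexp encode_digraph (digraphs_with_fvs k)
          (\<lambda>D. k_colorable k (with_proj D)) (\<lambda>D. card (pverts D))"
proof
  assume "solvable_subexp encode_digraph (digraphs_with_fvs k)
          (\<lambda>D. k_colorable k (with_proj D)) (\<lambda>D. card (pverts D))"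
  then obtain f :: "nat \<Rightarrow> real" and S where f: "f \<in> o(\<lambda>n. real n)" and S: "wf_tm S"
    and solve: "\<forall>d\<in>digraphs_with_fvs k. \<exists>t. real t \<le> 2 powr f (card (pverts d)) \<and>
      halted S (tm_run S (bits (encode_digraph d)) t) \<and>
      (fst (tm_run S (bits (encode_digraph d)) t) = tm_accept S \<longleftrightarrow> k_colorable k (with_proj d))"
    unfolding solvable_subexp_def solvable_in_time_def by (elim exE conjE)
  obtain M b G where G: "computes_within M b G"
    "\<And>\<phi>. G (encode_cnf \<phi>) = encode_digraph (gadget_digraph k \<phi>)"
    using gadget_computable[of k] by blast
  have M: "wf_tm M" and b: "poly_bounded b" using G(1) by (auto simp: computes_within_def)
  define B where "B s = s + 1 + s * (3 * (s + 3) + 1)" for s :: nat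
  have "poly_bounded (\<lambda>s. b (B s) + 1)"
    unfolding B_def using b
    by (intro poly_bounded_intros poly_bounded_compose[of b "\<lambda>s. s + 1 + s * (3 * (s + 3) + 1)"])
  then obtain e where e: "\<And>s. b (B s) + 1 \<le> (s + 2) ^ e" by (auto simp: poly_bounded_def)
  define m where "m s = max 0 (Max (f ` {..k + 4 * s}))" for s
  \<comment> \<open>The summands pay for the sum of two time bounds, for the polynomial
    \<open>(s + 2) ^ e\<close> written as a power of 2, and for the solver.\<close>
  define h where "h s = 1 + real e * log 2 (real s + 2) + m s" for s :: nat
  have "(\<lambda>s. 1 + real e * log 2 (real s + 2)) \<in> o(\<lambda>s. real s)" by real_asymp
  then have h: "h \<in> o(\<lambda>s. real s)"
    unfolding h_def m_def using smallo_Max[OF f, of k] by (rule sum_in_smallo)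
  have "\<exists>t. real t \<le> 2 powr h (cnf_size \<phi>) \<and>
      halted (compose_tm M S) (tm_run (compose_tm M S) (bits (encode_cnf \<phi>)) t) \<and>
      (fst (tm_run (compose_tm M S) (bits (encode_cnf \<phi>)) t) = tm_accept (compose_tm M S) \<longleftrightarrow> satisfiable \<phi>)"
    if \<phi>: "\<phi> \<in> three_cnf" for \<phi>
  proof -
    let ?s = "cnf_size \<phi>" and ?D = "gadget_digraph k \<phi>"
    let ?x = "encode_cnf \<phi>"
    obtain t2 where t2: "real t2 \<le> 2 powr f (card (pverts ?D))"
      "halted S (tm_run S (bits (encode_digraph ?D)) t2)"
      "fst (tm_run S (bits (encode_digraph ?D)) t2) = tm_accept S \<longleftrightarrow> k_colorable k (with_proj ?D)"
      using bspec[OF solve gadget_digraph_fvs[of k \<phi>]] by (elim exE conjE)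
    have run: "halted M (tm_run M (bits ?x) (b (length ?x)))"
      "hd (snd (tm_run M (bits ?x) (b (length ?x)))) = word_tape (bits (encode_digraph ?D))"
      using G(1) G(2)[of \<phi>] by (auto simp: computes_within_def)
    obtain t where t: "t \<le> b (length ?x) + t2 + 1"
      "halted (compose_tm M S) (tm_run (compose_tm M S) (bits ?x) t)"
      "fst (tm_run (compose_tm M S) (bits ?x) t) = tm_accept (compose_tm M S) \<longleftrightarrow>
         fst (tm_run S (bits (encode_digraph ?D)) t2) = tm_accept S"
      using compose_tm_run[OF M S set_bits_symbols[OF M] set_bits_symbols[OF S] run t2(2)]
      by (elim exE conjE)
    have "k_colorable k (with_proj ?D) \<longleftrightarrow> satisfiable \<phi>"
    proof (rule gadget_digraph_colorable[OF k])
      show "\<forall>C\<in>set (snd \<phi>). fst ` set C \<subseteq> {..<fst \<phi>}"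
        using \<phi> by (auto simp: three_cnf_def case_prod_beta)
    qed
    moreover have "real t \<le> 2 powr h ?s"
    proof -
      have "b (length ?x) \<le> b (B ?s)"
        using length_encode_cnf_le[OF \<phi>] by (intro poly_bounded_mono[OF b]) (simp add: B_def)
      then have "t \<le> (?s + 2) ^ e + t2" using t(1) e[of ?s] by linarith
      then have 1: "real t \<le> (real ?s + 2) ^ e + real t2"
        by (metis of_nat_add of_nat_le_iff of_nat_numeral of_nat_power)
      have "f (card (pverts ?D)) \<le> m ?s"
        unfolding m_def using card_gadget_digraph_le[OF \<phi>, of k] by (intro max.coboundedI2 Max_ge) auto
      then have 2: "real t2 \<le> 2 powr m ?s" using t2(1) by (meson order_trans powr_mono one_le_numeral)
      have 3: "1 \<le> (real ?s + 2) ^ e" by simp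
      have 4: "1 \<le> 2 powr m ?s" by (simp add: m_def ge_one_powr_ge_zero)
      have "real t \<le> (real ?s + 2) ^ e + 2 powr m ?s" using 1 2 by linarith
      \<comment> \<open>For \<open>a\<close> and \<open>b\<close> at least 1 the product of
        \<open>a - 1\<close> and \<open>b - 1\<close> is nonnegative, so \<open>a + b\<close> is at
        most \<open>a * b + 1\<close>, hence at most twice the product.\<close>
      also have "\<dots> \<le> 2 * ((real ?s + 2) ^ e * 2 powr m ?s)"
      proof -
        have "0 \<le> ((real ?s + 2) ^ e - 1) * (2 powr m ?s - 1)" using 3 4 by simp
        moreover have "1 \<le> (real ?s + 2) ^ e * 2 powr m ?s" using 3 4 by (metis mult_mono' mult_1 zero_le_one)
        ultimately show ?thesis by (simp add: algebra_simps)
      qed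
      also have "(real ?s + 2) ^ e = 2 powr (real e * log 2 (real ?s + 2))"
      proof -
        have "2 powr (real e * log 2 (real ?s + 2)) = (2 powr log 2 (real ?s + 2)) powr real e"
          by (simp only: powr_powr mult.commute)
        also have "\<dots> = (real ?s + 2) ^ e" by (simp add: powr_realpow)
        finally show ?thesis by simp
      qed
      also have "2 * (2 powr (real e * log 2 (real ?s + 2)) * 2 powr m ?s) = 2 powr h ?s"
        by (simp add: h_def powr_add)
      finally show ?thesis .
    qed
    ultimately show ?thesis using t t2(3) by blast
  qed
  then have "solvable_in_time encode_cnf three_cnf satisfiable (\<lambda>\<phi>. 2 powr h (cnf_size \<phi>))"
    unfolding solvable_in_time_def using wf_compose_tm[OF M S] by blast
  then have "solvable_subexp encode_cnf three_cnf satisfiable cnf_size"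
    unfolding solvable_subexp_def using h by blast
  then show False using \<open>ETH\<close> by (simp add: ETH_def)
qed

theorem theorem4:
  fixes k :: nat
  assumes "k \<ge> 2"
  shows "NP_hard encode_digraph (digraphs_with_fvs k) (\<lambda>D. k_colorable k (with_proj D)) \<and>
    (ETH \<longrightarrow>
      \<not> solvable_subexp encode_digraph (digraphs_with_fvs k)
          (\<lambda>D. k_colorable k (with_proj D)) (\<lambda>D. card (pverts D)))"
  using colouring_NP_hard[OF assms] colouring_ETH_hard[OF assms] by blast

end
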